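(* Let $p\ge1$ and suppose $\{W_{i,n},1\le i\le p;\ A_{i,n},1\le i\le p\}$ are independent $n\times n$ real symmetric patterned random matrices such that all input variables, within and across all the matrices, are independent real random variables with mean $0$, variance $1$ and, for every $m$, uniformly bounded $m$-th absolute moments, where the $W_{i,n}$ are Wigner matrices and the $A_{i,n}$ are any of Toeplitz, Hankel, Symmetric Circulant or Reverse Circulant matrices. Then $\{W_{i,n},1\le i\le p\}$ and $\{A_{i,n},1\le i\le p\}$ are free in the limit; that is, $\{\frac1{\sqrt n}W_{i,n},\frac1{\sqrt n}A_{i,n}:1\le i\le p\}$ converges jointly in distribution (with respect to $\varphi_2$, and almost surely with respect to $\varphi_1$) to a family $\{s_i,a_i:1\le i\le p\}$ in some non-commutative probability space $(\mathcal A,\varphi)$ such that the unital subalgebras generated by $\{s_1,\dots,s_p\}$ and by $\{a_1,\dots,a_p\}$ are free.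
   Context: A patterned matrix with (symmetric) link function $L:\{1,\dots,n\}^2\to\mathbb Z^d$ ($d=1$ or $2$; dependence on $n$ suppressed) and input sequence $\{x(t)\}$ of real random variables is the $n\times n$ real symmetric matrix with $(i,j)$ entry $x(L(i,j))$. The link functions are: Wigner $L(i,j)=(\min(i,j),\max(i,j))$; Toeplitz $L(i,j)=|i-j|$; Hankel $L(i,j)=i+j$; Reverse Circulant $L(i,j)=(i+j)\bmod n$; Symmetric Circulant $L(i,j)=n/2-|n/2-|i-j||$. A non-commutative probability space is a pair $(\mathcal A,\varphi)$ with $\mathcal A$ a unital algebra over $\mathbb C$ and $\varphi:\mathcal A\to\mathbb C$ linear with $\varphi(1)=1$. On $n\times n$ random matrices whose entries have all moments, $\varphi_1(A)=\frac1n\mathrm{Tr}(A)$ and $\varphi_2(A)=\frac1nE[\mathrm{Tr}(A)]$. Joint convergence in distribution means convergence of all joint moments (values of the functional on all monomials) to the corresponding joint moments in $(\mathcal A,\varphi)$. Unital subalgebras $\{\mathcal A_i\}_{i\in I}$ of $\mathcal A$ are free if $\varphi(a_1\cdots a_n)=0$ whenever $\varphi(a_j)=0$, $a_j\in\mathcal A_{i_j}$ and $i_j\ne i_{j+1}$ for all $j$. *)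

theory Defs
  imports
    "HOL-Probability.Probability"
    "HOL-Algebra.Subrings"
    "HOL-Algebra.Algebraic_Closure_Type"
    "Jordan_Normal_Form.Matrix"
begin

section \<open>Link functions and patterned matrices\<close>

text \<open>A link function takes the dimension n first and then indices i, j in 1..n.\<close>

definition wigner_link :: "nat \<Rightarrow> nat \<Rightarrow> nat \<Rightarrow> int \<times> int" where
  "wigner_link n i j = (int (min i j), int (max i j))"

definition toeplitz_link :: "nat \<Rightarrow> nat \<Rightarrow> nat \<Rightarrow> int" where
  "toeplitz_link n i j = \<bar>int i - int j\<bar>"

definition hankel_link :: "nat \<Rightarrow> nat \<Rightarrow> nat \<Rightarrow> int" where
  "hankel_link n i j = int i + int j"

definition reverse_circulant_link :: "nat \<Rightarrow> nat \<Rightarrow> nat \<Rightarrow> int" where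
  "reverse_circulant_link n i j = (int i + int j) mod int n"

text \<open>The real number under the floor is an integer
  (see \<open>of_int_symmetric_circulant_link\<close> below), so the floor is only a type conversion.\<close>

definition symmetric_circulant_link :: "nat \<Rightarrow> nat \<Rightarrow> nat \<Rightarrow> int" where
  "symmetric_circulant_link n i j =
     \<lfloor>real n / 2 - \<bar>real n / 2 - \<bar>real i - real j\<bar>\<bar>\<rfloor>"

lemma of_int_symmetric_circulant_link:
  "real_of_int (symmetric_circulant_link n i j) =
     real n / 2 - \<bar>real n / 2 - \<bar>real i - real j\<bar>\<bar>"
proof -
  have "real n / 2 - \<bar>real n / 2 - \<bar>real i - real j\<bar>\<bar> =
      real_of_int (min \<bar>int i - int j\<bar> (int n - \<bar>int i - int j\<bar>))"
    by (auto simp: min_def abs_if)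
  then show ?thesis
    unfolding symmetric_circulant_link_def by simp
qed

text \<open>Matrices are indexed from 0 in the library, hence the shift by one.\<close>

definition patterned_matrix ::
  "(nat \<Rightarrow> nat \<Rightarrow> nat \<Rightarrow> 't) \<Rightarrow> nat \<Rightarrow> ('t \<Rightarrow> real) \<Rightarrow> real mat" where
  "patterned_matrix L n x = mat n n (\<lambda>(i, j). x (L n (Suc i) (Suc j)))"

text \<open>The labels of the input variables that occur in the matrix for at least one dimension.\<close>

definition link_range :: "(nat \<Rightarrow> nat \<Rightarrow> nat \<Rightarrow> 't) \<Rightarrow> 't set" where
  "link_range L = {L n i j | n i j. i \<in> {1..n} \<and> j \<in> {1..n}}"

text \<open>Joint index set of all inputs of p Wigner matrices (left summand, pairs of a matrix number
  and a label) and of p matrices with links L 1, ..., L p (right summand).\<close>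

definition input_index ::
  "nat \<Rightarrow> (nat \<Rightarrow> nat \<Rightarrow> nat \<Rightarrow> nat \<Rightarrow> int) \<Rightarrow> (nat \<times> (int \<times> int) + nat \<times> int) set" where
  "input_index p L =
     Sum_Type.Plus (SIGMA i:{1..p}. link_range wigner_link) (SIGMA i:{1..p}. link_range (L i))"

definition input_var ::
  "(nat \<Rightarrow> int \<times> int \<Rightarrow> 'a \<Rightarrow> real) \<Rightarrow> (nat \<Rightarrow> int \<Rightarrow> 'a \<Rightarrow> real) \<Rightarrow>
    nat \<times> (int \<times> int) + nat \<times> int \<Rightarrow> 'a \<Rightarrow> real" where
  "input_var x y k = (case k of Inl (i, t) \<Rightarrow> x i t | Inr (i, t) \<Rightarrow> y i t)"

text \<open>\<open>Inl i\<close> is the i-th scaled Wigner matrix, \<open>Inr i\<close> the i-th scaled matrix with link \<open>L i\<close>.\<close>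

definition scaled_matrix ::
  "(nat \<Rightarrow> nat \<Rightarrow> nat \<Rightarrow> nat \<Rightarrow> int) \<Rightarrow>
    (nat \<Rightarrow> int \<times> int \<Rightarrow> 'a \<Rightarrow> real) \<Rightarrow> (nat \<Rightarrow> int \<Rightarrow> 'a \<Rightarrow> real) \<Rightarrow>
    nat \<Rightarrow> nat + nat \<Rightarrow> 'a \<Rightarrow> real mat" where
  "scaled_matrix L x y n k \<omega> = (1 / sqrt (real n)) \<cdot>\<^sub>m
     (case k of
        Inl i \<Rightarrow> patterned_matrix wigner_link n (\<lambda>t. x i t \<omega>)
      | Inr i \<Rightarrow> patterned_matrix (L i) n (\<lambda>t. y i t \<omega>))"

section \<open>Moments of random matrices\<close>

definition mat_trace :: "'b :: comm_monoid_add mat \<Rightarrow> 'b" where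
  "mat_trace B = (\<Sum>i<dim_row B. B $$ (i, i))"

definition mat_monomial :: "nat \<Rightarrow> ('k \<Rightarrow> real mat) \<Rightarrow> 'k list \<Rightarrow> real mat" where
  "mat_monomial n B ks = foldr (\<lambda>k C. B k * C) ks (1\<^sub>m n)"

definition phi1 :: "nat \<Rightarrow> real mat \<Rightarrow> real" where
  "phi1 n B = mat_trace B / real n"

definition phi2 :: "'a measure \<Rightarrow> nat \<Rightarrow> ('a \<Rightarrow> real mat) \<Rightarrow> real" where
  "phi2 M n B = (\<integral>\<omega>. mat_trace (B \<omega>) \<partial>M) / real n"

section \<open>Non-commutative probability spaces and freeness\<close>

text \<open>The locale \<open>algebra\<close> of the library demands a commutative multiplication, hence the following
  one. The zero algebra is ruled out as soon as there is a \<open>\<phi>\<close> as in \<open>nc_prob_space\<close>.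
  An existential statement about such algebras has to fix the type of their elements. The type
  \<open>'k list \<Rightarrow> complex\<close> loses no generality for families indexed by a countable type
  \<open>'k\<close>: it contains the free algebra on \<open>'k\<close>, and by cardinality every quotient of it embeds.\<close>

abbreviation complex_ring :: "complex ring" where
  "complex_ring \<equiv> ring_of_type_algebra"

locale unital_complex_algebra = module complex_ring A + ring A for A (structure) +
  assumes smult_mult_left:
      "\<lbrakk>x \<in> carrier A; y \<in> carrier A\<rbrakk> \<Longrightarrow> (c \<odot> x) \<otimes> y = c \<odot> (x \<otimes> y)"
    and smult_mult_right:
      "\<lbrakk>x \<in> carrier A; y \<in> carrier A\<rbrakk> \<Longrightarrow> x \<otimes> (c \<odot> y) = c \<odot> (x \<otimes> y)"

locale nc_prob_space = unital_complex_algebra A for A (structure) +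
  fixes \<phi> :: "_ \<Rightarrow> complex"
  assumes phi_add: "\<lbrakk>x \<in> carrier A; y \<in> carrier A\<rbrakk> \<Longrightarrow> \<phi> (x \<oplus> y) = \<phi> x + \<phi> y"
    and phi_smult: "x \<in> carrier A \<Longrightarrow> \<phi> (c \<odot> x) = c * \<phi> x"
    and phi_one: "\<phi> \<one> = 1"

definition alg_monomial :: "(complex, 'b) module \<Rightarrow> ('k \<Rightarrow> 'b) \<Rightarrow> 'k list \<Rightarrow> 'b" where
  "alg_monomial A b ks = foldr (\<lambda>k c. b k \<otimes>\<^bsub>A\<^esub> c) ks \<one>\<^bsub>A\<^esub>"

definition unital_subalgebra :: "(complex, 'b) module \<Rightarrow> 'b set \<Rightarrow> bool" where
  "unital_subalgebra A B \<longleftrightarrow> subring B A \<and> submodule B complex_ring A"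

definition generated_subalgebra :: "(complex, 'b) module \<Rightarrow> 'b set \<Rightarrow> 'b set" where
  "generated_subalgebra A S = \<Inter>{B. unital_subalgebra A B \<and> S \<subseteq> B}"

text \<open>The word of centred elements has to be non-empty since the empty product \<open>\<one>\<close>
  is mapped to 1.\<close>

definition free_subalgebras ::
  "(complex, 'b) module \<Rightarrow> ('b \<Rightarrow> complex) \<Rightarrow> 'i set \<Rightarrow> ('i \<Rightarrow> 'b set) \<Rightarrow> bool" where
  "free_subalgebras A \<phi> I B \<longleftrightarrow>
     (\<forall>i\<in>I. unital_subalgebra A (B i)) \<and>
     (\<forall>m is a. m \<ge> 1 \<and>
        (\<forall>j\<in>{1..m}. is j \<in> I \<and> a j \<in> B (is j) \<and> \<phi> (a j) = 0) \<and>
        (\<forall>j\<in>{1..<m}. is j \<noteq> is (Suc j)) \<longrightarrow>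
        \<phi> (alg_monomial A a [1..<Suc m]) = 0)"

end

theory Submission
  imports Defs
begin

text \<open>Expanding the trace of a monomial gives a sum over closed walks, each weighted by the expectation
  of the product of the inputs at its edges. A vertex of a walk is determined up to two choices by
  the previous vertex and the label of the edge between them, so walks are counted by the number of
  their distinct labels. Up to vanishing terms only walks in which every label occurs exactly twice
  contribute, and quadruples of walks that are linked by common labels are so few that the fourth
  central moment of a normalised trace is \<open>O(n\<^sup>-\<^sup>2)\<close>. This gives almost sure convergence and
  asymptotic factorisation of expectations of products of traces.

  If the first edge \<open>{i, j}\<close> of a walk belongs to a Wigner matrix and is traversed again in
  the opposite direction, the walk splits into two independent closed walks; the second traversal in
  the same direction is negligible. So the limit satisfies the Schwinger-Dyson equation
  \<open>\<phi>(s u) = \<Sum> \<phi>(u\<^sub>1) \<phi>(u\<^sub>2)\<close>, the sum being over all decompositions \<open>u = u\<^sub>1 s u\<^sub>2\<close>.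
  It reduces the existence of all limits to words without Wigner matrices, where the walks with given
  coincidences of labels are the lattice points of a union of dilated polytopes, and together with
  traciality it implies freeness by induction on the length of an alternating product.\<close>

text \<open>No equation for the patterned matrices is at hand, and their moments are obtained only
  as limits of counts. So freeness has to follow from traciality and from the equation for the
  Wigner letters alone; this is why the vanishing of alternating products is proved together with a
  second claim, which allows an uncentred word of Wigner letters in front. A second moment would not
  do for almost sure convergence: two linked walks lose one factor \<open>n\<close>, so this kind of
  count bounds the variance only by a multiple of \<open>1 / n\<close>, which is not summable. Four
  walks, each linked to another one, lose two factors. The volumes of the polytopes are not
  computed: a normalised number of lattice points is the integral of a step function whose value at
  almost every point is eventually constant in \<open>n\<close>, and dominated convergence gives a
  limit. Since the conclusion speaks of moments only, neither a quotient nor a completion is formed: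
  the limit space is the free algebra on the letters, with the linear extension of the limit
  moments.\<close>

section \<open>Centred words\<close>

text \<open>\<open>centred \<phi> u [v\<^sub>1, \<dots>, v\<^sub>m]\<close> is the value of \<open>\<phi>\<close> at
  \<open>u (v\<^sub>1 - \<phi> v\<^sub>1) \<cdots> (v\<^sub>m - \<phi> v\<^sub>m)\<close>.\<close>

fun centred :: "('k list \<Rightarrow> complex) \<Rightarrow> 'k list \<Rightarrow> 'k list list \<Rightarrow> complex" where
  "centred \<phi> u [] = \<phi> u"
| "centred \<phi> u (v # vs) = centred \<phi> (u @ v) vs - \<phi> v * centred \<phi> u vs"

text \<open>The free difference quotient with respect to \<open>s\<close>, which sends
  \<open>u\<close> to the sum of a \<otimes> b over all decompositions u = a s b, followed by the
  map a \<otimes> b \<mapsto> \<open>F a b\<close>.\<close>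

definition split_sum :: "'k \<Rightarrow> 'k list \<Rightarrow> ('k list \<Rightarrow> 'k list \<Rightarrow> complex) \<Rightarrow> complex" where
  "split_sum s u F = (\<Sum>c<length u. if u ! c = s then F (take c u) (drop (Suc c) u) else 0)"

text \<open>Leibniz rule of the free difference quotient: the letter \<open>s\<close> is removed
  either from \<open>u\<close> or from \<open>v\<close>, and the untouched word joins the half next
  to it.\<close>

lemma split_sum_append:
  "split_sum s (u @ v) F =
     split_sum s u (\<lambda>a b. F a (b @ v)) + split_sum s v (\<lambda>a b. F (u @ a) b)"
proof -
  let ?g = "\<lambda>c. if (u @ v) ! c = s then F (take c (u @ v)) (drop (Suc c) (u @ v)) else 0"
  have "split_sum s (u @ v) F = sum ?g {0..<length u + length v}"
    by (simp add: split_sum_def lessThan_atLeast0)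
  also have "\<dots> = sum ?g {0..<length u} + sum ?g {length u..<length u + length v}"
    by (simp add: sum.atLeastLessThan_concat)
  also have "sum ?g {length u..<length u + length v} = sum (\<lambda>c. ?g (c + length u)) {0..<length v}"
    using sum.shift_bounds_nat_ivl[of ?g 0 "length u" "length v"] by (simp add: add.commute)
  also have "\<dots> = split_sum s v (\<lambda>a b. F (u @ a) b)"
    by (auto simp: split_sum_def lessThan_atLeast0 nth_append intro!: sum.cong)
  also have "sum ?g {0..<length u} = split_sum s u (\<lambda>a b. F a (b @ v))"
    by (auto simp: split_sum_def lessThan_atLeast0 nth_append intro!: sum.cong)
  finally show ?thesis .
qed

lemma split_sum_diff: "split_sum s u (\<lambda>a b. F a b - G a b) = split_sum s u F - split_sum s u G"
  unfolding split_sum_def sum_subtractf[symmetric] by (rule sum.cong) auto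

lemma split_sum_cmult: "split_sum s u (\<lambda>a b. c * F a b) = c * split_sum s u F"
  unfolding split_sum_def sum_distrib_left by (rule sum.cong) auto

lemma split_sum_cong:
  assumes "\<And>a b. u = a @ s # b \<Longrightarrow> F a b = G a b"
  shows "split_sum s u F = split_sum s u G"
  unfolding split_sum_def
  by (rule sum.cong) (auto intro!: assms simp: id_take_nth_drop[symmetric])

section \<open>Tracial functionals in which the letters of \<open>S\<close> are semicircular\<close>

text \<open>On words in \<open>S\<close> the equation determines all moments, namely those of free
  standard semicircular elements, since a letter is paired only with copies of itself. The letters
  of \<open>K - S\<close> occur in these equations but have none of their own.\<close>

locale semicircular_functional =
  fixes \<phi> :: "'k list \<Rightarrow> complex" and S :: "'k set" and K :: "'k set"
  assumes phi_Nil: "\<phi> [] = 1"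
    and phi_rotate: "\<phi> (u @ v) = \<phi> (v @ u)"
    and schwinger_dyson:
      "\<lbrakk>s \<in> S; u \<in> lists K\<rbrakk> \<Longrightarrow> \<phi> (s # u) = split_sum s u (\<lambda>a b. \<phi> a * \<phi> b)"
    and S_subset: "S \<subseteq> K"
begin

text \<open>By traciality the last centred factor can be moved to the front, where its word merges
  with \<open>u\<close>.\<close>

lemma centred_snoc: "centred \<phi> u (vs @ [v]) = centred \<phi> (v @ u) vs - \<phi> v * centred \<phi> u vs"
proof (induction vs arbitrary: u)
  case Nil
  then show ?case by (simp add: phi_rotate[of v u])
next
  case (Cons w vs)
  then show ?case by (simp add: ring_distribs)
qed

lemma centred_rotate: "centred \<phi> [] (vs @ [v]) = centred \<phi> [] (v # vs)"
  by (simp add: centred_snoc)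

text \<open>The scalars in the centred factors have derivative zero, so \<open>s\<close> is paired
  with a letter of \<open>u\<close> or of some \<open>vs ! j\<close> as if nothing were centred. In
  the second case the pair encloses \<open>u\<close>, the centred factors before
  \<open>vs ! j\<close>, and \<open>a\<close>; rotation brings this part to the form
  \<open>centred \<phi> (a @ u) (take j vs)\<close>.\<close>

lemma centred_schwinger_dyson:
  assumes "s \<in> S" "u \<in> lists K" "\<forall>v\<in>set vs. v \<in> lists K"
  shows "centred \<phi> (s # u) vs =
    split_sum s u (\<lambda>a b. \<phi> a * centred \<phi> b vs) +
    (\<Sum>j<length vs. split_sum s (vs ! j)
       (\<lambda>a b. centred \<phi> (a @ u) (take j vs) * centred \<phi> b (drop (Suc j) vs)))"
  using assms(2,3)
proof (induction vs arbitrary: u)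
  case Nil
  then show ?case by (simp add: schwinger_dyson[OF assms(1)])
next
  case (Cons v vs)
  let ?G = "\<lambda>u j. split_sum s (vs ! j)
       (\<lambda>a b. centred \<phi> (a @ u) (take j vs) * centred \<phi> b (drop (Suc j) vs))"
  have uv: "u @ v \<in> lists K" using Cons.prems by auto
  have "centred \<phi> (s # u) (v # vs) = centred \<phi> (s # (u @ v)) vs - \<phi> v * centred \<phi> (s # u) vs"
    by simp
  also have "\<dots> = split_sum s u (\<lambda>a b. \<phi> a * centred \<phi> (b @ v) vs)
      + split_sum s v (\<lambda>a b. \<phi> (u @ a) * centred \<phi> b vs) + (\<Sum>j<length vs. ?G (u @ v) j)
      - \<phi> v * (split_sum s u (\<lambda>a b. \<phi> a * centred \<phi> b vs) + (\<Sum>j<length vs. ?G u j))"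
    using Cons.IH[OF uv] Cons.IH[OF Cons.prems(1)] Cons.prems by (simp add: split_sum_append)
  \<comment> \<open>The middle term is the summand \<open>j = 0\<close> of the claim, which belongs
    to the head \<open>v\<close>; all other summands are shifted by one.\<close>
  also have "\<dots> = split_sum s u (\<lambda>a b. \<phi> a * centred \<phi> b (v # vs))
      + split_sum s v (\<lambda>a b. \<phi> (a @ u) * centred \<phi> b vs)
      + (\<Sum>j<length vs. ?G (u @ v) j - \<phi> v * ?G u j)"
    by (simp add: algebra_simps split_sum_diff sum_subtractf sum_distrib_left
        split_sum_cmult[symmetric] phi_rotate[of u])
  also have "(\<Sum>j<length vs. ?G (u @ v) j - \<phi> v * ?G u j) =
     (\<Sum>j<length vs. split_sum s (vs ! j)
       (\<lambda>a b. centred \<phi> (a @ u) (v # take j vs) * centred \<phi> b (drop (Suc j) vs)))"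
    by (simp add: split_sum_cmult[symmetric] split_sum_diff[symmetric] algebra_simps)
  finally show ?case
    by (simp only: length_Cons sum.lessThan_Suc_shift nth_Cons_0 nth_Cons_Suc take_0 take_Suc_Cons
        drop_Suc_Cons drop_0 centred.simps(1) add.assoc)
qed

section \<open>Alternating products of centred words vanish\<close>

definition letters :: "bool \<Rightarrow> 'k set" where
  "letters b = (if b then S else K - S)"

fun alternating :: "bool \<Rightarrow> 'k list list \<Rightarrow> bool" where
  "alternating b [] \<longleftrightarrow> True"
| "alternating b (v # vs) \<longleftrightarrow> v \<in> lists (letters b) \<and> alternating (\<not> b) vs"

lemma alternating_append:
  "alternating b (us @ vs) \<longleftrightarrow>
     alternating b us \<and> alternating (if even (length us) then b else \<not> b) vs"
  by (induction us arbitrary: b) auto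

lemma alternating_take: "alternating b vs \<Longrightarrow> alternating b (take j vs)"
  by (metis alternating_append append_take_drop_id)

lemma alternating_lists: "\<lbrakk>alternating b vs; v \<in> set vs\<rbrakk> \<Longrightarrow> v \<in> lists K"
  using S_subset by (induction vs arbitrary: b) (auto simp: letters_def split: if_splits)

lemma alternating_nth:
  "\<lbrakk>alternating b vs; j < length vs\<rbrakk> \<Longrightarrow>
     vs ! j \<in> lists (letters (if even j then b else \<not> b))"
proof (induction vs arbitrary: b j)
  case (Cons v vs)
  show ?case
  proof (cases j)
    case (Suc i)
    then have "vs ! i \<in> lists (letters (if even i then \<not> b else \<not> \<not> b))"
      using Cons.prems by (intro Cons.IH) auto
    then show ?thesis by (cases "even i") (simp_all only: Suc even_Suc nth_Cons_Suc if_True if_False not_not simp_thms)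
  qed (use Cons.prems in simp)
qed simp

text \<open>Simultaneous induction on the number \<open>m\<close> of centred factors. The first
  claim for \<open>m\<close> rests on both claims for fewer factors. The second one for
  \<open>m\<close> follows from the first one for \<open>m - 1\<close> if the product begins in
  \<open>S\<close>; the remaining products are rotated so that they begin in
  \<open>S\<close>.\<close>

lemma centred_alternating:
  "(\<forall>vs u. length vs = m \<longrightarrow> alternating False vs \<longrightarrow> u \<in> lists S \<longrightarrow>
      centred \<phi> u vs = \<phi> u * centred \<phi> [] vs) \<and>
   (\<forall>vs b. length vs = m \<longrightarrow> vs \<noteq> [] \<longrightarrow> alternating b vs \<longrightarrow> centred \<phi> [] vs = 0)"
proof (induction m rule: less_induct)
  case (less m)
  have IHA: "centred \<phi> u vs = \<phi> u * centred \<phi> [] vs"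
    if "length vs < m" "alternating False vs" "u \<in> lists S" for vs u
    using less that by blast
  have IHB: "centred \<phi> [] vs = 0"
    if "length vs < m" "vs \<noteq> []" "alternating b vs" for vs b
    using less that by blast
  have A: "centred \<phi> u vs = \<phi> u * centred \<phi> [] vs"
    if vs: "length vs = m" "alternating False vs" and u: "u \<in> lists S" for vs u
    using u
  proof (induction u rule: length_induct)
    case (1 u)
    show ?case
    proof (cases u)
      case Nil
      then show ?thesis by (simp add: phi_Nil)
    next
      case (Cons s u')
      have s: "s \<in> S" and u': "u' \<in> lists S" "u' \<in> lists K"
        using 1 S_subset by (auto simp: Cons)
      have "centred \<phi> u vs =
        split_sum s u' (\<lambda>a b. \<phi> a * centred \<phi> b vs) +
        (\<Sum>j<length vs. split_sum s (vs ! j)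
          (\<lambda>a b. centred \<phi> (a @ u') (take j vs) * centred \<phi> b (drop (Suc j) vs)))"
        unfolding Cons using alternating_lists[OF vs(2)]
        by (intro centred_schwinger_dyson[OF s u'(2)] ballI)
      \<comment> \<open>A pair inside \<open>u\<close> leaves a word \<open>b\<close> shorter than
        \<open>u\<close>, so the inner induction splits off the common factor; the Schwinger-Dyson
        equation, read backwards, then puts \<open>\<phi> u\<close> together again.\<close>
      also have "split_sum s u' (\<lambda>a b. \<phi> a * centred \<phi> b vs) =
          split_sum s u' (\<lambda>a b. centred \<phi> [] vs * (\<phi> a * \<phi> b))"
      proof (rule split_sum_cong)
        fix a b assume ab: "u' = a @ s # b"
        have "length b < length u" "b \<in> lists S"
          using u'(1) unfolding Cons ab by simp_all
        then have "centred \<phi> b vs = \<phi> b * centred \<phi> [] vs"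
          using 1(1) by blast
        then show "\<phi> a * centred \<phi> b vs = centred \<phi> [] vs * (\<phi> a * \<phi> b)"
          by simp
      qed
      also have "\<dots> = centred \<phi> [] vs * \<phi> u"
        by (simp add: split_sum_cmult Cons schwinger_dyson s u')
      also have "(\<Sum>j<length vs. split_sum s (vs ! j)
          (\<lambda>a b. centred \<phi> (a @ u') (take j vs) * centred \<phi> b (drop (Suc j) vs))) = 0"
      proof (intro sum.neutral ballI)
        fix j assume j: "j \<in> {..<length vs}"
        have "split_sum s (vs ! j)
          (\<lambda>a b. centred \<phi> (a @ u') (take j vs) * centred \<phi> b (drop (Suc j) vs)) =
          split_sum s (vs ! j) (\<lambda>a b. 0)"
        proof (rule split_sum_cong)
          fix a b assume ab: "vs ! j = a @ s # b"
          \<comment> \<open>Words of Wigner letters sit at the odd positions. So \<open>j\<close> is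
            positive, and the enclosed part is a word in \<open>S\<close> followed by a non-empty
            alternating product of fewer factors: the first claim splits off the word and the second
            one kills the rest.\<close>
          have vsj: "vs ! j \<in> lists (letters (if even j then False else True))"
            using alternating_nth[OF vs(2), of j] j by (simp only: lessThan_iff simp_thms)
          with ab s have "odd j" by (auto simp: letters_def split: if_splits)
          then have "j \<noteq> 0" by (cases j) auto
          moreover have "a \<in> lists S"
            using vsj ab \<open>odd j\<close> by (auto simp: letters_def)
          ultimately have "centred \<phi> (a @ u') (take j vs) =
              \<phi> (a @ u') * centred \<phi> [] (take j vs)"
            using j vs u' by (intro IHA) (auto intro: alternating_take)
          also have "centred \<phi> [] (take j vs) = 0"
            using j vs \<open>j \<noteq> 0\<close> by (intro IHB[of _ False]) (auto intro: alternating_take)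
          finally show "centred \<phi> (a @ u') (take j vs) * centred \<phi> b (drop (Suc j) vs) = 0"
            by simp
        qed
        then show "split_sum s (vs ! j)
          (\<lambda>a b. centred \<phi> (a @ u') (take j vs) * centred \<phi> b (drop (Suc j) vs)) = 0"
          by (simp add: split_sum_def)
      qed
      finally show ?thesis by (simp add: mult.commute)
    qed
  qed
  \<comment> \<open>The leading centred factor is a difference, and the first claim for
    \<open>m - 1\<close> factors makes its two terms equal.\<close>
  have BT: "centred \<phi> [] vs = 0" if "length vs = m" "vs \<noteq> []" "alternating True vs" for vs
  proof (cases vs)
    case (Cons v vs')
    then have "centred \<phi> v vs' = \<phi> v * centred \<phi> [] vs'"
      using that by (intro IHA) (auto simp: letters_def)
    then show ?thesis by (simp add: Cons)
  qed (use that in simp)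
  have B: "centred \<phi> [] vs = 0" if vs: "length vs = m" "vs \<noteq> []" "alternating b vs" for vs b
  proof (cases b)
    case True
    then show ?thesis using BT vs by simp
  next
    case False
    then obtain v vs' where v: "vs = v # vs'" "v \<in> lists (letters False)" "alternating True vs'"
      using vs by (cases vs) auto
    have rot: "centred \<phi> [] vs = centred \<phi> [] (vs' @ [v])"
      by (simp only: centred_rotate v(1))
    show ?thesis
    proof (cases "even (length vs)")
      case True
      then have "alternating True (vs' @ [v])"
        using v by (simp add: alternating_append)
      then show ?thesis unfolding rot using vs v by (intro BT) auto
    next
      \<comment> \<open>For odd length the first and the last factor both come from
        \<open>K - S\<close> and become neighbours \<open>z\<close>, \<open>v\<close> by the
        rotation. Their product is expanded: each term contains \<open>ws\<close> alone or
        \<open>ws\<close> with one uncentred word \<open>w\<close> over these letters, and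
        \<open>ws\<close> followed by the centred \<open>w\<close> is an alternating product of
        \<open>m - 1\<close> factors that begins in \<open>S\<close>.\<close>
      case odd: False
      show ?thesis
      proof (cases vs' rule: rev_cases)
        case Nil
        then show ?thesis by (simp add: v phi_Nil)
      next
        case (snoc ws z)
        have ws: "alternating True ws" and z: "z \<in> lists (letters False)"
          using v odd by (auto simp: snoc alternating_append)
        have "odd (length ws)" using odd by (simp add: v snoc)
        then have alt: "alternating True (ws @ [w])" if "w \<in> lists (letters False)" for w
          using ws that by (simp add: alternating_append)
        have "ws \<noteq> []" using \<open>odd (length ws)\<close> by auto
        have w0: "centred \<phi> [] ws = 0"
          using \<open>ws \<noteq> []\<close> ws vs by (intro IHB[of _ True]) (auto simp: v snoc)
        have *: "centred \<phi> w ws = 0" if "w \<in> lists (letters False)" for w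
        proof -
          have "centred \<phi> [] (ws @ [w]) = 0"
            using alt[OF that] vs by (intro IHB[of _ True]) (auto simp: v snoc)
          then show ?thesis by (simp add: centred_snoc w0)
        qed
        have "z @ v \<in> lists (letters False)" using z v by auto
        then have "centred \<phi> (z @ v) ws = 0" by (rule *)
        moreover have "centred \<phi> z ws = 0" "centred \<phi> v ws = 0" using z v * by auto
        ultimately show ?thesis
          unfolding rot snoc by (simp add: centred_snoc w0 del: append_assoc)
      qed
    qed
  qed
  show ?case using A B by blast
qed

lemma centred_alternating_eq_0: "\<lbrakk>alternating b vs; vs \<noteq> []\<rbrakk> \<Longrightarrow> centred \<phi> [] vs = 0"
  using centred_alternating by blast

end

section \<open>The free algebra\<close>

text \<open>Cauchy product over all cuts of the argument into two words. The recursion strips the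
  first letter, so that the algebraic laws follow by induction on the word.\<close>

fun convolution :: "('k list \<Rightarrow> complex) \<Rightarrow> ('k list \<Rightarrow> complex) \<Rightarrow> 'k list \<Rightarrow> complex" where
  "convolution f g [] = f [] * g []"
| "convolution f g (x # w) = f [] * g (x # w) + convolution (\<lambda>v. f (x # v)) g w"

definition support :: "('k list \<Rightarrow> complex) \<Rightarrow> 'k list set" where
  "support f = {w. f w \<noteq> 0}"

definition word :: "'k list \<Rightarrow> 'k list \<Rightarrow> complex" where
  "word u = (\<lambda>w. of_bool (w = u))"

definition free_algebra :: "(complex, 'k list \<Rightarrow> complex) module" where
  "free_algebra = \<lparr>carrier = {f. finite (support f)}, mult = convolution, one = word [],
     zero = (\<lambda>_. 0), add = (\<lambda>f g w. f w + g w), smult = (\<lambda>c f w. c * f w)\<rparr>"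

lemma free_algebra_simps [simp]:
  "carrier free_algebra = {f. finite (support f)}"
  "f \<otimes>\<^bsub>free_algebra\<^esub> g = convolution f g"
  "\<one>\<^bsub>free_algebra\<^esub> = word []"
  "\<zero>\<^bsub>free_algebra\<^esub> = (\<lambda>_. 0)"
  "f \<oplus>\<^bsub>free_algebra\<^esub> g = (\<lambda>w. f w + g w)"
  "c \<odot>\<^bsub>free_algebra\<^esub> f = (\<lambda>w. c * f w)"
  by (simp_all add: free_algebra_def)

lemma convolution_distrib_right:
  "convolution (\<lambda>v. f v + f' v) g w = convolution f g w + convolution f' g w"
  by (induction w arbitrary: f f') (simp_all add: algebra_simps)

lemma convolution_distrib_left:
  "convolution f (\<lambda>v. g v + g' v) w = convolution f g w + convolution f g' w"
  by (induction w arbitrary: f) (simp_all add: algebra_simps)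

lemma convolution_smult_left: "convolution (\<lambda>v. c * f v) g w = c * convolution f g w"
  by (induction w arbitrary: f) (simp_all add: algebra_simps)

lemma convolution_smult_right: "convolution f (\<lambda>v. c * g v) w = c * convolution f g w"
  by (induction w arbitrary: f) (simp_all add: algebra_simps)

lemma convolution_zero_left: "convolution (\<lambda>_. 0) g w = 0"
  by (induction w) simp_all

lemma convolution_one_left: "convolution (word []) g w = g w"
  by (cases w) (simp_all add: word_def convolution_zero_left)

lemma convolution_one_right: "convolution f (word []) w = f w"
  by (induction w arbitrary: f) (simp_all add: word_def)

lemma convolution_assoc:
  "convolution (convolution f g) h w = convolution f (convolution g h) w"
proof (induction w arbitrary: f)
  case (Cons x w)
  have "convolution (\<lambda>v. f [] * g (x # v) + convolution (\<lambda>v. f (x # v)) g v) h w =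
    f [] * convolution (\<lambda>v. g (x # v)) h w + convolution (convolution (\<lambda>v. f (x # v)) g) h w"
    by (simp add: convolution_distrib_right convolution_smult_left)
  then show ?case by (simp add: Cons.IH algebra_simps)
qed simp

lemma convolution_eq_sum:
  "convolution f g w = (\<Sum>i\<le>length w. f (take i w) * g (drop i w))"
  by (induction w arbitrary: f) (simp_all add: sum.atMost_Suc_shift del: sum.atMost_Suc)

lemma support_convolution:
  "support (convolution f g) \<subseteq> (\<lambda>(a, b). a @ b) ` (support f \<times> support g)"
proof
  fix w assume "w \<in> support (convolution f g)"
  then have "(\<Sum>i\<le>length w. f (take i w) * g (drop i w)) \<noteq> 0"
    by (simp add: support_def convolution_eq_sum)
  then obtain i where "f (take i w) * g (drop i w) \<noteq> 0"
    by (metis (no_types, lifting) sum.neutral)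
  then have "(take i w, drop i w) \<in> support f \<times> support g"
    by (simp add: support_def)
  then show "w \<in> (\<lambda>(a, b). a @ b) ` (support f \<times> support g)"
    by (intro image_eqI) auto
qed

lemma support_add: "support (\<lambda>w. f w + g w) \<subseteq> support f \<union> support g"
  by (auto simp: support_def)

lemma support_smult: "support (\<lambda>w. c * f w) \<subseteq> support f"
  by (auto simp: support_def)

lemma support_word: "support (word u) = {u}"
  by (auto simp: support_def word_def)

lemma finite_support_convolution:
  "\<lbrakk>finite (support f); finite (support g)\<rbrakk> \<Longrightarrow> finite (support (convolution f g))"
  by (rule finite_subset[OF support_convolution]) auto

lemma finite_support_add:
  "\<lbrakk>finite (support f); finite (support g)\<rbrakk> \<Longrightarrow> finite (support (\<lambda>w. f w + g w))"
  by (rule finite_subset[OF support_add]) auto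

lemma finite_support_smult: "finite (support f) \<Longrightarrow> finite (support (\<lambda>w. c * f w))"
  by (rule finite_subset[OF support_smult])

lemma free_algebra_inverse:
  assumes "finite (support f)"
  shows "\<exists>g. finite (support g) \<and> (\<lambda>w. f w + g w) = (\<lambda>_. 0)"
  using finite_support_smult[OF assms, of "-1"] by (intro exI[of _ "\<lambda>w. -1 * f w"]) auto

lemma ring_free_algebra: "ring free_algebra"
proof (rule ringI)
  show "abelian_group free_algebra"
    by (rule abelian_groupI)
      (auto simp: finite_support_add free_algebra_inverse algebra_simps, simp add: support_def)
  show "monoid free_algebra"
    by (rule monoidI)
      (auto simp: finite_support_convolution support_word convolution_assoc
        convolution_one_left convolution_one_right)
qed (auto simp: convolution_distrib_left convolution_distrib_right)

lemma complex_ring_simps [simp]: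
  "carrier complex_ring = UNIV" "x \<oplus>\<^bsub>complex_ring\<^esub> y = x + y"
  "x \<otimes>\<^bsub>complex_ring\<^esub> y = x * y" "\<one>\<^bsub>complex_ring\<^esub> = 1" "\<zero>\<^bsub>complex_ring\<^esub> = 0"
  by (simp_all add: ring_of_type_algebra_def)

lemma unital_complex_algebra_free_algebra: "unital_complex_algebra free_algebra"
proof (intro unital_complex_algebra.intro unital_complex_algebra_axioms.intro)
  show "module complex_ring free_algebra"
    by (rule moduleI)
      (auto simp: cring_from_type_algebra ring.is_abelian_group[OF ring_free_algebra]
        finite_support_smult algebra_simps)
qed (auto simp: ring_free_algebra convolution_smult_left convolution_smult_right)

section \<open>Linear extension of a functional on words\<close>

definition linear_ext :: "('k list \<Rightarrow> complex) \<Rightarrow> ('k list \<Rightarrow> complex) \<Rightarrow> complex" where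
  "linear_ext \<phi> f = (\<Sum>w\<in>support f. f w * \<phi> w)"

lemma linear_ext_superset:
  assumes "finite A" "support f \<subseteq> A"
  shows "linear_ext \<phi> f = (\<Sum>w\<in>A. f w * \<phi> w)"
  unfolding linear_ext_def by (rule sum.mono_neutral_left) (use assms in \<open>auto simp: support_def\<close>)

lemma linear_ext_add:
  assumes "finite (support f)" "finite (support g)"
  shows "linear_ext \<phi> (\<lambda>w. f w + g w) = linear_ext \<phi> f + linear_ext \<phi> g"
  using assms support_add[of f g]
  by (simp add: linear_ext_superset[of "support f \<union> support g"] distrib_right sum.distrib)

lemma linear_ext_smult:
  assumes "finite (support f)"
  shows "linear_ext \<phi> (\<lambda>w. c * f w) = c * linear_ext \<phi> f"
  using assms support_smult[of c f]
  by (simp add: linear_ext_superset[of "support f"] sum_distrib_left mult.assoc)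

lemma linear_ext_word: "linear_ext \<phi> (word u) = \<phi> u"
  by (simp add: linear_ext_def support_word) (simp add: word_def)

lemma nc_prob_space_free_algebra:
  "\<phi> [] = 1 \<Longrightarrow> nc_prob_space free_algebra (linear_ext \<phi>)"
  by (intro nc_prob_space.intro nc_prob_space_axioms.intro unital_complex_algebra_free_algebra)
    (simp_all add: linear_ext_add linear_ext_smult linear_ext_word)

text \<open>The left factor is summed word by word and absorbed into the functional as a prefix. In
  this form a long product can be expanded one factor at a time.\<close>

lemma linear_ext_convolution:
  assumes f: "finite (support f)" and g: "finite (support g)"
  shows "linear_ext \<phi> (convolution f g) =
    (\<Sum>a\<in>support f. f a * linear_ext (\<lambda>w. \<phi> (a @ w)) g)"
proof -
  let ?AB = "support f \<times> support g" and ?app = "\<lambda>(a, b). a @ b"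
  have conv: "convolution f g w = (\<Sum>ab\<in>{ab \<in> ?AB. ?app ab = w}. f (fst ab) * g (snd ab))" for w
  proof -
    have "convolution f g w = (\<Sum>ab\<in>(\<lambda>i. (take i w, drop i w)) ` {..length w}. f (fst ab) * g (snd ab))"
      unfolding convolution_eq_sum
      by (subst sum.reindex) (auto simp: inj_on_def dest: arg_cong[of _ _ length])
    also have "\<dots> = (\<Sum>ab\<in>{ab \<in> ?AB. ?app ab = w}. f (fst ab) * g (snd ab))"
    proof (rule sum.mono_neutral_right)
      show "{ab \<in> ?AB. ?app ab = w} \<subseteq> (\<lambda>i. (take i w, drop i w)) ` {..length w}"
      proof
        fix ab assume "ab \<in> {ab \<in> ?AB. ?app ab = w}"
        then obtain a b where "ab = (a, b)" "w = a @ b" by (cases ab) auto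
        then show "ab \<in> (\<lambda>i. (take i w, drop i w)) ` {..length w}"
          by (intro image_eqI[of _ _ "length a"]) auto
      qed
    qed (auto simp: support_def)
    finally show ?thesis .
  qed
  have "linear_ext \<phi> (convolution f g) = (\<Sum>w\<in>?app ` ?AB. convolution f g w * \<phi> w)"
    using f g support_convolution[of f g] by (intro linear_ext_superset) auto
  also have "\<dots> = (\<Sum>w\<in>?app ` ?AB. \<Sum>ab\<in>{ab \<in> ?AB. ?app ab = w}.
      f (fst ab) * g (snd ab) * \<phi> (?app ab))"
    unfolding conv sum_distrib_right by (intro sum.cong) auto
  also have "\<dots> = (\<Sum>ab\<in>?AB. f (fst ab) * g (snd ab) * \<phi> (?app ab))"
    using f g by (intro sum.group) auto
  also have "\<dots> = (\<Sum>a\<in>support f. \<Sum>b\<in>support g. f a * g b * \<phi> (a @ b))"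
    by (simp add: sum.cartesian_product case_prod_unfold)
  finally show ?thesis by (simp add: linear_ext_def sum_distrib_left mult.assoc)
qed

lemma finite_support_alg_monomial:
  "(\<forall>k\<in>set ks. finite (support (b k))) \<Longrightarrow> finite (support (alg_monomial free_algebra b ks))"
  by (induction ks) (simp_all add: alg_monomial_def support_word finite_support_convolution)

lemma alg_monomial_word:
  "alg_monomial free_algebra (\<lambda>k. word [h k]) ks = word (map h ks)"
proof (induction ks)
  case (Cons k ks)
  have "convolution (word [h k]) f w = (case w of [] \<Rightarrow> 0 | x # v \<Rightarrow> of_bool (x = h k) * f v)"
    for f w
  proof (cases w)
    case (Cons x v)
    then have "convolution (word [h k]) f w = convolution (\<lambda>v. of_bool (x = h k) * word [] v) f v"
      by (simp add: word_def of_bool_conj)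
    then show ?thesis
      by (simp add: Cons convolution_smult_left convolution_one_left)
  qed (simp add: word_def)
  with Cons show ?case
    by (auto simp: alg_monomial_def word_def split: list.splits)
qed (simp add: alg_monomial_def)

fun coefficient :: "('i \<Rightarrow> 'k list \<Rightarrow> complex) \<Rightarrow> 'i list \<Rightarrow> 'k list list \<Rightarrow> complex" where
  "coefficient a (k # ks) (v # vs) = a k v * coefficient a ks vs"
| "coefficient a _ _ = 1"

text \<open>Since \<open>\<phi> (a\<^sub>j) = 0\<close>, each word of \<open>a\<^sub>j\<close> may be centred without changing \<open>a\<^sub>j\<close>.\<close>

lemma linear_ext_alg_monomial_centred:
  assumes "\<forall>k\<in>set ks. finite (support (a k)) \<and> linear_ext \<phi> (a k) = 0"
  shows "linear_ext (\<lambda>w. \<phi> (u @ w)) (alg_monomial free_algebra a ks) =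
    (\<Sum>vs\<in>listset (map (\<lambda>k. support (a k)) ks). coefficient a ks vs * centred \<phi> u vs)"
  using assms
proof (induction ks arbitrary: u)
  case Nil
  then show ?case by (simp add: alg_monomial_def linear_ext_word)
next
  case (Cons k ks)
  let ?m = "alg_monomial free_algebra a ks"
  let ?LS = "listset (map (\<lambda>k. support (a k)) ks)"
  let ?E = "\<lambda>u. \<Sum>vs\<in>?LS. coefficient a ks vs * centred \<phi> u vs"
  have fin: "finite (support (a k))" "finite (support ?m)"
    using Cons.prems by (auto intro: finite_support_alg_monomial)
  have IH: "linear_ext (\<lambda>w. \<phi> (u @ w)) ?m = ?E u" for u
    using Cons.prems by (intro Cons.IH) simp
  have "linear_ext (\<lambda>w. \<phi> (u @ w)) (alg_monomial free_algebra a (k # ks)) =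
      linear_ext (\<lambda>w. \<phi> (u @ w)) (convolution (a k) ?m)"
    by (simp add: alg_monomial_def)
  also have "\<dots> = (\<Sum>v\<in>support (a k). a k v * linear_ext (\<lambda>w. \<phi> ((u @ v) @ w)) ?m)"
    by (simp add: linear_ext_convolution fin)
  also have "\<dots> = (\<Sum>v\<in>support (a k). a k v * ?E (u @ v))"
    by (simp only: IH)
  also have "\<dots> = (\<Sum>v\<in>support (a k). a k v * ?E (u @ v)) - linear_ext \<phi> (a k) * ?E u"
    using Cons.prems by simp
  also have "\<dots> = (\<Sum>v\<in>support (a k). a k v * (?E (u @ v) - \<phi> v * ?E u))"
    by (simp add: linear_ext_def algebra_simps sum_subtractf sum_distrib_right)
  also have "\<dots> = (\<Sum>v\<in>support (a k). \<Sum>vs\<in>?LS. coefficient a (k # ks) (v # vs) * centred \<phi> u (v # vs))"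
    by (simp add: algebra_simps sum_subtractf sum_distrib_left)
  also have "\<dots> = (\<Sum>(v, vs)\<in>support (a k) \<times> ?LS. coefficient a (k # ks) (v # vs) * centred \<phi> u (v # vs))"
    by (rule sum.cartesian_product)
  also have "\<dots> = (\<Sum>vs\<in>(\<lambda>(v, vs). v # vs) ` (support (a k) \<times> ?LS).
      coefficient a (k # ks) vs * centred \<phi> u vs)"
    by (subst sum.reindex) (auto simp: inj_on_def case_prod_unfold)
  also have "(\<lambda>(v, vs). v # vs) ` (support (a k) \<times> ?LS) =
      listset (map (\<lambda>k. support (a k)) (k # ks))"
    by (auto simp: set_Cons_def)
  finally show ?case .
qed

section \<open>Freeness\<close>

text \<open>An explicit subalgebra around the generated one. The inclusion suffices, because the
  vanishing condition in the definition of freeness is inherited by smaller subalgebras.\<close>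

definition word_subalgebra :: "'k set \<Rightarrow> ('k list \<Rightarrow> complex) set" where
  "word_subalgebra B = {f. finite (support f) \<and> support f \<subseteq> lists B}"

lemma unital_subalgebra_word_subalgebra: "unital_subalgebra free_algebra (word_subalgebra B)"
proof -
  interpret A: unital_complex_algebra "free_algebra :: (complex, 'a list \<Rightarrow> complex) module"
    by (rule unital_complex_algebra_free_algebra)
  have inv: "\<ominus>\<^bsub>free_algebra\<^esub> f = (\<lambda>w. -1 * f w)" if "finite (support f)" for f :: "'a list \<Rightarrow> complex"
    using that finite_support_smult[OF that, of "-1"]
    by (intro A.minus_equality) auto
  have add: "(\<lambda>w. f w + g w) \<in> word_subalgebra B"
    if "f \<in> word_subalgebra B" "g \<in> word_subalgebra B" for f g
    using that support_add[of f g] by (auto simp: word_subalgebra_def finite_support_add)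
  have smult: "(\<lambda>w. c * f w) \<in> word_subalgebra B" if "f \<in> word_subalgebra B" for c f
    using that support_smult[of c f] unfolding word_subalgebra_def
    by (auto simp only: mem_Collect_eq finite_support_smult)
  have mult: "convolution f g \<in> word_subalgebra B"
    if "f \<in> word_subalgebra B" "g \<in> word_subalgebra B" for f g
  proof -
    have "support (convolution f g) \<subseteq> lists B"
    proof
      fix w assume "w \<in> support (convolution f g)"
      then have "w \<in> (\<lambda>(a, b). a @ b) ` (support f \<times> support g)"
        by (rule subsetD[OF support_convolution])
      then obtain a b where "w = a @ b" "a \<in> support f" "b \<in> support g"
        by auto
      then show "w \<in> lists B" using that by (auto simp: word_subalgebra_def)
    qed
    then show ?thesis
      using that by (simp add: word_subalgebra_def finite_support_convolution)
  qed
  have neg: "\<ominus>\<^bsub>free_algebra\<^esub> f \<in> word_subalgebra B" if "f \<in> word_subalgebra B" for f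
    using smult[OF that, of "-1"] that by (subst inv) (auto simp: word_subalgebra_def)
  have sub: "word_subalgebra B \<subseteq> carrier free_algebra"
    by (auto simp: word_subalgebra_def)
  have zero: "(\<lambda>_. 0) \<in> word_subalgebra B"
    by (simp add: word_subalgebra_def support_def)
  have one: "word [] \<in> word_subalgebra B"
    by (simp add: word_subalgebra_def support_word)
  show ?thesis
    unfolding unital_subalgebra_def
  proof
    show "subring (word_subalgebra B) free_algebra"
      by (rule A.subringI[OF sub]) (simp_all add: neg mult add one)
    show "submodule (word_subalgebra B) complex_ring free_algebra"
      by (rule A.submoduleI[OF sub]) (simp_all add: neg add smult zero)
  qed
qed

text \<open>The intersection is a subalgebra because the family is not empty: it contains
  \<open>word_subalgebra UNIV\<close>, the whole free algebra.\<close>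

lemma unital_subalgebra_generated:
  assumes "S \<subseteq> carrier free_algebra"
  shows "unital_subalgebra free_algebra (generated_subalgebra free_algebra S)"
proof -
  interpret A: unital_complex_algebra "free_algebra :: (complex, 'a list \<Rightarrow> complex) module"
    by (rule unital_complex_algebra_free_algebra)
  let ?F = "{B. unital_subalgebra free_algebra B \<and> S \<subseteq> B}"
  have "S \<subseteq> word_subalgebra (UNIV :: 'a set)"
    using assms by (auto simp: word_subalgebra_def)
  then have "word_subalgebra UNIV \<in> ?F"
    using unital_subalgebra_word_subalgebra by simp
  then have ne: "?F \<noteq> {}" by blast
  have sr: "subring B free_algebra" and sm: "submodule B complex_ring free_algebra" if "B \<in> ?F" for B
    using that by (auto simp: unital_subalgebra_def)
  have subring: "subring (\<Inter>?F) free_algebra"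
    by (rule A.subring_Inter[OF sr ne])
  have submodule: "submodule (\<Inter>?F) complex_ring free_algebra"
  proof (rule A.submoduleI)
    fix c :: complex and f assume "f \<in> \<Inter>?F"
    then have "c \<odot>\<^bsub>free_algebra\<^esub> f \<in> B" if "B \<in> ?F" for B
      using submodule.smult_closed[OF sm[OF that], of c f] that complex_ring_simps(1) by blast
    then show "c \<odot>\<^bsub>free_algebra\<^esub> f \<in> \<Inter>?F" by blast
  qed (simp_all only: subringE(1,2,5,7)[OF subring])
  show ?thesis
    unfolding generated_subalgebra_def
    by (rule unital_subalgebra_def[THEN iffD2, OF conjI[OF subring submodule]])
qed

lemma generated_subalgebra_subset:
  assumes "S \<subseteq> word_subalgebra B"
  shows "generated_subalgebra free_algebra S \<subseteq> word_subalgebra B"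
  using assms unital_subalgebra_word_subalgebra[of B] by (auto simp: generated_subalgebra_def)

context semicircular_functional
begin

text \<open>There are two subalgebras only, so different neighbouring indices are negations of each
  other, and the alternation demanded by freeness becomes that of \<open>alternating\<close> for
  every choice of words from the supports.\<close>

lemma alternating_listset:
  assumes "vs \<in> listset (map (\<lambda>k. support (a k)) [l..<Suc m])" "l \<le> m"
    and "\<And>j. j \<in> {l..m} \<Longrightarrow> a j \<in> word_subalgebra (letters (i j))"
    and "\<And>j. j \<in> {l..<m} \<Longrightarrow> i j \<noteq> i (Suc j)"
  shows "alternating (i l) vs"
  using assms
proof (induction "m - l" arbitrary: l vs)
  case 0
  then show ?case
    by (auto simp: set_Cons_def word_subalgebra_def)
next
  case (Suc d)
  then have "l < m" by simp
  then have *: "[l..<Suc m] = l # [Suc l..<Suc m]" by (simp add: upt_conv_Cons)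
  obtain v ws where vs: "vs = v # ws" "v \<in> support (a l)"
      "ws \<in> listset (map (\<lambda>k. support (a k)) [Suc l..<Suc m])"
    using Suc.prems(1) unfolding * by (auto simp: set_Cons_def)
  have "alternating (i (Suc l)) ws"
  proof (rule Suc.hyps(1)[OF _ vs(3)])
    show "a j \<in> word_subalgebra (letters (i j))" if "j \<in> {Suc l..m}" for j
      using that by (intro Suc.prems(3)) simp
    show "i j \<noteq> i (Suc j)" if "j \<in> {Suc l..<m}" for j
      using that by (intro Suc.prems(4)) simp
  qed (use Suc.hyps(2) \<open>l < m\<close> in simp_all)
  moreover have "i (Suc l) = (\<not> i l)" using Suc.prems(4)[of l] \<open>l < m\<close> by auto
  moreover have "v \<in> lists (letters (i l))"
    using Suc.prems(3)[of l] \<open>l < m\<close> vs(2) by (auto simp: word_subalgebra_def)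
  ultimately show ?case by (simp add: vs(1))
qed

text \<open>Multilinear expansion turns the value at a product of centred elements into a
  combination of values at alternating products of centred words, all of which vanish.\<close>

theorem free_subalgebras_generated:
  assumes gen: "\<And>b. G b \<subseteq> word_subalgebra (letters b)"
  shows "free_subalgebras free_algebra (linear_ext \<phi>) (UNIV :: bool set)
    (\<lambda>b. generated_subalgebra free_algebra (G b))"
  unfolding free_subalgebras_def
proof (intro conjI ballI allI impI)
  fix b :: bool
  show "unital_subalgebra free_algebra (generated_subalgebra free_algebra (G b))"
    using gen[of b] by (intro unital_subalgebra_generated) (auto simp: word_subalgebra_def)
next
  fix m :: nat and i :: "nat \<Rightarrow> bool" and a :: "nat \<Rightarrow> 'k list \<Rightarrow> complex"
  assume *: "1 \<le> m \<and>
    (\<forall>j\<in>{1..m}. i j \<in> UNIV \<and> a j \<in> generated_subalgebra free_algebra (G (i j)) \<and>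
       linear_ext \<phi> (a j) = 0) \<and>
    (\<forall>j\<in>{1..<m}. i j \<noteq> i (Suc j))"
  then have a: "a j \<in> word_subalgebra (letters (i j))" "linear_ext \<phi> (a j) = 0"
    if "j \<in> {1..m}" for j
    using that generated_subalgebra_subset[OF gen, of "i j"] by auto
  let ?LS = "listset (map (\<lambda>k. support (a k)) [1..<Suc m])"
  have "linear_ext \<phi> (alg_monomial free_algebra a [1..<Suc m]) =
      linear_ext (\<lambda>w. \<phi> ([] @ w)) (alg_monomial free_algebra a [1..<Suc m])"
    by simp
  also have "\<dots> = (\<Sum>vs\<in>?LS. coefficient a [1..<Suc m] vs * centred \<phi> [] vs)"
  proof (rule linear_ext_alg_monomial_centred, rule ballI)
    fix k assume "k \<in> set [1..<Suc m]"
    then have "k \<in> {1..m}" by (simp only: set_upt atLeastLessThanSuc_atLeastAtMost)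
    then show "finite (support (a k)) \<and> linear_ext \<phi> (a k) = 0"
      using a by (simp add: word_subalgebra_def)
  qed
  also have "\<dots> = 0"
  proof (intro sum.neutral ballI)
    fix vs assume vs: "vs \<in> ?LS"
    have "alternating (i 1) vs"
    proof (rule alternating_listset[OF vs _ a(1)])
      show "i j \<noteq> i (Suc j)" if "j \<in> {1..<m}" for j using * that by blast
    qed (use * in blast)+
    moreover have "vs \<noteq> []"
    proof -
      have "[1..<Suc m] = 1 # [Suc 1..<Suc m]"
        using * by (intro upt_conv_Cons) simp
      then have "vs \<in> set_Cons (support (a 1)) (listset (map (\<lambda>k. support (a k)) [Suc 1..<Suc m]))"
        using vs by (simp only: list.map listset.simps)
      then show ?thesis by (auto simp: set_Cons_def)
    qed
    ultimately show "coefficient a [1..<Suc m] vs * centred \<phi> [] vs = 0"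
      by (simp add: centred_alternating_eq_0)
  qed
  finally show "linear_ext \<phi> (alg_monomial free_algebra a [1..<Suc m]) = 0" .
qed

end

section \<open>Moments of products of independent inputs\<close>

text \<open>Every factor is at most the maximum of 1 and all the absolute values, and the power of
  this maximum is 1 or one of the summands. So absolute moments of single variables control mixed
  moments.\<close>

lemma prod_abs_le:
  fixes x :: "'e \<Rightarrow> real"
  assumes "finite E"
  shows "\<bar>\<Prod>e\<in>E. x e\<bar> \<le> 1 + (\<Sum>e\<in>E. \<bar>x e\<bar> ^ card E)"
proof -
  define b where "b = Max (insert 1 ((\<lambda>e. \<bar>x e\<bar>) ` E))"
  have "b \<in> insert 1 ((\<lambda>e. \<bar>x e\<bar>) ` E)"
    unfolding b_def using assms by (intro Max_in) auto
  moreover have "1 \<le> b" "\<And>e. e \<in> E \<Longrightarrow> \<bar>x e\<bar> \<le> b"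
    unfolding b_def using assms by (auto intro!: Max_ge)
  ultimately have b: "b \<in> insert 1 ((\<lambda>e. \<bar>x e\<bar>) ` E)" "1 \<le> b"
      "\<And>e. e \<in> E \<Longrightarrow> \<bar>x e\<bar> \<le> b"
    by blast+
  have "\<bar>\<Prod>e\<in>E. x e\<bar> = (\<Prod>e\<in>E. \<bar>x e\<bar>)" by (rule abs_prod)
  also have "\<dots> \<le> b ^ card E"
    using b by (intro prod_le_power) auto
  also have "\<dots> \<le> 1 + (\<Sum>e\<in>E. \<bar>x e\<bar> ^ card E)"
  proof (cases "b = 1")
    case True
    then show ?thesis by (simp add: sum_nonneg)
  next
    case False
    then obtain e where "e \<in> E" "b = \<bar>x e\<bar>" using b by auto
    then have "b ^ card E \<le> (\<Sum>e\<in>E. \<bar>x e\<bar> ^ card E)"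
      using assms by (auto intro!: member_le_sum)
    then show ?thesis by simp
  qed
  finally show ?thesis .
qed

locale independent_inputs = prob_space M for M :: "'a measure" +
  fixes V :: "'l \<Rightarrow> 'a \<Rightarrow> real" and Idx :: "'l set"
  assumes indep: "indep_vars (\<lambda>_. borel) V Idx"
    and mean: "t \<in> Idx \<Longrightarrow> expectation (V t) = 0"
    and second_moment: "t \<in> Idx \<Longrightarrow> expectation (\<lambda>\<omega>. V t \<omega> ^ 2) = 1"
    and moments: "\<exists>C. \<forall>t\<in>Idx. integrable M (\<lambda>\<omega>. \<bar>V t \<omega>\<bar> ^ m) \<and>
      expectation (\<lambda>\<omega>. \<bar>V t \<omega>\<bar> ^ m) \<le> C"
begin

lemma measurable_V: "t \<in> Idx \<Longrightarrow> V t \<in> borel_measurable M"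
  using indep by (simp add: indep_vars_def)

lemma integrable_abs_power: "t \<in> Idx \<Longrightarrow> integrable M (\<lambda>\<omega>. \<bar>V t \<omega>\<bar> ^ m)"
  using moments by blast

lemma integrable_power: "t \<in> Idx \<Longrightarrow> integrable M (\<lambda>\<omega>. V t \<omega> ^ m)"
proof (rule integrable_abs_cancel)
  assume t: "t \<in> Idx"
  note [measurable] = measurable_V[OF t]
  show "integrable M (\<lambda>\<omega>. \<bar>V t \<omega> ^ m\<bar>)"
    using integrable_abs_power[OF t] by (simp add: power_abs)
  show "(\<lambda>\<omega>. V t \<omega> ^ m) \<in> borel_measurable M" by measurable
qed

text \<open>Factors with equal labels are collected into a power of one variable before independence
  is applied.\<close>

lemma
  assumes E: "finite E" "lam ` E \<subseteq> Idx"
  shows integrable_prod: "integrable M (\<lambda>\<omega>. \<Prod>e\<in>E. V (lam e) \<omega>)"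
    and expectation_prod: "expectation (\<lambda>\<omega>. \<Prod>e\<in>E. V (lam e) \<omega>) =
      (\<Prod>t\<in>lam ` E. expectation (\<lambda>\<omega>. V t \<omega> ^ card {e \<in> E. lam e = t}))"
proof -
  have eq: "(\<Prod>e\<in>E. V (lam e) \<omega>) = (\<Prod>t\<in>lam ` E. V t \<omega> ^ card {e \<in> E. lam e = t})" for \<omega>
    using prod.image_gen[OF E(1), of "\<lambda>e. V (lam e) \<omega>" lam] by simp
  have ind: "indep_vars (\<lambda>_. borel) (\<lambda>t \<omega>. V t \<omega> ^ card {e \<in> E. lam e = t}) (lam ` E)"
    by (rule indep_vars_compose2[OF indep_vars_subset[OF indep E(2)]]) simp
  show "integrable M (\<lambda>\<omega>. \<Prod>e\<in>E. V (lam e) \<omega>)"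
    unfolding eq using E by (intro indep_vars_integrable ind) (auto intro: integrable_power)
  show "expectation (\<lambda>\<omega>. \<Prod>e\<in>E. V (lam e) \<omega>) =
      (\<Prod>t\<in>lam ` E. expectation (\<lambda>\<omega>. V t \<omega> ^ card {e \<in> E. lam e = t}))"
    unfolding eq using E by (intro indep_vars_lebesgue_integral ind) (auto intro: integrable_power)
qed

lemma expectation_prod_single:
  assumes E: "finite E" "lam ` E \<subseteq> Idx" and e: "e \<in> E" "\<And>e'. e' \<in> E \<Longrightarrow> lam e' = lam e \<Longrightarrow> e' = e"
  shows "expectation (\<lambda>\<omega>. \<Prod>e\<in>E. V (lam e) \<omega>) = 0"
proof -
  have "{e' \<in> E. lam e' = lam e} = {e}" using e by auto
  then have "expectation (\<lambda>\<omega>. V (lam e) \<omega> ^ card {e' \<in> E. lam e' = lam e}) = 0"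
    using mean[of "lam e"] E(2) e(1) by auto
  then show ?thesis
    unfolding expectation_prod[OF E] using E(1) e(1) by (intro prod_zero) auto
qed

lemma expectation_prod_pairs:
  assumes E: "finite E" "lam ` E \<subseteq> Idx" and "\<And>e. e \<in> E \<Longrightarrow> card {e' \<in> E. lam e' = lam e} = 2"
  shows "expectation (\<lambda>\<omega>. \<Prod>e\<in>E. V (lam e) \<omega>) = 1"
  unfolding expectation_prod[OF E] using assms by (intro prod.neutral) (auto simp: second_moment)

lemma expectation_prod_disjoint:
  assumes E: "finite E" "lam ` E \<subseteq> Idx" and E': "finite E'" "lam ` E' \<subseteq> Idx"
    and disj: "\<And>e e'. e \<in> E \<Longrightarrow> e' \<in> E' \<Longrightarrow> lam e \<noteq> lam e'"
  shows "expectation (\<lambda>\<omega>. \<Prod>e\<in>E \<union> E'. V (lam e) \<omega>) =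
    expectation (\<lambda>\<omega>. \<Prod>e\<in>E. V (lam e) \<omega>) * expectation (\<lambda>\<omega>. \<Prod>e\<in>E'. V (lam e) \<omega>)"
proof -
  have "{e \<in> E \<union> E'. lam e = t} = {e \<in> E. lam e = t}" if "t \<in> lam ` E" for t
    using that disj by fastforce
  moreover have "{e \<in> E \<union> E'. lam e = t} = {e \<in> E'. lam e = t}" if "t \<in> lam ` E'" for t
    using that disj by fastforce
  moreover have "lam ` E \<inter> lam ` E' = {}" using disj by auto
  moreover have "lam ` (E \<union> E') \<subseteq> Idx" using E E' by auto
  ultimately show ?thesis
    using E E' by (simp add: expectation_prod image_Un prod.union_disjoint)
qed

text \<open>One constant serves all index sets of bounded size and all labellings. This uniformity
  lets a mere count of walks bound a sum of expectations.\<close>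

lemma expectation_prod_bounded:
  "\<exists>C\<ge>1. \<forall>E (lam :: 'e \<Rightarrow> 'l). finite E \<longrightarrow> card E \<le> N \<longrightarrow> lam ` E \<subseteq> Idx \<longrightarrow>
     \<bar>expectation (\<lambda>\<omega>. \<Prod>e\<in>E. V (lam e) \<omega>)\<bar> \<le> C"
proof -
  obtain c where c: "\<And>m t. t \<in> Idx \<Longrightarrow> expectation (\<lambda>\<omega>. \<bar>V t \<omega>\<bar> ^ m) \<le> c m"
    using moments by metis
  let ?C = "1 + (\<Sum>m\<le>N. real m * \<bar>c m\<bar>)"
  have "\<bar>expectation (\<lambda>\<omega>. \<Prod>e\<in>E. V (lam e) \<omega>)\<bar> \<le> ?C"
    if E: "finite E" "card E \<le> N" "lam ` E \<subseteq> Idx" for E and lam :: "'e \<Rightarrow> 'l"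
  proof -
    have int: "integrable M (\<lambda>\<omega>. \<bar>V (lam e) \<omega>\<bar> ^ card E)" if "e \<in> E" for e
      using E(3) that by (intro integrable_abs_power) auto
    have "\<bar>expectation (\<lambda>\<omega>. \<Prod>e\<in>E. V (lam e) \<omega>)\<bar> \<le> expectation (\<lambda>\<omega>. \<bar>\<Prod>e\<in>E. V (lam e) \<omega>\<bar>)"
      by (rule integral_abs_bound)
    also have "\<dots> \<le> expectation (\<lambda>\<omega>. 1 + (\<Sum>e\<in>E. \<bar>V (lam e) \<omega>\<bar> ^ card E))"
      using E int by (intro integral_mono) (auto intro!: integrable_abs integrable_prod prod_abs_le)
    also have "\<dots> = 1 + (\<Sum>e\<in>E. expectation (\<lambda>\<omega>. \<bar>V (lam e) \<omega>\<bar> ^ card E))"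
      using int by (simp add: prob_space)
    also have "(\<Sum>e\<in>E. expectation (\<lambda>\<omega>. \<bar>V (lam e) \<omega>\<bar> ^ card E)) \<le> (\<Sum>e\<in>E. \<bar>c (card E)\<bar>)"
      using E(3) c by (intro sum_mono) (meson abs_ge_self image_subset_iff order_trans)
    also have "\<dots> = real (card E) * \<bar>c (card E)\<bar>" by simp
    also have "\<dots> \<le> (\<Sum>m\<le>N. real m * \<bar>c m\<bar>)"
      using E(2) by (intro member_le_sum[of "card E" "{..N}" "\<lambda>m. real m * \<bar>c m\<bar>"]) auto
    finally show ?thesis by simp
  qed
  moreover have "1 \<le> ?C" by (simp add: sum_nonneg)
  ultimately show ?thesis by blast
qed

section \<open>Expectations of products of centred monomials\<close>

lemma centred_prod_expand:
  assumes fin: "finite R" "finite A" and lam: "lam ` (R \<times> A) \<subseteq> Idx"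
  shows "(\<Prod>r\<in>R. (\<Prod>a\<in>A. V (lam (r, a)) \<omega>) - c r) =
    (\<Sum>T\<in>Pow R. (\<Prod>r\<in>R - T. - c r) * (\<Prod>e\<in>T \<times> A. V (lam e) \<omega>))"
proof -
  have "(\<Prod>r\<in>R. (\<Prod>a\<in>A. V (lam (r, a)) \<omega>) - c r) =
      (\<Prod>r\<in>R. (\<Prod>a\<in>A. V (lam (r, a)) \<omega>) + - c r)"
    by simp
  also have "\<dots> = (\<Sum>T\<in>Pow R. (\<Prod>r\<in>R - T. - c r) * (\<Prod>e\<in>T \<times> A. V (lam e) \<omega>))"
    unfolding prod_add[OF fin(1)]
    by (intro sum.cong refl) (simp add: prod.cartesian_product mult.commute case_prod_eta)
  finally show ?thesis .
qed

lemma integrable_prod_mult: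
  assumes "finite E" "lam ` E \<subseteq> Idx" "finite E'" "lam ` E' \<subseteq> Idx" "E \<inter> E' = {}"
  shows "integrable M (\<lambda>\<omega>. (\<Prod>e\<in>E. V (lam e) \<omega>) * (\<Prod>e\<in>E'. V (lam e) \<omega>))"
  using integrable_prod[of "E \<union> E'" lam] assms by (simp add: prod.union_disjoint image_Un)

lemma
  assumes fin: "finite R" "finite A" and lam: "lam ` (R \<times> A) \<subseteq> Idx"
  shows integrable_centred_prod:
    "integrable M (\<lambda>\<omega>. \<Prod>r\<in>R. (\<Prod>a\<in>A. V (lam (r, a)) \<omega>) - c r)"
    and expectation_centred_prod:
    "expectation (\<lambda>\<omega>. \<Prod>r\<in>R. (\<Prod>a\<in>A. V (lam (r, a)) \<omega>) - c r) =
      (\<Sum>T\<in>Pow R. (\<Prod>r\<in>R - T. - c r) * expectation (\<lambda>\<omega>. \<Prod>e\<in>T \<times> A. V (lam e) \<omega>))"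
proof -
  have int: "integrable M (\<lambda>\<omega>. \<Prod>e\<in>T \<times> A. V (lam e) \<omega>)" if "T \<in> Pow R" for T
    using that fin lam finite_subset[of T R] by (intro integrable_prod) auto
  show "integrable M (\<lambda>\<omega>. \<Prod>r\<in>R. (\<Prod>a\<in>A. V (lam (r, a)) \<omega>) - c r)"
    unfolding centred_prod_expand[OF fin lam] using int by auto
  show "expectation (\<lambda>\<omega>. \<Prod>r\<in>R. (\<Prod>a\<in>A. V (lam (r, a)) \<omega>) - c r) =
      (\<Sum>T\<in>Pow R. (\<Prod>r\<in>R - T. - c r) * expectation (\<lambda>\<omega>. \<Prod>e\<in>T \<times> A. V (lam e) \<omega>))"
    unfolding centred_prod_expand[OF fin lam] using int by simp
qed

text \<open>If row \<open>r0\<close> contains a label that occurs nowhere else, every expectation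
  involving this row vanishes, \<open>c r0\<close> included; if it shares no label with other rows,
  it is independent of them. In both cases the expectation of row \<open>r0\<close> times the rows
  \<open>T\<close> is \<open>c r0\<close> times that of the rows \<open>T\<close>, for every
  \<open>T\<close> without \<open>r0\<close>, and the expansion cancels termwise.\<close>

lemma expectation_centred_prod_eq_0:
  assumes fin: "finite R" "finite A" and lam: "lam ` (R \<times> A) \<subseteq> Idx" and r0: "r0 \<in> R"
    and c: "c r0 = expectation (\<lambda>\<omega>. \<Prod>a\<in>A. V (lam (r0, a)) \<omega>)"
    and cases: "(\<exists>a\<in>A. \<forall>e\<in>R \<times> A. lam e = lam (r0, a) \<longrightarrow> e = (r0, a)) \<or>
      (\<forall>a\<in>A. \<forall>e\<in>R \<times> A. lam e = lam (r0, a) \<longrightarrow> fst e = r0)"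
  shows "expectation (\<lambda>\<omega>. \<Prod>r\<in>R. (\<Prod>a\<in>A. V (lam (r, a)) \<omega>) - c r) = 0"
proof -
  let ?R = "R - {r0}" and ?X = "\<lambda>T \<omega>. \<Prod>e\<in>T \<times> A. V (lam e) \<omega>"
  have x0: "(\<Prod>a\<in>A. V (lam (r0, a)) \<omega>) = ?X {r0} \<omega>" for \<omega>
  proof -
    have "{r0} \<times> A = Pair r0 ` A" by auto
    then show ?thesis by (simp add: prod.reindex inj_on_def)
  qed
  have lamR: "lam ` (T \<times> A) \<subseteq> Idx" if "T \<subseteq> R" for T
    using lam that by blast
  have finT: "finite (T \<times> A)" if "T \<subseteq> R" for T
    using fin that finite_subset by auto
  have key: "expectation (\<lambda>\<omega>. ?X {r0} \<omega> * ?X T \<omega>) = c r0 * expectation (?X T)" if T: "T \<subseteq> ?R" for T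
  proof -
    have un: "?X {r0} \<omega> * ?X T \<omega> = (\<Prod>e\<in>({r0} \<times> A) \<union> (T \<times> A). V (lam e) \<omega>)" for \<omega>
      using T fin finite_subset[of T R] by (subst prod.union_disjoint) auto
    have T': "T \<subseteq> R" "{r0} \<subseteq> R" using T r0 by auto
    from cases show ?thesis
    proof
      assume "\<exists>a\<in>A. \<forall>e\<in>R \<times> A. lam e = lam (r0, a) \<longrightarrow> e = (r0, a)"
      then obtain a where a: "a \<in> A" "\<And>e. e \<in> R \<times> A \<Longrightarrow> lam e = lam (r0, a) \<Longrightarrow> e = (r0, a)"
        by blast
      have "expectation (?X {r0}) = 0"
        using a r0 by (intro expectation_prod_single[of _ _ "(r0, a)"] finT lamR T') auto
      moreover have "expectation (\<lambda>\<omega>. \<Prod>e\<in>({r0} \<times> A) \<union> (T \<times> A). V (lam e) \<omega>) = 0"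
        using a r0 T' finT[OF T'(1)] finT[OF T'(2)] lamR[OF T'(1)] lamR[OF T'(2)]
        by (intro expectation_prod_single[of _ _ "(r0, a)"]) auto
      ultimately show ?thesis by (simp add: un c x0)
    next
      assume *: "\<forall>a\<in>A. \<forall>e\<in>R \<times> A. lam e = lam (r0, a) \<longrightarrow> fst e = r0"
      have "lam e \<noteq> lam e'" if "e \<in> {r0} \<times> A" "e' \<in> T \<times> A" for e e'
        using * that T by (metis DiffE SigmaE Sigma_mono T'(1) fst_conv insertI1 mem_Sigma_iff
            order_refl singletonD subsetD)
      then show ?thesis
        unfolding un c x0 by (intro expectation_prod_disjoint finT lamR T')
    qed
  qed
  have "expectation (\<lambda>\<omega>. \<Prod>r\<in>R. (\<Prod>a\<in>A. V (lam (r, a)) \<omega>) - c r) =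
    expectation (\<lambda>\<omega>. (?X {r0} \<omega> - c r0) * (\<Prod>r\<in>?R. (\<Prod>a\<in>A. V (lam (r, a)) \<omega>) - c r))"
    using fin r0 by (simp add: prod.remove[of R r0] x0)
  also have "\<dots> = expectation (\<lambda>\<omega>. \<Sum>T\<in>Pow ?R. (\<Prod>r\<in>?R - T. - c r) *
      (?X {r0} \<omega> * ?X T \<omega> - c r0 * ?X T \<omega>))"
    using fin lam by (subst centred_prod_expand) (auto simp: sum_distrib_left algebra_simps)
  also have "\<dots> = (\<Sum>T\<in>Pow ?R. (\<Prod>r\<in>?R - T. - c r) *
      (expectation (\<lambda>\<omega>. ?X {r0} \<omega> * ?X T \<omega>) - c r0 * expectation (?X T)))"
  proof -
    have "integrable M (\<lambda>\<omega>. ?X {r0} \<omega> * ?X T \<omega>)" "integrable M (?X T)" if "T \<in> Pow ?R" for T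
      using that r0 finT[of T] lamR[of T] finT[of "{r0}"] lamR[of "{r0}"]
      by (auto intro!: integrable_prod_mult integrable_prod)
    then show ?thesis by (subst Bochner_Integration.integral_sum) auto
  qed
  also have "\<dots> = 0" using key by (intro sum.neutral) auto
  finally show ?thesis .
qed

lemma expectation_centred_prod_bounded:
  "\<exists>C. \<forall>(lam :: nat \<times> nat \<Rightarrow> 'l). lam ` ({..<m} \<times> {..<k}) \<subseteq> Idx \<longrightarrow>
    \<bar>expectation (\<lambda>\<omega>. \<Prod>r<m. (\<Prod>a<k. V (lam (r, a)) \<omega>) -
       expectation (\<lambda>\<omega>. \<Prod>a<k. V (lam (r, a)) \<omega>))\<bar> \<le> C"
proof -
  obtain C1 where C1: "C1 \<ge> 1" "\<And>E (lam :: nat \<times> nat \<Rightarrow> 'l). finite E \<Longrightarrow> card E \<le> m * k \<Longrightarrow>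
     lam ` E \<subseteq> Idx \<Longrightarrow> \<bar>expectation (\<lambda>\<omega>. \<Prod>e\<in>E. V (lam e) \<omega>)\<bar> \<le> C1"
    using expectation_prod_bounded[of "m * k"] by blast
  obtain C2 where C2: "C2 \<ge> 1" "\<And>E (lam :: nat \<Rightarrow> 'l). finite E \<Longrightarrow> card E \<le> k \<Longrightarrow>
     lam ` E \<subseteq> Idx \<Longrightarrow> \<bar>expectation (\<lambda>\<omega>. \<Prod>e\<in>E. V (lam e) \<omega>)\<bar> \<le> C2"
    using expectation_prod_bounded[of k] by blast
  have "\<bar>expectation (\<lambda>\<omega>. \<Prod>r<m. (\<Prod>a<k. V (lam (r, a)) \<omega>) -
       expectation (\<lambda>\<omega>. \<Prod>a<k. V (lam (r, a)) \<omega>))\<bar> \<le> (\<Sum>T\<in>Pow {..<m}. C2 ^ m * C1)"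
    if lam: "lam ` ({..<m} \<times> {..<k}) \<subseteq> Idx" for lam :: "nat \<times> nat \<Rightarrow> 'l"
  proof -
    let ?c = "\<lambda>r. expectation (\<lambda>\<omega>. \<Prod>a<k. V (lam (r, a)) \<omega>)"
    have c: "\<bar>?c r\<bar> \<le> C2" if "r < m" for r
      using C2(2)[of "{..<k}" "\<lambda>a. lam (r, a)"] lam that by auto
    have "\<bar>(\<Prod>r\<in>{..<m} - T. - ?c r) * expectation (\<lambda>\<omega>. \<Prod>e\<in>T \<times> {..<k}. V (lam e) \<omega>)\<bar>
        \<le> C2 ^ m * C1" if T: "T \<in> Pow {..<m}" for T
    proof -
      have "\<bar>\<Prod>r\<in>{..<m} - T. - ?c r\<bar> \<le> C2 ^ m"
        unfolding abs_prod using c C2(1) card_mono[of "{..<m}" "{..<m} - T"]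
        by (intro prod_le_power) auto
      moreover have "\<bar>expectation (\<lambda>\<omega>. \<Prod>e\<in>T \<times> {..<k}. V (lam e) \<omega>)\<bar> \<le> C1"
        using T lam finite_subset[of T "{..<m}"] card_mono[of "{..<m}" T]
        by (intro C1(2)) (auto simp: card_cartesian_product)
      ultimately show ?thesis
        unfolding abs_mult using C2(1) by (intro mult_mono) auto
    qed
    then show ?thesis
      unfolding expectation_centred_prod[OF finite_lessThan finite_lessThan lam]
      by (intro order_trans[OF sum_abs] sum_mono) auto
  qed
  then show ?thesis by blast
qed

end

section \<open>Counting closed walks\<close>

lemma card_le_fibres:
  assumes "finite S" "finite T" "h ` S \<subseteq> T"
    and "\<And>x. x \<in> S \<Longrightarrow> card {y \<in> S. h y = h x} \<le> B"
  shows "card S \<le> card T * B"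
proof -
  have "card S = (\<Sum>t\<in>h ` S. card {y \<in> S. h y = t})"
    using sum.image_gen[OF assms(1), of "\<lambda>_. 1 :: nat" h] by simp
  also have "\<dots> \<le> (\<Sum>t\<in>h ` S. B)"
    using assms(4) by (intro sum_mono) auto
  also have "\<dots> \<le> card T * B"
    using assms by (simp add: card_mono)
  finally show ?thesis .
qed

text \<open>An element of \<open>P\<close> is encoded by its coordinates in \<open>F\<close> together with one bit for every
  other coordinate, from which the coordinates are recovered in the order of their rank.\<close>

lemma card_le_encoding:
  fixes val :: "'z \<Rightarrow> 'i \<Rightarrow> nat" and rank :: "'i \<Rightarrow> nat"
    and code :: "'z \<Rightarrow> 'i \<Rightarrow> bool"
  assumes "finite I" "F \<subseteq> I"
    and bound: "\<And>x i. x \<in> P \<Longrightarrow> i \<in> F \<Longrightarrow> val x i < n"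
    and inj: "\<And>x y. x \<in> P \<Longrightarrow> y \<in> P \<Longrightarrow> \<forall>i\<in>I. val x i = val y i \<Longrightarrow> x = y"
    and step: "\<And>x y i. \<lbrakk>x \<in> P; y \<in> P; i \<in> I; i \<notin> F; \<forall>j\<in>I. rank j < rank i \<longrightarrow> val x j = val y j;
       code x i = code y i\<rbrakk> \<Longrightarrow> val x i = val y i"
  shows "card P \<le> n ^ card F * 2 ^ card I"
proof -
  let ?c = "\<lambda>x. (restrict (val x) F, {i \<in> I. code x i})"
  have "inj_on ?c P"
  proof (rule inj_onI)
    fix x y assume xy: "x \<in> P" "y \<in> P" "?c x = ?c y"
    have eq: "val x i = val y i" if "i \<in> F" for i
      using xy(3) that by (auto simp: restrict_def fun_eq_iff split: if_splits)
    have bit: "code x i = code y i" if "i \<in> I" for i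
      using xy(3) that by auto
    have "\<forall>i\<in>I. rank i = l \<longrightarrow> val x i = val y i" for l
    proof (induction l rule: less_induct)
      case (less l)
      then show ?case using step[OF xy(1,2)] eq bit by blast
    qed
    then show "x = y" by (intro inj xy) blast
  qed
  moreover have "?c ` P \<subseteq> (F \<rightarrow>\<^sub>E {..<n}) \<times> Pow I"
    using bound by auto
  moreover have fin: "finite F" using assms(1,2) finite_subset by blast
  ultimately have "card P \<le> card ((F \<rightarrow>\<^sub>E {..<n}) \<times> Pow I)"
    using assms(1) by (intro card_inj_on_le) (auto intro: finite_PiE)
  also have "\<dots> = n ^ card F * 2 ^ card I"
    using fin assms(1) by (simp add: card_cartesian_product card_PiE card_Pow)
  finally show ?thesis .
qed

definition walks :: "nat \<Rightarrow> nat \<Rightarrow> (nat \<Rightarrow> nat) set" where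
  "walks n k = {\<pi> \<in> {..k} \<rightarrow>\<^sub>E {..<n}. \<pi> k = \<pi> 0}"

lemma finite_walks [simp]: "finite (walks n k)"
  unfolding walks_def by (rule finite_subset[of _ "{..k} \<rightarrow>\<^sub>E {..<n}"]) (auto intro: finite_PiE)

lemma walks_less: "\<pi> \<in> walks n k \<Longrightarrow> a \<le> k \<Longrightarrow> \<pi> a < n"
  by (auto simp: walks_def PiE_iff)

lemma walks_closed: "\<pi> \<in> walks n k \<Longrightarrow> \<pi> k = \<pi> 0"
  by (simp add: walks_def)

lemma walks_eqI:
  assumes "\<pi> \<in> walks n k" "\<rho> \<in> walks n k" "\<And>c. c < k \<Longrightarrow> \<pi> c = \<rho> c" "k > 0"
  shows "\<pi> = \<rho>"
proof (rule PiE_ext)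
  show "\<pi> \<in> {..k} \<rightarrow>\<^sub>E {..<n}" "\<rho> \<in> {..k} \<rightarrow>\<^sub>E {..<n}"
    using assms(1,2) by (simp_all add: walks_def)
  show "\<pi> c = \<rho> c" if "c \<in> {..k}" for c
    using that assms(3)[of c] assms(3)[of 0] assms(4) walks_closed[OF assms(1)] walks_closed[OF assms(2)]
    by (cases "c = k") auto
qed

text \<open>The multiplicities add up to \<open>card E\<close>, and every label outside
  \<open>S\<close> accounts for at least two. Thus each unit of excess over multiplicity two in
  \<open>S\<close> costs half a distinct label.\<close>

lemma card_multiplicity_le:
  assumes "finite E" "\<And>t. t \<in> lam ` E \<Longrightarrow> 2 \<le> card {e \<in> E. lam e = t}" "S \<subseteq> lam ` E"
  shows "2 * card (lam ` E) + (\<Sum>t\<in>S. card {e \<in> E. lam e = t}) \<le> card E + 2 * card S"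
proof -
  have fin: "finite (lam ` E)" "finite S"
    using assms(1) finite_subset[OF assms(3)] by auto
  have "card E = (\<Sum>t\<in>lam ` E. card {e \<in> E. lam e = t})"
    using sum.image_gen[OF assms(1), of "\<lambda>_. 1 :: nat" lam] by simp
  also have "\<dots> = (\<Sum>t\<in>lam ` E - S. card {e \<in> E. lam e = t}) + (\<Sum>t\<in>S. card {e \<in> E. lam e = t})"
    using sum.subset_diff[OF assms(3) fin(1)] by simp
  finally have 1: "card E = (\<Sum>t\<in>lam ` E - S. card {e \<in> E. lam e = t}) + (\<Sum>t\<in>S. card {e \<in> E. lam e = t})" .
  have "(\<Sum>t\<in>lam ` E - S. 2) \<le> (\<Sum>t\<in>lam ` E - S. card {e \<in> E. lam e = t})"
    using assms(2) by (intro sum_mono) auto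
  then have "2 * card (lam ` E - S) \<le> (\<Sum>t\<in>lam ` E - S. card {e \<in> E. lam e = t})" by simp
  moreover have "card (lam ` E - S) = card (lam ` E) - card S" "card S \<le> card (lam ` E)"
    using assms(3) fin by (auto simp: card_Diff_subset card_mono)
  ultimately show ?thesis using 1 by linarith
qed

text \<open>What the counting needs to know about link functions: labels of different matrices
  differ, and the start of an edge together with its label leaves at most two candidates for its
  end, which the bit \<open>side\<close> tells apart.\<close>

locale patterned_inputs = independent_inputs M V Idx
  for M :: "'a measure" and V :: "'l \<Rightarrow> 'a \<Rightarrow> real" and Idx :: "'l set" +
  fixes K :: "'k set" and lab :: "nat \<Rightarrow> 'k \<Rightarrow> nat \<Rightarrow> nat \<Rightarrow> 'l"
    and side :: "nat \<Rightarrow> 'k \<Rightarrow> nat \<Rightarrow> nat \<Rightarrow> bool"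
  assumes lab_Idx: "\<lbrakk>\<kappa> \<in> K; i < n; j < n\<rbrakk> \<Longrightarrow> lab n \<kappa> i j \<in> Idx"
    and lab_letter: "lab n \<kappa> i j = lab n \<kappa>' i' j' \<Longrightarrow> \<kappa> = \<kappa>'"
    and lab_side: "\<lbrakk>\<kappa> \<in> K; i < n; j < n; j' < n; lab n \<kappa> i j = lab n \<kappa> i j';
      side n \<kappa> i j = side n \<kappa> i j'\<rbrakk> \<Longrightarrow> j = j'"
begin

definition edge_label :: "nat \<Rightarrow> 'k list \<Rightarrow> (nat \<Rightarrow> nat) \<Rightarrow> nat \<Rightarrow> 'l" where
  "edge_label n ks \<pi> a = lab n (ks ! a) (\<pi> a) (\<pi> (Suc a))"

definition edge_labels :: "nat \<Rightarrow> 'k list \<Rightarrow> (nat \<Rightarrow> nat \<Rightarrow> nat) \<Rightarrow> nat \<times> nat \<Rightarrow> 'l" where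
  "edge_labels n ks Z e = edge_label n ks (Z (fst e)) (snd e)"

lemma edge_label_Idx:
  "\<lbrakk>set ks \<subseteq> K; \<pi> \<in> walks n (length ks); a < length ks\<rbrakk> \<Longrightarrow> edge_label n ks \<pi> a \<in> Idx"
  unfolding edge_label_def by (intro lab_Idx) (auto intro: walks_less)

text \<open>In the count below, walk \<open>r\<close> starts right after its edge \<open>cl r\<close>, which is therefore the last
  edge to be traversed and closes the walk; \<open>pos\<close> determines the order of the walks.\<close>

definition edge_rank :: "nat \<Rightarrow> (nat \<Rightarrow> nat) \<Rightarrow> (nat \<Rightarrow> nat) \<Rightarrow> nat \<times> nat \<Rightarrow> nat" where
  "edge_rank k pos cl e = pos (fst e) * k +
     (if cl (fst e) < snd e then snd e - Suc (cl (fst e)) else snd e + k - Suc (cl (fst e)))"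

definition first_edges ::
  "nat \<Rightarrow> nat \<Rightarrow> (nat \<Rightarrow> nat) \<Rightarrow> (nat \<Rightarrow> nat) \<Rightarrow> (nat \<times> nat \<Rightarrow> 't) \<Rightarrow> (nat \<times> nat) set" where
  "first_edges m k pos cl lam = {e \<in> {..<m} \<times> {..<k}. \<forall>e'\<in>{..<m} \<times> {..<k}.
     edge_rank k pos cl e' < edge_rank k pos cl e \<longrightarrow> lam e' \<noteq> lam e}"

lemma edge_rank_bounds:
  assumes "snd e < k" "cl (fst e) < k"
  shows "pos (fst e) * k \<le> edge_rank k pos cl e" "edge_rank k pos cl e < (pos (fst e) + 1) * k"
  using assms by (auto simp: edge_rank_def)

lemma edge_rank_less_pos:
  assumes "snd e < k" "cl (fst e) < k" "snd e' < k" "cl (fst e') < k"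
    and "edge_rank k pos cl e' < edge_rank k pos cl e"
  shows "pos (fst e') \<le> pos (fst e)"
proof (rule ccontr)
  assume "\<not> ?thesis"
  then have "(pos (fst e) + 1) * k \<le> pos (fst e') * k" by (intro mult_right_mono) auto
  then show False
    using edge_rank_bounds[of e k cl pos] edge_rank_bounds[of e' k cl pos] assms by linarith
qed

lemma edge_rank_inj:
  assumes "inj_on pos {..<m}" "\<And>r. r < m \<Longrightarrow> cl r < k"
  shows "inj_on (edge_rank k pos cl) ({..<m} \<times> {..<k})"
proof (rule inj_onI)
  fix e e' assume e: "e \<in> {..<m} \<times> {..<k}" "e' \<in> {..<m} \<times> {..<k}"
    and eq: "edge_rank k pos cl e = edge_rank k pos cl e'"
  have b: "snd e < k" "cl (fst e) < k" "snd e' < k" "cl (fst e') < k" using e assms by auto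
  have "\<not> pos (fst e) < pos (fst e')" "\<not> pos (fst e') < pos (fst e)"
    using edge_rank_bounds[of e k cl pos, OF b(1,2)] edge_rank_bounds[of e' k cl pos, OF b(3,4)] eq
      mult_right_mono[of "pos (fst e) + 1" "pos (fst e')" k]
      mult_right_mono[of "pos (fst e') + 1" "pos (fst e)" k] by (auto simp del: add_mult_distrib)
  then have "pos (fst e) = pos (fst e')" by simp
  then have f: "fst e = fst e'" using assms(1) e by (auto simp: inj_on_def)
  then have "snd e = snd e'"
    using eq b by (auto simp: edge_rank_def split: if_splits)
  with f show "e = e'" by (simp add: prod_eq_iff)
qed

lemma card_first_edges:
  assumes "inj_on pos {..<m}" "\<And>r. r < m \<Longrightarrow> cl r < k"
  shows "card (first_edges m k pos cl lam) \<le> card (lam ` ({..<m} \<times> {..<k}))"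
proof (rule card_inj_on_le)
  show "inj_on lam (first_edges m k pos cl lam)"
  proof (rule inj_onI)
    fix e e' assume *: "e \<in> first_edges m k pos cl lam" "e' \<in> first_edges m k pos cl lam" "lam e = lam e'"
    from *(1,2) have "e \<in> {..<m} \<times> {..<k}" "e' \<in> {..<m} \<times> {..<k}"
        "\<forall>d\<in>{..<m} \<times> {..<k}. edge_rank k pos cl d < edge_rank k pos cl e \<longrightarrow> lam d \<noteq> lam e"
        "\<forall>d\<in>{..<m} \<times> {..<k}. edge_rank k pos cl d < edge_rank k pos cl e' \<longrightarrow> lam d \<noteq> lam e'"
      unfolding first_edges_def mem_Collect_eq by blast+
    then have "\<not> edge_rank k pos cl e < edge_rank k pos cl e'" "\<not> edge_rank k pos cl e' < edge_rank k pos cl e"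
      using *(3) by metis+
    then have "edge_rank k pos cl e = edge_rank k pos cl e'" by simp
    then show "e = e'"
      using * inj_onD[OF edge_rank_inj[OF assms]] by (simp add: first_edges_def)
  qed
qed (auto simp: first_edges_def)

section \<open>Tuples of walks with prescribed coincidences of labels\<close>

definition configurations :: "nat \<Rightarrow> nat \<Rightarrow> nat \<Rightarrow> (nat \<Rightarrow> nat \<Rightarrow> nat) set" where
  "configurations n k m = {..<m} \<rightarrow>\<^sub>E walks n k"

lemma finite_configurations [simp]: "finite (configurations n k m)"
  by (simp add: configurations_def finite_PiE)

text \<open>The start of each walk is free, and so is the end of an edge with a new label; after an
  old label one bit fixes the end. The closing edge leads back to the start and costs nothing even
  if its label is new. A clever choice of \<open>pos\<close> and \<open>cl\<close> therefore saves
  factors \<open>n\<close>.\<close>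

lemma card_configurations_le:
  fixes lam0 :: "nat \<times> nat \<Rightarrow> 't"
  assumes k: "k = length ks" "k > 0" and ks: "set ks \<subseteq> K" and m: "m > 0" and n: "n > 0"
    and cl: "\<And>r. r < m \<Longrightarrow> cl r < k"
    and P: "P \<subseteq> configurations n k m"
      "\<And>Z e e'. \<lbrakk>Z \<in> P; e \<in> {..<m} \<times> {..<k}; e' \<in> {..<m} \<times> {..<k}; lam0 e = lam0 e'\<rbrakk> \<Longrightarrow>
         edge_labels n ks Z e = edge_labels n ks Z e'"
  shows "card P \<le> n ^ (m + card {e \<in> first_edges m k pos cl lam0. snd e \<noteq> cl (fst e)}) * 2 ^ (m * k)"
proof -
  let ?I = "{..<m} \<times> {..<k}" and ?rank = "edge_rank k pos cl"
  let ?N = "{e \<in> first_edges m k pos cl lam0. snd e \<noteq> cl (fst e)}"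
  let ?next = "\<lambda>a. if Suc a = k then 0 else Suc a"
  \<comment> \<open>Each free vertex is the cyclic successor of an edge: the start of walk
    \<open>r\<close> follows its closing edge \<open>cl r\<close>, the others are the ends of edges
    with new labels.\<close>
  define F where "F = (\<lambda>r. (r, ?next (cl r))) ` {..<m} \<union> (\<lambda>e. (fst e, ?next (snd e))) ` ?N"
  have NI: "?N \<subseteq> ?I" by (auto simp: first_edges_def)
  then have finN: "finite ?N" using finite_subset by blast
  have FI: "F \<subseteq> ?I"
  proof -
    have "?next a < k" if "a < k" for a using that by auto
    then show ?thesis using NI cl k(2) unfolding F_def by auto
  qed
  have cardF: "card F \<le> m + card ?N"
  proof -
    have "card F \<le> card ((\<lambda>r. (r, ?next (cl r))) ` {..<m}) + card ((\<lambda>e. (fst e, ?next (snd e))) ` ?N)"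
      unfolding F_def by (rule card_Un_le)
    also have "\<dots> \<le> card {..<m} + card ?N"
      using finN by (intro add_mono card_image_le) auto
    finally show ?thesis by simp
  qed
  have walk: "Z r \<in> walks n k" if "Z \<in> P" "r < m" for Z r
    using that P(1) by (auto simp: configurations_def)
  have nxt: "Z r (Suc a) = Z r (?next a)" if "Z \<in> P" "r < m" "a < k" for Z r a
    using walks_closed[OF walk[OF that(1,2)]] by auto
  \<comment> \<open>A vertex has the rank of the edge that leaves it; its bit is the side of the
    edge that arrives at it.\<close>
  have "card P \<le> n ^ card F * 2 ^ card ?I"
  proof (rule card_le_encoding[where val = "\<lambda>Z i. Z (fst i) (snd i)" and rank = ?rank and
        code = "\<lambda>Z i. let a = (if snd i = 0 then k - 1 else snd i - 1) in
          side n (ks ! a) (Z (fst i) a) (Z (fst i) (snd i))"])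
    show "Z (fst i) (snd i) < n" if "Z \<in> P" "i \<in> F" for Z i
      using walks_less[OF walk[OF that(1), of "fst i"], of "snd i"] FI that(2) by auto
    show "Z = Y" if "Z \<in> P" "Y \<in> P" and eq: "\<forall>i\<in>?I. Z (fst i) (snd i) = Y (fst i) (snd i)" for Z Y
    proof (rule PiE_ext)
      show "Z \<in> {..<m} \<rightarrow>\<^sub>E walks n k" "Y \<in> {..<m} \<rightarrow>\<^sub>E walks n k"
        using that P(1) by (auto simp: configurations_def)
      show "Z r = Y r" if r: "r \<in> {..<m}" for r
      proof (rule walks_eqI[OF _ _ _ k(2)])
        show "Z r \<in> walks n k" "Y r \<in> walks n k"
          using r \<open>Z \<in> P\<close> \<open>Y \<in> P\<close> by (simp_all add: walk)
        show "Z r c = Y r c" if "c < k" for c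
          using bspec[OF eq, of "(r, c)"] r that by simp
      qed
    qed
    show "Z (fst i) (snd i) = Y (fst i) (snd i)"
      if ZY: "Z \<in> P" "Y \<in> P" and i: "i \<in> ?I" "i \<notin> F"
        and IH: "\<forall>j\<in>?I. ?rank j < ?rank i \<longrightarrow> Z (fst j) (snd j) = Y (fst j) (snd j)"
        and side: "(let a = (if snd i = 0 then k - 1 else snd i - 1) in
            side n (ks ! a) (Z (fst i) a) (Z (fst i) (snd i))) =
          (let a = (if snd i = 0 then k - 1 else snd i - 1) in
            side n (ks ! a) (Y (fst i) a) (Y (fst i) (snd i)))" for Z Y i
    proof -
      obtain r c where rc: "i = (r, c)" "r < m" "c < k" using i by auto
      define a where "a = (if c = 0 then k - 1 else c - 1)"
      have a: "a < k" "?next a = c" using rc(3) k(2) by (auto simp: a_def)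
      have acl: "a \<noteq> cl r"
        using i(2) rc a unfolding F_def by auto
      have "(r, a) \<notin> first_edges m k pos cl lam0"
      proof
        assume "(r, a) \<in> first_edges m k pos cl lam0"
        then have "(r, a) \<in> ?N" using acl by simp
        then have "(r, ?next a) \<in> F" unfolding F_def by force
        then show False using i(2) rc a by simp
      qed
      then obtain r' a' where e': "r' < m" "a' < k" "?rank (r', a') < ?rank (r, a)" "lam0 (r', a') = lam0 (r, a)"
        using rc a by (auto simp: first_edges_def)
      have ri: "?rank (r, c) = Suc (?rank (r, a))"
        using acl rc a cl[OF rc(2)] by (auto simp: edge_rank_def split: if_splits)
      have eq: "Z s d = Y s d" if "s < m" "d < k" "?rank (s, d) \<le> ?rank (r, a)" for s d
        using IH that ri rc by auto
      \<comment> \<open>The end of the earlier edge is known as well: it is the next vertex in the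
        order or, if the edge closes its walk, the start of that walk.\<close>
      have "?rank (r', ?next a') \<le> ?rank (r, a)"
      proof (cases "a' = cl r'")
        case True
        then have "?rank (r', ?next a') = pos r' * k"
          using cl[OF e'(1)] by (auto simp: edge_rank_def)
        also have "\<dots> \<le> ?rank (r', a')" by (simp add: edge_rank_def)
        finally show ?thesis using e'(3) by simp
      next
        case False
        then have "?rank (r', ?next a') = Suc (?rank (r', a'))"
          using e'(2) cl[OF e'(1)] by (auto simp: edge_rank_def)
        then show ?thesis using e'(3) by simp
      qed
      then have E: "Z r' a' = Y r' a'" "Z r' (?next a') = Y r' (?next a')"
        using e' by (intro eq; auto)+
      have ra: "Z r a = Y r a" using rc a by (intro eq) auto
      have lab: "lab n (ks ! a') (W r' a') (W r' (?next a')) = lab n (ks ! a) (W r a) (W r c)"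
        if "W \<in> P" for W
      proof -
        have "edge_labels n ks W (r', a') = edge_labels n ks W (r, a)"
          using P(2)[OF that, of "(r', a')" "(r, a)"] e' rc a by simp
        moreover have "W r (Suc a) = W r c" using nxt[OF that rc(2) a(1)] unfolding a(2) .
        moreover have "W r' (Suc a') = W r' (?next a')" by (rule nxt[OF that e'(1,2)])
        ultimately show ?thesis
          by (simp only: edge_labels_def edge_label_def fst_conv snd_conv)
      qed
      have "lab n (ks ! a) (Z r a) (Z r c) = lab n (ks ! a) (Z r a) (Y r c)"
        using lab[OF ZY(1)] lab[OF ZY(2)] E ra by metis
      moreover have "side n (ks ! a) (Z r a) (Z r c) = side n (ks ! a) (Z r a) (Y r c)"
        using side rc ra by (simp add: Let_def a_def split: if_splits)
      moreover have "ks ! a \<in> K" using a(1) k(1) ks by auto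
      ultimately have "Z r c = Y r c"
        using walks_less[OF walk[OF ZY(1) rc(2)]] walks_less[OF walk[OF ZY(2) rc(2)]] a rc
        by (intro lab_side) auto
      then show ?thesis by (simp add: rc)
    qed
  qed (use FI in auto)
  also have "\<dots> \<le> n ^ (m + card ?N) * 2 ^ (m * k)"
    using cardF n by (simp add: card_cartesian_product power_increasing)
  finally show ?thesis .
qed

text \<open>The first factor is the number of relations on the \<open>m * k\<close> edges. The
  coincidence pattern of the labels is one of them, so it remains to bound each pattern
  separately.\<close>

lemma card_le_kernels:
  assumes k: "k = length ks" and P: "P \<subseteq> configurations n k m"
    and "\<And>Z0. Z0 \<in> P \<Longrightarrow> card {Z \<in> P. \<forall>e\<in>{..<m} \<times> {..<k}. \<forall>e'\<in>{..<m} \<times> {..<k}.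
      edge_labels n ks Z e = edge_labels n ks Z e' \<longleftrightarrow>
      edge_labels n ks Z0 e = edge_labels n ks Z0 e'} \<le> B"
  shows "card P \<le> 2 ^ (m * k * (m * k)) * B"
proof -
  let ?E = "{..<m} \<times> {..<k}"
  let ?ker = "\<lambda>Z. {(e, e') \<in> ?E \<times> ?E. edge_labels n ks Z e = edge_labels n ks Z e'}"
  have "card P \<le> card (Pow (?E \<times> ?E)) * B"
  proof (rule card_le_fibres[where h = ?ker])
    show "finite P" using P finite_subset finite_configurations by blast
    fix Z0 assume "Z0 \<in> P"
    have "{Z \<in> P. ?ker Z = ?ker Z0} = {Z \<in> P. \<forall>e\<in>?E. \<forall>e'\<in>?E.
      edge_labels n ks Z e = edge_labels n ks Z e' \<longleftrightarrow>
      edge_labels n ks Z0 e = edge_labels n ks Z0 e'}"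
    proof (intro Collect_cong conj_cong refl)
      fix Z
      have "?ker Z = ?ker Z0 \<longleftrightarrow> (\<forall>d. d \<in> ?ker Z \<longleftrightarrow> d \<in> ?ker Z0)"
        by (rule set_eq_iff)
      also have "\<dots> \<longleftrightarrow> (\<forall>e\<in>?E. \<forall>e'\<in>?E. edge_labels n ks Z e = edge_labels n ks Z e' \<longleftrightarrow>
          edge_labels n ks Z0 e = edge_labels n ks Z0 e')"
        by (simp add: split_paired_all) blast
      finally show "?ker Z = ?ker Z0 \<longleftrightarrow> (\<forall>e\<in>?E. \<forall>e'\<in>?E. edge_labels n ks Z e = edge_labels n ks Z e' \<longleftrightarrow>
          edge_labels n ks Z0 e = edge_labels n ks Z0 e')" .
    qed
    then show "card {Z \<in> P. ?ker Z = ?ker Z0} \<le> B" using assms(3)[OF \<open>Z0 \<in> P\<close>] by simp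
  qed auto
  then show ?thesis by (simp add: card_Pow card_cartesian_product)
qed

section \<open>Walks with a label of multiplicity at least three\<close>

definition triple_walks :: "nat \<Rightarrow> 'k list \<Rightarrow> (nat \<Rightarrow> nat) set" where
  "triple_walks n ks = {\<pi> \<in> walks n (length ks).
     (\<forall>a<length ks. 2 \<le> card {b. b < length ks \<and> edge_label n ks \<pi> b = edge_label n ks \<pi> a}) \<and>
     (\<exists>a<length ks. 3 \<le> card {b. b < length ks \<and> edge_label n ks \<pi> b = edge_label n ks \<pi> a})}"

text \<open>With one multiplicity at least three and all others at least two, a walk of length
  \<open>k\<close> has at most \<open>(k - 1) div 2\<close> distinct labels. This is at least half a
  power of \<open>n\<close> below the normalisation \<open>n ^ (1 + k / 2)\<close>.\<close>

lemma card_triple_walks: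
  assumes ks: "set ks \<subseteq> K" "ks \<noteq> []" and n: "n > 0"
  shows "card (triple_walks n ks) \<le> 2 ^ (length ks * length ks + length ks) * n ^ (1 + (length ks - 1) div 2)"
proof -
  define k where "k = length ks"
  let ?E = "{..<1 :: nat} \<times> {..<k}" and ?c = "\<lambda>\<pi>. \<lambda>r\<in>{..<1::nat}. \<pi>"
  let ?P = "?c ` triple_walks n ks"
  have inj: "inj_on ?c (triple_walks n ks)"
  proof (rule inj_onI)
    fix \<pi> \<rho> assume "?c \<pi> = ?c \<rho>"
    from fun_cong[OF this, of 0] show "\<pi> = \<rho>" by simp
  qed
  have P: "?P \<subseteq> configurations n k 1"
    by (auto simp: triple_walks_def configurations_def k_def)
  have "card ?P \<le> 2 ^ (1 * k * (1 * k)) * (n ^ (1 + (k - 1) div 2) * 2 ^ (1 * k))"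
  proof (rule card_le_kernels[OF k_def P])
    fix Z0 assume "Z0 \<in> ?P"
    then obtain \<pi> where pi: "\<pi> \<in> triple_walks n ks" "Z0 = ?c \<pi>" by auto
    let ?lam = "edge_labels n ks Z0"
    have lam: "?lam e = edge_label n ks \<pi> (snd e)" if "e \<in> ?E" for e
      using that by (auto simp: edge_labels_def pi(2))
    have mult: "card {e \<in> ?E. ?lam e = ?lam (0, a)} = card {b. b < k \<and> edge_label n ks \<pi> b = edge_label n ks \<pi> a}"
      if "a < k" for a
    proof -
      have "{e \<in> ?E. ?lam e = ?lam (0, a)} = Pair 0 ` {b. b < k \<and> edge_label n ks \<pi> b = edge_label n ks \<pi> a}"
        using that lam by (auto simp: image_iff)
      then show ?thesis by (simp add: card_image inj_on_def)
    qed
    obtain a where a: "a < k" "3 \<le> card {e \<in> ?E. ?lam e = ?lam (0, a)}"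
      using pi(1) mult by (auto simp: triple_walks_def k_def)
    have "2 * card (?lam ` ?E) + (\<Sum>t\<in>{?lam (0, a)}. card {e \<in> ?E. ?lam e = t}) \<le> card ?E + 2 * card {?lam (0, a)}"
    proof (rule card_multiplicity_le)
      fix t assume "t \<in> ?lam ` ?E"
      then obtain b where "b < k" "t = ?lam (0, b)" by auto
      then show "2 \<le> card {e \<in> ?E. ?lam e = t}"
        using pi(1) mult[of b] by (auto simp: triple_walks_def k_def)
    qed (use a in auto)
    then have D: "card (?lam ` ?E) \<le> (k - 1) div 2"
      using a by (simp add: card_cartesian_product)
    let ?pos = "\<lambda>r :: nat. r" and ?cl = "\<lambda>r :: nat. 0 :: nat"
    have fin: "finite (first_edges 1 k ?pos ?cl ?lam)"
      by (rule finite_subset[of _ ?E]) (auto simp: first_edges_def)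
    have k0: "k > 0" using ks by (simp add: k_def)
    have "card {Z \<in> ?P. \<forall>e\<in>?E. \<forall>e'\<in>?E. edge_labels n ks Z e = edge_labels n ks Z e' \<longleftrightarrow>
        ?lam e = ?lam e'} \<le> n ^ (1 + card {e \<in> first_edges 1 k ?pos ?cl ?lam. snd e \<noteq> ?cl (fst e)}) * 2 ^ (1 * k)"
      using P k0 ks n by (intro card_configurations_le[OF k_def]) auto
    also have "\<dots> \<le> n ^ (1 + (k - 1) div 2) * 2 ^ (1 * k)"
    proof -
      have "card {e \<in> first_edges 1 k ?pos ?cl ?lam. snd e \<noteq> ?cl (fst e)} \<le> card (first_edges 1 k ?pos ?cl ?lam)"
        by (intro card_mono fin) auto
      also have "\<dots> \<le> card (?lam ` ?E)"
        using k0 by (intro card_first_edges) auto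
      finally show ?thesis using D n by (intro mult_right_mono power_increasing) auto
    qed
    finally show "card {Z \<in> ?P. \<forall>e\<in>?E. \<forall>e'\<in>?E. edge_labels n ks Z e = edge_labels n ks Z e' \<longleftrightarrow>
        ?lam e = ?lam e'} \<le> n ^ (1 + (k - 1) div 2) * 2 ^ (1 * k)" .
  qed
  then show ?thesis
    unfolding card_image[OF inj] by (simp add: k_def power_add algebra_simps)
qed

end

context patterned_inputs
begin

section \<open>Quadruples of linked walks\<close>

text \<open>The two conditions exclude the two alternatives of
  \<open>expectation_centred_prod_eq_0\<close> for each of the four rows, so only these quadruples
  can contribute to the fourth central moment.\<close>

definition linked_configurations :: "nat \<Rightarrow> 'k list \<Rightarrow> (nat \<Rightarrow> nat \<Rightarrow> nat) set" where
  "linked_configurations n ks = {Z \<in> configurations n (length ks) 4.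
     (\<forall>e\<in>{..<4} \<times> {..<length ks}. \<exists>e'\<in>{..<4} \<times> {..<length ks}.
        e' \<noteq> e \<and> edge_labels n ks Z e' = edge_labels n ks Z e) \<and>
     (\<forall>r<4. \<exists>a<length ks. \<exists>e'\<in>{..<4} \<times> {..<length ks}.
        fst e' \<noteq> r \<and> edge_labels n ks Z e' = edge_labels n ks Z (r, a))}"

text \<open>Only labels occurring exactly twice would allow \<open>2 * k\<close> distinct labels, and then two of the
  four walks can be closed by an edge whose label has not been seen before and hence is determined
  by the rest of the walk.\<close>

lemma linked_order:
  fixes lam :: "nat \<times> nat \<Rightarrow> 't" and k :: nat
  defines "E \<equiv> {..<4} \<times> {..<k}"
  assumes twice: "\<And>e. e \<in> E \<Longrightarrow> \<exists>e'\<in>E. e' \<noteq> e \<and> lam e' = lam e"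
    and linked: "\<And>r. r < 4 \<Longrightarrow> \<exists>a<k. \<exists>e'\<in>E. fst e' \<noteq> r \<and> lam e' = lam (r, a)"
  shows "\<exists>pos cl. inj_on pos {..<4} \<and> (\<forall>r<4. cl r < k) \<and>
    4 + card {e \<in> first_edges 4 k pos cl lam. snd e \<noteq> cl (fst e)} \<le> 2 * k + 2"
proof -
  let ?mult = "\<lambda>t. card {e \<in> E. lam e = t}"
  define D where "D = card (lam ` E)"
  have finE: "finite E" and cardE: "card E = 4 * k"
    by (simp_all add: E_def card_cartesian_product)
  have k: "k > 0" using linked[of 0] by auto
  have mult2: "2 \<le> ?mult t" if t: "t \<in> lam ` E" for t
  proof -
    obtain e where e: "e \<in> E" "t = lam e" using t by auto
    obtain e' where "e' \<in> E" "e' \<noteq> e" "lam e' = lam e" using twice[OF e(1)] by auto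
    then have "{e, e'} \<subseteq> {d \<in> E. lam d = t}" using e by auto
    then have "card {e, e'} \<le> ?mult t" using finE by (intro card_mono) auto
    then show ?thesis using \<open>e' \<noteq> e\<close> by simp
  qed
  have count: "2 * D + (\<Sum>t\<in>S. ?mult t) \<le> 4 * k + 2 * card S" if "S \<subseteq> lam ` E" for S
    using card_multiplicity_le[OF finE mult2 that] by (simp add: D_def cardE)
  have fin: "finite (first_edges 4 k pos cl lam)" for pos cl
    by (rule finite_subset[OF _ finE]) (auto simp: first_edges_def E_def)
  have saved: "card {e \<in> first_edges 4 k pos cl lam. snd e \<noteq> cl (fst e)} + card S \<le> D"
    if "inj_on pos {..<4}" "\<And>r. r < 4 \<Longrightarrow> cl r < k"
      "S \<subseteq> first_edges 4 k pos cl lam" "\<And>e. e \<in> S \<Longrightarrow> snd e = cl (fst e)" for pos cl S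
  proof -
    have "card {e \<in> first_edges 4 k pos cl lam. snd e \<noteq> cl (fst e)} + card S =
        card ({e \<in> first_edges 4 k pos cl lam. snd e \<noteq> cl (fst e)} \<union> S)"
      using that fin finite_subset[OF that(3) fin] by (subst card_Un_disjoint) auto
    also have "\<dots> \<le> card (first_edges 4 k pos cl lam)"
      using that fin by (intro card_mono) auto
    also have "\<dots> \<le> D"
      unfolding D_def E_def by (intro card_first_edges that(1,2))
    finally show ?thesis .
  qed
  \<comment> \<open>Multiplicities of at least two among \<open>4 * k\<close> edges give
    \<open>D \<le> 2 * k\<close>. The three cases have to save zero, one and two closing edges,
    respectively.\<close>
  consider (few) "D + 2 \<le> 2 * k" | (odd) "D + 1 = 2 * k" | (pairs) "D = 2 * k"
    using count[of "{}"] by (simp; linarith)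
  then show ?thesis
  proof cases
    case few
    have "card {e \<in> first_edges 4 k (\<lambda>r. r) (\<lambda>_. 0) lam. snd e \<noteq> (\<lambda>_. 0) (fst e)} + card ({} :: (nat \<times> nat) set) \<le> D"
      using k by (intro saved) auto
    then show ?thesis
      using few k by (intro exI[of _ "\<lambda>r. r"] exI[of _ "\<lambda>_. 0"]) auto
  next
    case odd
    \<comment> \<open>The total excess of the multiplicities over two is
      \<open>4 * k - 2 * D = 2\<close>. If no row had a label that occurs in it only once, a label
      shared by two rows would have multiplicity at least four and exhaust the excess. Then all rows
      would share one and the same label, whose multiplicity would be at least six.\<close>
    have "\<exists>r<4. \<exists>a<k. \<forall>b<k. lam (r, b) = lam (r, a) \<longrightarrow> b = a"
    proof (rule ccontr)
      assume "\<not> ?thesis"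
      then have dup: "\<exists>b<k. lam (r, b) = lam (r, a) \<and> b \<noteq> a" if "r < 4" "a < k" for r a
        using that by blast
      have row2: "2 \<le> card {b. b < k \<and> lam (r, b) = t}" if ra: "r < 4" "a < k" "lam (r, a) = t" for r a t
      proof -
        obtain b where "b < k" "lam (r, b) = lam (r, a)" "b \<noteq> a" using dup[OF ra(1,2)] by auto
        then have "{a, b} \<subseteq> {b. b < k \<and> lam (r, b) = t}" using ra by auto
        then have "card {a, b} \<le> card {b. b < k \<and> lam (r, b) = t}" by (intro card_mono) auto
        then show ?thesis using \<open>b \<noteq> a\<close> by simp
      qed
      have rows: "(\<Sum>r\<in>R. card {b. b < k \<and> lam (r, b) = t}) \<le> ?mult t" if "R \<subseteq> {..<4}" for R t
      proof -
        have "(\<Sum>r\<in>R. card {b. b < k \<and> lam (r, b) = t}) = card (SIGMA r:R. {b. b < k \<and> lam (r, b) = t})"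
          using that finite_subset by (subst card_SigmaI) auto
        also have "\<dots> \<le> ?mult t"
          using finE that by (intro card_mono) (auto simp: E_def)
        finally show ?thesis .
      qed
      have ex: "\<exists>t. t \<in> lam ` E \<and> 4 \<le> ?mult t \<and> (\<exists>a<k. lam (r, a) = t)" if r: "r < 4" for r
      proof -
        obtain a r' a' where a: "a < k" "r' < 4" "a' < k" "r' \<noteq> r" "lam (r', a') = lam (r, a)"
          using linked[OF r] by (auto simp: E_def)
        have "2 + 2 \<le> (\<Sum>s\<in>{r, r'}. card {b. b < k \<and> lam (s, b) = lam (r, a)})"
          using row2[OF r a(1) refl] row2[OF a(2,3,5)] a(4) by simp
        also have "\<dots> \<le> ?mult (lam (r, a))" using r a by (intro rows) auto
        finally show ?thesis using r a by (auto simp: E_def)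
      qed
      define t where "t r = (SOME t. t \<in> lam ` E \<and> 4 \<le> ?mult t \<and> (\<exists>a<k. lam (r, a) = t))" for r
      have t: "t r \<in> lam ` E \<and> 4 \<le> ?mult (t r) \<and> (\<exists>a<k. lam (r, a) = t r)" if "r < 4" for r
        unfolding t_def by (rule someI_ex[OF ex[OF that]])
      have eq: "t r = t s" if "r < 4" "s < 4" for r s
      proof (rule ccontr)
        assume "t r \<noteq> t s"
        then show False
          using count[of "{t r, t s}"] t[OF that(1)] t[OF that(2)] odd by simp
      qed
      have "2 + 2 + 2 \<le> (\<Sum>r\<in>{0, 1, 2}. card {b. b < k \<and> lam (r, b) = t 0})"
      proof -
        have "2 \<le> card {b. b < k \<and> lam (r, b) = t 0}" if "r < 4" for r
          using t[OF that] eq[OF that, of 0] row2[OF that] by auto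
        from this[of 0] this[of 1] this[of 2] show ?thesis by simp
      qed
      also have "\<dots> \<le> ?mult (t 0)" by (intro rows) auto
      finally show False using count[of "{t 0}"] t[of 0] odd by simp
    qed
    then obtain r a where r: "r < 4" "a < k" "\<And>b. b < k \<Longrightarrow> lam (r, b) = lam (r, a) \<Longrightarrow> b = a"
      by blast
    \<comment> \<open>Walk \<open>r\<close> is put first, so that the label of its closing edge
      \<open>a\<close> is new: it occurs once in this walk, and all other walks come later.\<close>
    define pos where "pos = (\<lambda>c. if c = r then 0 else Suc c)"
    have inj: "inj_on pos {..<4}" by (auto simp: inj_on_def pos_def split: if_splits)
    have "(r, a) \<in> first_edges 4 k pos (\<lambda>_. a) lam"
      unfolding first_edges_def
    proof (intro CollectI conjI ballI impI)
      show "(r, a) \<in> {..<4} \<times> {..<k}" using r by simp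
      fix e' assume e': "e' \<in> {..<4} \<times> {..<k}" "edge_rank k pos (\<lambda>_. a) e' < edge_rank k pos (\<lambda>_. a) (r, a)"
      then have "pos (fst e') \<le> pos r"
        using edge_rank_less_pos[of "(r, a)" k "\<lambda>_. a" e' pos] r by auto
      then have "fst e' = r" by (simp add: pos_def split: if_splits)
      moreover have "e' \<noteq> (r, a)" using e'(2) by auto
      ultimately show "lam e' \<noteq> lam (r, a)" using r(3)[of "snd e'"] e'(1) by (cases e') auto
    qed
    then have "card {e \<in> first_edges 4 k pos (\<lambda>_. a) lam. snd e \<noteq> (\<lambda>_. a) (fst e)} + card {(r, a)} \<le> D"
      using r by (intro saved inj) auto
    then show ?thesis
      using odd inj r by (intro exI[of _ pos] exI[of _ "\<lambda>_. a"]) auto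
  next
    case pairs
    have mult: "?mult t = 2" if "t \<in> lam ` E" for t
      using count[of "{t}"] mult2[OF that] that pairs by simp
    have unique: "e' = d" if "e \<in> E" "e' \<in> E" "d \<in> E" "lam e' = lam e" "lam d = lam e" "e' \<noteq> e" "d \<noteq> e"
      for e e' d
    proof (rule ccontr)
      assume "e' \<noteq> d"
      then have "card {e, e', d} = 3" using that by simp
      moreover have "card {e, e', d} \<le> ?mult (lam e)"
        using that finE by (intro card_mono) auto
      ultimately show False using mult[of "lam e"] that by simp
    qed
    obtain a0 e0 where e0: "a0 < k" "e0 \<in> E" "fst e0 \<noteq> 0" "lam e0 = lam (0, a0)"
      using linked[of 0] by auto
    \<comment> \<open>The walks to be closed without cost are \<open>0\<close> and \<open>b\<close>,
      where \<open>b\<close> avoids the walk that contains the partner \<open>e0\<close> of the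
      closing edge of walk \<open>0\<close>. With \<open>b\<close> first and \<open>0\<close>
      second, the partners of both closing edges come later.\<close>
    define b where "b = (if fst e0 = 1 then 2 else 1 :: nat)"
    have b: "b < 4" "b \<noteq> 0" "b \<noteq> fst e0" by (auto simp: b_def)
    obtain ab eb where eb: "ab < k" "eb \<in> E" "fst eb \<noteq> b" "lam eb = lam (b, ab)"
      using linked[OF b(1)] by auto
    define pos where "pos = (\<lambda>c. if c = b then 0 else if c = 0 then 1 else Suc (Suc c))"
    define cl where "cl = (\<lambda>c :: nat. if c = 0 then a0 else ab)"
    have inj: "inj_on pos {..<4}" by (auto simp: inj_on_def pos_def split: if_splits)
    have cl: "cl r < k" for r using e0(1) eb(1) by (simp add: cl_def)
    have posle: "pos (fst e') \<le> pos (fst e)" if "e \<in> E" "e' \<in> E" "edge_rank k pos cl e' < edge_rank k pos cl e" for e e'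
      using edge_rank_less_pos[of e k cl e' pos] that cl by (auto simp: E_def)
    have "(0, a0) \<in> first_edges 4 k pos cl lam"
      unfolding first_edges_def E_def[symmetric]
    proof (intro CollectI conjI ballI impI notI)
      show E0: "(0, a0) \<in> E" using e0 by (simp add: E_def)
      fix e' assume e': "e' \<in> E" "edge_rank k pos cl e' < edge_rank k pos cl (0, a0)" "lam e' = lam (0, a0)"
      have "e' \<noteq> (0, a0)" "e0 \<noteq> (0, a0)" using e'(2) e0(3) by auto
      then have "e' = e0" using e' e0 E0 unique[of "(0, a0)" e' e0] by simp
      then show False
        using posle[OF E0 e'(1,2)] b e0(3) by (simp add: pos_def split: if_splits)
    qed
    moreover have "(b, ab) \<in> first_edges 4 k pos cl lam"
      unfolding first_edges_def E_def[symmetric]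
    proof (intro CollectI conjI ballI impI notI)
      show E0: "(b, ab) \<in> E" using eb b by (simp add: E_def)
      fix e' assume e': "e' \<in> E" "edge_rank k pos cl e' < edge_rank k pos cl (b, ab)" "lam e' = lam (b, ab)"
      have "e' \<noteq> (b, ab)" "eb \<noteq> (b, ab)" using e'(2) eb(3) by auto
      then have "e' = eb" using e' eb E0 unique[of "(b, ab)" e' eb] by simp
      then show False
        using posle[OF E0 e'(1,2)] eb(3) by (simp add: pos_def split: if_splits)
    qed
    ultimately have "card {e \<in> first_edges 4 k pos cl lam. snd e \<noteq> cl (fst e)} + card {(0, a0), (b, ab)} \<le> D"
      using b cl by (intro saved inj) (auto simp: cl_def)
    moreover have "card {(0, a0), (b, ab)} = 2" using b by simp
    ultimately show ?thesis
      using pairs inj cl by (intro exI[of _ pos] exI[of _ cl]) auto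
  qed
qed

text \<open>With \<open>k\<close> the length of the word, four normalised traces are divided by
  \<open>n ^ (2 * k + 4)\<close>; two powers of \<open>n\<close> are gained.\<close>

lemma card_linked_configurations:
  assumes ks: "set ks \<subseteq> K" "ks \<noteq> []" and n: "n > 0"
  shows "card (linked_configurations n ks) \<le>
    2 ^ (4 * length ks * (4 * length ks) + 4 * length ks) * n ^ (2 * length ks + 2)"
proof -
  define k where "k = length ks"
  let ?E = "{..<4} \<times> {..<k}" and ?P = "linked_configurations n ks"
  have k0: "k > 0" using ks by (simp add: k_def)
  have P: "?P \<subseteq> configurations n k 4"
    by (auto simp: linked_configurations_def k_def)
  have "card ?P \<le> 2 ^ (4 * k * (4 * k)) * (n ^ (2 * k + 2) * 2 ^ (4 * k))"
  proof (rule card_le_kernels[OF k_def P])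
    fix Z0 assume Z0: "Z0 \<in> ?P"
    let ?lam = "edge_labels n ks Z0"
    let ?Q = "{Z \<in> ?P. \<forall>e\<in>?E. \<forall>e'\<in>?E. edge_labels n ks Z e = edge_labels n ks Z e' \<longleftrightarrow> ?lam e = ?lam e'}"
    have "\<exists>pos cl. inj_on pos {..<4} \<and> (\<forall>r<4. cl r < k) \<and>
        4 + card {e \<in> first_edges 4 k pos cl ?lam. snd e \<noteq> cl (fst e)} \<le> 2 * k + 2"
      using Z0 by (intro linked_order) (auto simp: linked_configurations_def k_def)
    then obtain pos cl where pc: "inj_on pos {..<4}" "\<And>r. r < 4 \<Longrightarrow> cl r < k"
        "4 + card {e \<in> first_edges 4 k pos cl ?lam. snd e \<noteq> cl (fst e)} \<le> 2 * k + 2"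
      by blast
    have Q: "?Q \<subseteq> configurations n k 4" using P by blast
    have "card ?Q \<le> n ^ (4 + card {e \<in> first_edges 4 k pos cl ?lam. snd e \<noteq> cl (fst e)}) * 2 ^ (4 * k)"
      by (rule card_configurations_le[OF k_def k0 ks(1) _ n pc(2) Q]) auto
    also have "\<dots> \<le> n ^ (2 * k + 2) * 2 ^ (4 * k)"
      using pc(3) n by (intro mult_right_mono power_increasing) auto
    finally show "card ?Q \<le> n ^ (2 * k + 2) * 2 ^ (4 * k)" .
  qed
  then show ?thesis by (simp add: k_def power_add algebra_simps)
qed

end

section \<open>Traces of monomials as sums over closed walks\<close>

definition paths :: "nat \<Rightarrow> nat \<Rightarrow> nat \<Rightarrow> nat \<Rightarrow> (nat \<Rightarrow> nat) set" where
  "paths n k i j = {\<pi> \<in> {..k} \<rightarrow>\<^sub>E {..<n}. \<pi> 0 = i \<and> \<pi> k = j}"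

lemma finite_paths [simp]: "finite (paths n k i j)"
  unfolding paths_def by (rule finite_subset[of _ "{..k} \<rightarrow>\<^sub>E {..<n}"]) (auto intro: finite_PiE)

lemma paths_disjoint: "i \<noteq> i' \<or> j \<noteq> j' \<Longrightarrow> paths n k i j \<inter> paths n k i' j' = {}"
  by (auto simp: paths_def)

lemma sum_paths_Suc:
  assumes "j < n"
  shows "(\<Sum>\<pi>\<in>paths n (Suc k) i j. f \<pi>) = (\<Sum>l<n. \<Sum>\<pi>\<in>paths n k i l. f (\<pi>(Suc k := j)))"
proof -
  have "(\<Sum>l<n. \<Sum>\<pi>\<in>paths n k i l. f (\<pi>(Suc k := j))) = (\<Sum>\<pi>\<in>(\<Union>l<n. paths n k i l). f (\<pi>(Suc k := j)))"
    by (rule sum.UNION_disjoint[symmetric]) (auto simp: paths_disjoint)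
  also have "(\<Union>l<n. paths n k i l) = {\<pi> \<in> {..k} \<rightarrow>\<^sub>E {..<n}. \<pi> 0 = i}"
    by (auto simp: paths_def PiE_iff)
  also have "(\<Sum>\<pi>\<in>{\<pi> \<in> {..k} \<rightarrow>\<^sub>E {..<n}. \<pi> 0 = i}. f (\<pi>(Suc k := j))) = (\<Sum>\<pi>\<in>paths n (Suc k) i j. f \<pi>)"
  proof (rule sum.reindex_bij_witness[of _ "\<lambda>\<pi>. restrict \<pi> {..k}" "\<lambda>\<pi>. \<pi>(Suc k := j)"])
    fix \<pi> assume pi: "\<pi> \<in> {\<pi> \<in> {..k} \<rightarrow>\<^sub>E {..<n}. \<pi> 0 = i}"
    then have undef: "\<pi> c = undefined" if "c > k" for c using that by (auto simp: PiE_iff extensional_def)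
    show "restrict (\<pi>(Suc k := j)) {..k} = \<pi>"
      using undef by (auto simp: fun_eq_iff restrict_def)
    show "\<pi>(Suc k := j) \<in> paths n (Suc k) i j"
      using pi assms by (auto simp: paths_def PiE_iff extensional_def)
  next
    fix \<pi> assume pi: "\<pi> \<in> paths n (Suc k) i j"
    then have undef: "\<pi> c = undefined" if "c > Suc k" for c
      using that by (auto simp: paths_def PiE_iff extensional_def)
    show "(restrict \<pi> {..k})(Suc k := j) = \<pi>"
    proof
      fix c show "((restrict \<pi> {..k})(Suc k := j)) c = \<pi> c"
        using undef[of c] pi by (cases c "Suc k" rule: linorder_cases) (auto simp: paths_def)
    qed
    show "restrict \<pi> {..k} \<in> {\<pi> \<in> {..k} \<rightarrow>\<^sub>E {..<n}. \<pi> 0 = i}"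
      using pi by (auto simp: paths_def PiE_iff)
  qed simp
  finally show ?thesis by (rule sym)
qed

lemma mat_monomial_carrier:
  "(\<And>k. B k \<in> carrier_mat n n) \<Longrightarrow> mat_monomial n B ks \<in> carrier_mat n n"
  by (induction ks) (auto simp: mat_monomial_def intro: mult_carrier_mat)

lemma mat_monomial_append:
  assumes "\<And>k. B k \<in> carrier_mat n n"
  shows "mat_monomial n B (us @ vs) = mat_monomial n B us * mat_monomial n B vs"
proof (induction us)
  case Nil
  then show ?case
    using mat_monomial_carrier[of B n vs] assms by (simp add: mat_monomial_def)
next
  case (Cons u us)
  have "mat_monomial n B ((u # us) @ vs) = B u * mat_monomial n B (us @ vs)"
    by (simp add: mat_monomial_def)
  also have "\<dots> = B u * mat_monomial n B us * mat_monomial n B vs"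
    using assms mat_monomial_carrier[of B n] by (simp add: Cons assoc_mult_mat[of _ n n _ n _ n])
  finally show ?case by (simp add: mat_monomial_def)
qed

lemma mat_monomial_entry:
  assumes B: "\<And>k. B k \<in> carrier_mat n n" and ij: "i < n" "j < n"
  shows "mat_monomial n B ks $$ (i, j) =
    (\<Sum>\<pi>\<in>paths n (length ks) i j. \<Prod>a<length ks. B (ks ! a) $$ (\<pi> a, \<pi> (Suc a)))"
  using ij
proof (induction ks arbitrary: j rule: rev_induct)
  case Nil
  have "paths n 0 i j = (if i = j then {\<lambda>a\<in>{..0}. i} else {})"
    using Nil by (auto simp: paths_def PiE_iff extensional_def fun_eq_iff)
  then show ?case using Nil by (simp add: mat_monomial_def)
next
  case (snoc u ks)
  let ?k = "length ks"
  have "mat_monomial n B (ks @ [u]) $$ (i, j) = (mat_monomial n B ks * B u) $$ (i, j)"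
  proof -
    have "mat_monomial n B [u] = B u" by (simp add: mat_monomial_def right_mult_one_mat[OF B])
    then show ?thesis by (simp only: mat_monomial_append[OF B])
  qed
  also have "\<dots> = (\<Sum>l<n. mat_monomial n B ks $$ (i, l) * B u $$ (l, j))"
  proof -
    have "dim_row (mat_monomial n B ks) = n" "dim_col (mat_monomial n B ks) = n"
        "dim_row (B u) = n" "dim_col (B u) = n"
      using B[of u] mat_monomial_carrier[of B n ks, OF B] by auto
    then show ?thesis
      using snoc.prems by (simp add: scalar_prod_def lessThan_atLeast0)
  qed
  also have "\<dots> = (\<Sum>l<n. \<Sum>\<pi>\<in>paths n ?k i l.
      (\<Prod>a<?k. B (ks ! a) $$ (\<pi> a, \<pi> (Suc a))) * B u $$ (\<pi> ?k, j))"
    using snoc by (intro sum.cong refl) (simp add: sum_distrib_right paths_def)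
  also have "\<dots> = (\<Sum>l<n. \<Sum>\<pi>\<in>paths n ?k i l. \<Prod>a<Suc ?k. B ((ks @ [u]) ! a) $$
      ((\<pi>(Suc ?k := j)) a, (\<pi>(Suc ?k := j)) (Suc a)))"
    by (intro sum.cong refl) (simp add: nth_append)
  also have "\<dots> = (\<Sum>\<pi>\<in>paths n (Suc ?k) i j. \<Prod>a<Suc ?k. B ((ks @ [u]) ! a) $$ (\<pi> a, \<pi> (Suc a)))"
    using snoc.prems by (simp only: sum_paths_Suc)
  finally show ?case by simp
qed

lemma mat_trace_monomial:
  assumes B: "\<And>k. B k \<in> carrier_mat n n"
  shows "mat_trace (mat_monomial n B ks) =
    (\<Sum>\<pi>\<in>walks n (length ks). \<Prod>a<length ks. B (ks ! a) $$ (\<pi> a, \<pi> (Suc a)))"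
proof -
  have "mat_trace (mat_monomial n B ks) = (\<Sum>i<n. \<Sum>\<pi>\<in>paths n (length ks) i i.
      \<Prod>a<length ks. B (ks ! a) $$ (\<pi> a, \<pi> (Suc a)))"
    using mat_monomial_carrier[of B n ks, OF B]
    unfolding mat_trace_def by (intro sum.cong) (auto simp: mat_monomial_entry[OF B])
  also have "\<dots> = (\<Sum>\<pi>\<in>(\<Union>i<n. paths n (length ks) i i).
      \<Prod>a<length ks. B (ks ! a) $$ (\<pi> a, \<pi> (Suc a)))"
    by (rule sum.UNION_disjoint[symmetric]) (auto simp: paths_disjoint)
  also have "(\<Union>i<n. paths n (length ks) i i) = walks n (length ks)"
    by (auto simp: paths_def walks_def PiE_iff)
  finally show ?thesis .
qed

lemma mat_trace_commute:
  fixes A B :: "'a :: comm_semiring_0 mat"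
  assumes "A \<in> carrier_mat n n" "B \<in> carrier_mat n n"
  shows "mat_trace (A * B) = mat_trace (B * A)"
proof -
  have dims: "dim_row A = n" "dim_col A = n" "dim_row B = n" "dim_col B = n"
    using assms by auto
  have "mat_trace (A * B) = (\<Sum>i<n. \<Sum>l<n. A $$ (i, l) * B $$ (l, i))"
    by (simp add: mat_trace_def scalar_prod_def lessThan_atLeast0 dims)
  also have "\<dots> = (\<Sum>l<n. \<Sum>i<n. B $$ (l, i) * A $$ (i, l))"
    by (subst sum.swap) (simp add: mult.commute)
  also have "\<dots> = mat_trace (B * A)"
    by (simp add: mat_trace_def scalar_prod_def lessThan_atLeast0 dims)
  finally show ?thesis .
qed

section \<open>Concentration of traces\<close>

context patterned_inputs
begin

definition walk_prod :: "nat \<Rightarrow> 'k list \<Rightarrow> (nat \<Rightarrow> nat) \<Rightarrow> 'a \<Rightarrow> real" where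
  "walk_prod n ks \<pi> \<omega> = (\<Prod>a<length ks. V (edge_label n ks \<pi> a) \<omega>)"

definition normed_trace :: "nat \<Rightarrow> 'k list \<Rightarrow> 'a \<Rightarrow> real" where
  "normed_trace n ks \<omega> =
     (\<Sum>\<pi>\<in>walks n (length ks). walk_prod n ks \<pi> \<omega>) / (real n * sqrt (real n) ^ length ks)"

definition label_matrix :: "nat \<Rightarrow> 'a \<Rightarrow> 'k \<Rightarrow> real mat" where
  "label_matrix n \<omega> \<kappa> = mat n n (\<lambda>(i, j). V (lab n \<kappa> i j) \<omega>)"

lemma sum_walk_prod:
  "(\<Sum>\<pi>\<in>walks n (length ks). walk_prod n ks \<pi> \<omega>) = mat_trace (mat_monomial n (label_matrix n \<omega>) ks)"
proof -
  have "label_matrix n \<omega> k \<in> carrier_mat n n" for k by (simp add: label_matrix_def)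
  then show ?thesis
    by (subst mat_trace_monomial)
      (auto simp: walk_prod_def edge_label_def label_matrix_def walks_less intro!: sum.cong prod.cong)
qed

lemma normed_trace_rotate: "normed_trace n (us @ vs) \<omega> = normed_trace n (vs @ us) \<omega>"
proof -
  have B: "label_matrix n \<omega> k \<in> carrier_mat n n" for k by (simp add: label_matrix_def)
  let ?m = "mat_monomial n (label_matrix n \<omega>)"
  have "mat_trace (?m us * ?m vs) = mat_trace (?m vs * ?m us)"
    by (rule mat_trace_commute[OF mat_monomial_carrier[OF B] mat_monomial_carrier[OF B]])
  then show ?thesis
    unfolding normed_trace_def sum_walk_prod mat_monomial_append[OF B] by (simp add: add.commute)
qed

lemma edge_label_image:
  "\<lbrakk>set ks \<subseteq> K; \<pi> \<in> walks n (length ks)\<rbrakk> \<Longrightarrow> edge_label n ks \<pi> ` {..<length ks} \<subseteq> Idx"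
  using edge_label_Idx by blast

lemma integrable_walk_prod:
  "\<lbrakk>set ks \<subseteq> K; \<pi> \<in> walks n (length ks)\<rbrakk> \<Longrightarrow> integrable M (walk_prod n ks \<pi>)"
  unfolding walk_prod_def by (intro integrable_prod edge_label_image) auto

lemma integrable_normed_trace: "set ks \<subseteq> K \<Longrightarrow> integrable M (normed_trace n ks)"
  unfolding normed_trace_def
  by (intro integrable_divide_zero Bochner_Integration.integrable_sum integrable_walk_prod)

lemma normed_trace_Nil: "n > 0 \<Longrightarrow> normed_trace n [] \<omega> = 1"
  unfolding normed_trace_def sum_walk_prod by (simp add: mat_monomial_def mat_trace_def)

lemma centred_normed_trace_power:
  assumes "set ks \<subseteq> K"
  shows "(normed_trace n ks \<omega> - expectation (normed_trace n ks)) ^ 4 =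
    (\<Sum>Z\<in>configurations n (length ks) 4. \<Prod>r<4.
       (\<Prod>a<length ks. V (edge_labels n ks Z (r, a)) \<omega>) -
       expectation (\<lambda>\<omega>. \<Prod>a<length ks. V (edge_labels n ks Z (r, a)) \<omega>)) /
    (real n * sqrt (real n) ^ length ks) ^ 4"
proof -
  let ?W = "walks n (length ks)" and ?c = "real n * sqrt (real n) ^ length ks"
  let ?X = "\<lambda>\<pi>. walk_prod n ks \<pi> \<omega> - expectation (walk_prod n ks \<pi>)"
  have E: "expectation (normed_trace n ks) = (\<Sum>\<pi>\<in>?W. expectation (walk_prod n ks \<pi>)) / ?c"
    unfolding normed_trace_def using assms by (simp add: integrable_walk_prod)
  have "normed_trace n ks \<omega> - expectation (normed_trace n ks) = (\<Sum>\<pi>\<in>?W. ?X \<pi>) / ?c"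
    unfolding E unfolding normed_trace_def by (simp add: sum_subtractf diff_divide_distrib)
  then have "(normed_trace n ks \<omega> - expectation (normed_trace n ks)) ^ 4 = (\<Prod>r<(4 :: nat). \<Sum>\<pi>\<in>?W. ?X \<pi>) / ?c ^ 4"
    by (simp add: power_divide)
  also have "(\<Prod>r<(4 :: nat). \<Sum>\<pi>\<in>?W. ?X \<pi>) = (\<Sum>Z\<in>configurations n (length ks) 4. \<Prod>r<4. ?X (Z r))"
    unfolding configurations_def by (rule prod_sum_PiE) auto
  finally show ?thesis
    by (simp add: edge_labels_def walk_prod_def[abs_def])
qed

lemma edge_labels_image:
  assumes "set ks \<subseteq> K" "Z \<in> configurations n (length ks) m"
  shows "edge_labels n ks Z ` ({..<m} \<times> {..<length ks}) \<subseteq> Idx"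
  using assms by (auto simp: edge_labels_def configurations_def intro!: edge_label_Idx)

text \<open>Quadruples that are not linked have expectation zero. For the linked ones a uniform
  bound on the expectation is multiplied by their number.\<close>

lemma
  assumes ks: "set ks \<subseteq> K"
  shows integrable_normed_trace_power:
      "integrable M (\<lambda>\<omega>. (normed_trace n ks \<omega> - expectation (normed_trace n ks)) ^ 4)"
    and fourth_moment_normed_trace:
      "\<exists>C\<ge>0. \<forall>n>0. expectation (\<lambda>\<omega>. (normed_trace n ks \<omega> - expectation (normed_trace n ks)) ^ 4) \<le> C / real n ^ 2"
proof -
  define k where "k = length ks"
  let ?X = "\<lambda>n Z \<omega>. \<Prod>r<4. (\<Prod>a<k. V (edge_labels n ks Z (r, a)) \<omega>) -
       expectation (\<lambda>\<omega>. \<Prod>a<k. V (edge_labels n ks Z (r, a)) \<omega>)"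
  have int: "integrable M (?X n Z)" if "Z \<in> configurations n k 4" for n Z
    using edge_labels_image[OF ks, of Z n 4] that by (intro integrable_centred_prod) (auto simp: k_def)
  note expand = centred_normed_trace_power[OF ks, folded k_def]
  show "integrable M (\<lambda>\<omega>. (normed_trace n ks \<omega> - expectation (normed_trace n ks)) ^ 4)"
    unfolding expand using int by (intro integrable_divide_zero Bochner_Integration.integrable_sum)
  obtain C where C: "\<And>lam :: nat \<times> nat \<Rightarrow> 'l. lam ` ({..<4} \<times> {..<k}) \<subseteq> Idx \<Longrightarrow>
    \<bar>expectation (\<lambda>\<omega>. \<Prod>r<4. (\<Prod>a<k. V (lam (r, a)) \<omega>) -
       expectation (\<lambda>\<omega>. \<Prod>a<k. V (lam (r, a)) \<omega>))\<bar> \<le> C"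
    using expectation_centred_prod_bounded[of 4 k] by blast
  show "\<exists>C\<ge>0. \<forall>n>0. expectation (\<lambda>\<omega>. (normed_trace n ks \<omega> - expectation (normed_trace n ks)) ^ 4) \<le> C / real n ^ 2"
  proof (cases "ks = []")
    case True
    have "(\<lambda>\<omega>. (normed_trace n ks \<omega> - expectation (normed_trace n ks)) ^ 4) = (\<lambda>\<omega>. 0)" if "n > 0" for n
    proof -
      have "normed_trace n ks = (\<lambda>_. 1)" using that by (simp add: True normed_trace_Nil fun_eq_iff)
      then show ?thesis by (simp add: prob_space)
    qed
    then have "expectation (\<lambda>\<omega>. (normed_trace n ks \<omega> - expectation (normed_trace n ks)) ^ 4) \<le> 0 / real n ^ 2"
      if "n > 0" for n
      using that by (simp only:) simp
    then show ?thesis by (intro exI[of _ 0] conjI allI impI) simp_all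
  next
    case False
    define B where "B = 2 ^ (4 * k * (4 * k) + 4 * k) * \<bar>C\<bar>"
    have "expectation (\<lambda>\<omega>. (normed_trace n ks \<omega> - expectation (normed_trace n ks)) ^ 4) \<le> B / real n ^ 2"
      if n: "n > 0" for n
    proof -
      have zero: "expectation (?X n Z) = 0"
        if Z: "Z \<in> configurations n k 4" "Z \<notin> linked_configurations n ks" for Z
      proof -
        let ?E = "{..<4} \<times> {..<k}" and ?lam = "edge_labels n ks Z"
        have "(\<exists>e\<in>?E. \<forall>e'\<in>?E. ?lam e' = ?lam e \<longrightarrow> e' = e) \<or>
            (\<exists>r<4. \<forall>a<k. \<forall>e'\<in>?E. ?lam e' = ?lam (r, a) \<longrightarrow> fst e' = r)"
        proof -
          have "\<not> ((\<forall>e\<in>?E. \<exists>e'\<in>?E. e' \<noteq> e \<and> ?lam e' = ?lam e) \<and>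
              (\<forall>r<4. \<exists>a<k. \<exists>e'\<in>?E. fst e' \<noteq> r \<and> ?lam e' = ?lam (r, a)))"
            using Z unfolding linked_configurations_def k_def by blast
          then show ?thesis by blast
        qed
        then obtain r where "r < 4" "(\<exists>a\<in>{..<k}. \<forall>e\<in>?E. ?lam e = ?lam (r, a) \<longrightarrow> e = (r, a)) \<or>
          (\<forall>a\<in>{..<k}. \<forall>e\<in>?E. ?lam e = ?lam (r, a) \<longrightarrow> fst e = r)"
          by (elim disjE bexE exE conjE) fastforce+
        then show ?thesis
          using edge_labels_image[OF ks, of Z n 4] Z(1)
          by (intro expectation_centred_prod_eq_0[of _ _ _ r]) (auto simp: k_def)
      qed
      have sub: "linked_configurations n ks \<subseteq> configurations n k 4"
        by (auto simp: linked_configurations_def k_def)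
      have eq: "expectation (\<lambda>\<omega>. (normed_trace n ks \<omega> - expectation (normed_trace n ks)) ^ 4) =
          (\<Sum>Z\<in>configurations n k 4. expectation (?X n Z)) / (real n * sqrt (real n) ^ k) ^ 4"
        unfolding expand using int by simp
      have "(\<Sum>Z\<in>configurations n k 4. expectation (?X n Z)) =
          (\<Sum>Z\<in>linked_configurations n ks. expectation (?X n Z))"
        using zero by (intro sum.mono_neutral_right sub) auto
      also have "\<dots> \<le> (\<Sum>Z\<in>linked_configurations n ks. \<bar>C\<bar>)"
      proof (rule sum_mono)
        fix Z assume "Z \<in> linked_configurations n ks"
        then have "\<bar>expectation (?X n Z)\<bar> \<le> C"
          using edge_labels_image[OF ks, of Z n 4] sub by (intro C) (auto simp: k_def)
        then show "expectation (?X n Z) \<le> \<bar>C\<bar>" by linarith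
      qed
      also have "\<dots> = real (card (linked_configurations n ks)) * \<bar>C\<bar>" by simp
      also have "\<dots> \<le> real (2 ^ (4 * k * (4 * k) + 4 * k) * n ^ (2 * k + 2)) * \<bar>C\<bar>"
        using card_linked_configurations[OF ks False n]
        by (intro mult_right_mono of_nat_mono) (simp_all add: k_def)
      also have "\<dots> = B * real n ^ (2 * k + 2)" by (simp add: B_def)
      finally have "expectation (\<lambda>\<omega>. (normed_trace n ks \<omega> - expectation (normed_trace n ks)) ^ 4) \<le>
          B * real n ^ (2 * k + 2) / (real n * sqrt (real n) ^ k) ^ 4"
        unfolding eq by (intro divide_right_mono) simp_all
      also have "B * real n ^ (2 * k + 2) / (real n * sqrt (real n) ^ k) ^ 4 = B / real n ^ 2"
      proof -
        have "(sqrt (real n) ^ k) ^ 4 = (sqrt (real n) ^ 2) ^ (2 * k)"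
          by (simp only: power_mult[symmetric]) (simp add: mult.commute)
        then have "(real n * sqrt (real n) ^ k) ^ 4 = real n ^ (2 * k + 2) * real n ^ 2"
          by (simp add: power_mult_distrib power_add power2_eq_square power4_eq_xxxx)
        then show ?thesis using n by simp
      qed
      finally show ?thesis .
    qed
    then show ?thesis by (intro exI[of _ B]) (auto simp: B_def)
  qed
qed

text \<open>Borel-Cantelli in integrated form: the expectations of the fourth powers are summable,
  hence the sum of the fourth powers is almost surely finite and its terms tend to zero.\<close>

lemma normed_trace_AE:
  assumes ks: "set ks \<subseteq> K"
  shows "AE \<omega> in M. (\<lambda>n. normed_trace n ks \<omega> - expectation (normed_trace n ks)) \<longlonglongrightarrow> 0"
proof -
  \<comment> \<open>The shift by \<open>Suc\<close> avoids dimension zero, which the fourth moment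
    bound does not cover.\<close>
  define f where "f n \<omega> = (normed_trace (Suc n) ks \<omega> - expectation (normed_trace (Suc n) ks)) ^ 4" for n \<omega>
  have int: "integrable M (f n)" and nonneg: "0 \<le> f n \<omega>" for n \<omega>
    unfolding f_def by (intro integrable_normed_trace_power ks, simp)
  obtain C where C: "C \<ge> 0" "\<And>n. expectation (f n) \<le> C / real (Suc n) ^ 2"
    using fourth_moment_normed_trace[OF ks] unfolding f_def by blast
  have "summable (\<lambda>n. C * (1 / real (Suc n) ^ 2))"
    by (intro summable_mult) (use inverse_power_summable[of 2, where 'a = real] in
        \<open>simp add: summable_Suc_iff[of "\<lambda>n. inverse (real n ^ 2)"] divide_inverse del: of_nat_Suc\<close>)
  then have "summable (\<lambda>n. expectation (f n))"
    by (rule summable_comparison_test'[of _ 0])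
      (use C nonneg in \<open>simp add: integral_nonneg\<close>)
  then have "(\<Sum>n. ennreal (expectation (f n))) \<noteq> \<infinity>"
    using nonneg by (simp add: suminf_ennreal2 integral_nonneg)
  then have "(\<integral>\<^sup>+\<omega>. (\<Sum>n. ennreal (f n \<omega>)) \<partial>M) \<noteq> \<infinity>"
    using int nonneg by (subst nn_integral_suminf) (auto simp: nn_integral_eq_integral)
  then have "AE \<omega> in M. (\<Sum>n. ennreal (f n \<omega>)) \<noteq> \<infinity>"
    using int by (intro nn_integral_PInf_AE) auto
  then show ?thesis
  proof (rule AE_mp, intro AE_I2 impI)
    fix \<omega> assume "(\<Sum>n. ennreal (f n \<omega>)) \<noteq> \<infinity>"
    then have "summable (\<lambda>n. f n \<omega>)"
      using nonneg by (intro summable_suminf_not_top) auto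
    then have "(\<lambda>n. f n \<omega>) \<longlonglongrightarrow> 0" by (rule summable_LIMSEQ_zero)
    then have "(\<lambda>n. root 4 (f n \<omega>)) \<longlonglongrightarrow> root 4 0" by (rule tendsto_real_root)
    moreover have "root 4 (f n \<omega>) = \<bar>normed_trace (Suc n) ks \<omega> - expectation (normed_trace (Suc n) ks)\<bar>" for n
    proof -
      have "f n \<omega> = \<bar>normed_trace (Suc n) ks \<omega> - expectation (normed_trace (Suc n) ks)\<bar> ^ 4"
        by (simp add: f_def power_even_abs)
      then show ?thesis by (simp only: real_root_power_cancel zero_less_numeral abs_ge_zero)
    qed
    ultimately have "(\<lambda>n. \<bar>normed_trace (Suc n) ks \<omega> - expectation (normed_trace (Suc n) ks)\<bar>) \<longlonglongrightarrow> 0"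
      by simp
    then show "(\<lambda>n. normed_trace n ks \<omega> - expectation (normed_trace n ks)) \<longlonglongrightarrow> 0"
      by (subst filterlim_sequentially_Suc[symmetric]) (rule tendsto_rabs_zero_cancel)
  qed
qed

text \<open>Asymptotic factorisation from fourth central moments alone:
  \<open>\<bar>x y\<bar>\<close> is at most \<open>c (x^4 + y^4) + 2 / c\<close>, and the choice
  \<open>c = n\<close> makes both parts of the bound \<open>O(1 / n)\<close>.\<close>

lemma normed_trace_covariance:
  assumes us: "set us \<subseteq> K" and vs: "set vs \<subseteq> K"
  shows "(\<lambda>n. expectation (\<lambda>\<omega>. normed_trace n us \<omega> * normed_trace n vs \<omega>) -
          expectation (normed_trace n us) * expectation (normed_trace n vs)) \<longlonglongrightarrow> 0"
proof -
  let ?A = "\<lambda>ks n \<omega>. normed_trace n ks \<omega> - expectation (normed_trace n ks)"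
  have meas: "?A ks n \<in> borel_measurable M" if "set ks \<subseteq> K" for ks n
    using integrable_normed_trace[OF that, of n] by simp
  have sq: "x ^ 2 \<le> c * x ^ 4 + 1 / c" if "c > 0" for x c :: real
  proof -
    have "0 \<le> (c * x ^ 2 - 1) ^ 2" by simp
    then have "2 * (c * x ^ 2) \<le> c ^ 2 * x ^ 4 + 1"
      by (simp add: power2_eq_square algebra_simps power4_eq_xxxx)
    moreover have "0 \<le> c * x ^ 2" using that by simp
    ultimately have "c * x ^ 2 \<le> c ^ 2 * x ^ 4 + 1" by linarith
    also have "\<dots> = c * (c * x ^ 4 + 1 / c)"
      using that by (simp add: algebra_simps power2_eq_square)
    finally show ?thesis using that by simp
  qed
  have prod: "\<bar>x * y\<bar> \<le> (c * x ^ 4 + 1 / c) + (c * y ^ 4 + 1 / c)" if "c > 0" for x y c :: real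
  proof -
    have "0 \<le> (\<bar>x\<bar> - \<bar>y\<bar>) ^ 2" by simp
    then have "2 * \<bar>x * y\<bar> \<le> x ^ 2 + y ^ 2"
      by (simp add: power2_eq_square algebra_simps abs_mult)
    then have "\<bar>x * y\<bar> \<le> x ^ 2 + y ^ 2" using zero_le_power2[of x] zero_le_power2[of y] by linarith
    then show ?thesis using sq[OF that, of x] sq[OF that, of y] by linarith
  qed
  have int4: "integrable M (\<lambda>\<omega>. ?A ks n \<omega> ^ 4)" if "set ks \<subseteq> K" for ks n
    using that by (rule integrable_normed_trace_power)
  have intb: "integrable M (\<lambda>\<omega>. (c * ?A us n \<omega> ^ 4 + 1 / c) + (c * ?A vs n \<omega> ^ 4 + 1 / c))" for n c
    using int4[OF us] int4[OF vs] by simp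
  \<comment> \<open>The same inequality with \<open>c = 1\<close> supplies an integrable
    majorant.\<close>
  have intA: "integrable M (\<lambda>\<omega>. ?A us n \<omega> * ?A vs n \<omega>)" for n
  proof (rule Bochner_Integration.integrable_bound[OF intb[of 1 n]])
    show "(\<lambda>\<omega>. ?A us n \<omega> * ?A vs n \<omega>) \<in> borel_measurable M"
      using meas[OF us] meas[OF vs] by (rule borel_measurable_times)
    show "AE \<omega> in M. norm (?A us n \<omega> * ?A vs n \<omega>) \<le>
        norm ((1 * ?A us n \<omega> ^ 4 + 1 / 1) + (1 * ?A vs n \<omega> ^ 4 + 1 / 1))"
      using prod[of 1] by (intro AE_I2) (simp add: order_trans[OF _ abs_ge_self])
  qed
  have eq: "normed_trace n us \<omega> * normed_trace n vs \<omega> = ?A us n \<omega> * ?A vs n \<omega> +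
     expectation (normed_trace n us) * normed_trace n vs \<omega> +
     expectation (normed_trace n vs) * normed_trace n us \<omega> -
     expectation (normed_trace n us) * expectation (normed_trace n vs)" for n \<omega>
    by (simp add: algebra_simps)
  have cov: "expectation (\<lambda>\<omega>. normed_trace n us \<omega> * normed_trace n vs \<omega>) -
          expectation (normed_trace n us) * expectation (normed_trace n vs) =
        expectation (\<lambda>\<omega>. ?A us n \<omega> * ?A vs n \<omega>)" for n
    unfolding eq using intA[of n] integrable_normed_trace[OF us, of n] integrable_normed_trace[OF vs, of n]
    by (simp add: prob_space)
  obtain C where C: "\<And>n. n > 0 \<Longrightarrow> expectation (\<lambda>\<omega>. ?A us n \<omega> ^ 4) \<le> C / real n ^ 2"
    using fourth_moment_normed_trace[OF us] by blast
  obtain D where D: "\<And>n. n > 0 \<Longrightarrow> expectation (\<lambda>\<omega>. ?A vs n \<omega> ^ 4) \<le> D / real n ^ 2"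
    using fourth_moment_normed_trace[OF vs] by blast
  have bound: "\<bar>expectation (\<lambda>\<omega>. ?A us n \<omega> * ?A vs n \<omega>)\<bar> \<le> (C + D + 2) / real n" if n: "n > 0" for n
  proof -
    have "\<bar>expectation (\<lambda>\<omega>. ?A us n \<omega> * ?A vs n \<omega>)\<bar> \<le> expectation (\<lambda>\<omega>. \<bar>?A us n \<omega> * ?A vs n \<omega>\<bar>)"
      by (rule integral_abs_bound)
    also have "\<dots> \<le> expectation (\<lambda>\<omega>. (n * ?A us n \<omega> ^ 4 + 1 / n) + (n * ?A vs n \<omega> ^ 4 + 1 / n))"
      using n by (intro integral_mono intb integrable_abs intA prod) simp
    also have "\<dots> = n * expectation (\<lambda>\<omega>. ?A us n \<omega> ^ 4) + 1 / n + (n * expectation (\<lambda>\<omega>. ?A vs n \<omega> ^ 4) + 1 / n)"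
      using int4[OF us, of n] int4[OF vs, of n] by (simp add: prob_space)
    also have "\<dots> \<le> n * (C / real n ^ 2) + 1 / n + (n * (D / real n ^ 2) + 1 / n)"
      by (intro add_mono mult_left_mono C D n order_refl) simp_all
    also have "\<dots> = (C + D + 2) / real n"
      using n by (simp add: field_simps power2_eq_square)
    finally show ?thesis .
  qed
  show "(\<lambda>n. expectation (\<lambda>\<omega>. normed_trace n us \<omega> * normed_trace n vs \<omega>) -
          expectation (normed_trace n us) * expectation (normed_trace n vs)) \<longlonglongrightarrow> 0"
    unfolding cov
  proof (rule Lim_null_comparison)
    show "\<forall>\<^sub>F n in sequentially. norm (expectation (\<lambda>\<omega>. ?A us n \<omega> * ?A vs n \<omega>)) \<le> (C + D + 2) / real n"
      using bound by (intro eventually_sequentiallyI[of 1]) simp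
    show "(\<lambda>n. (C + D + 2) / real n) \<longlonglongrightarrow> 0" by (rule lim_const_over_n)
  qed
qed

end

section \<open>The asymptotic Schwinger-Dyson equation\<close>

context patterned_inputs
begin

definition label_count :: "nat \<Rightarrow> 'k list \<Rightarrow> (nat \<Rightarrow> nat) \<Rightarrow> nat \<Rightarrow> nat" where
  "label_count n ks \<pi> a = card {b. b < length ks \<and> edge_label n ks \<pi> b = edge_label n ks \<pi> a}"

definition pair_walks :: "nat \<Rightarrow> 'k list \<Rightarrow> (nat \<Rightarrow> nat) set" where
  "pair_walks n ks = {\<pi> \<in> walks n (length ks). \<forall>a<length ks. label_count n ks \<pi> a = 2}"

lemma triple_walks_eq: "triple_walks n ks = {\<pi> \<in> walks n (length ks).
     (\<forall>a<length ks. 2 \<le> label_count n ks \<pi> a) \<and> (\<exists>a<length ks. 3 \<le> label_count n ks \<pi> a)}"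
  by (simp add: triple_walks_def label_count_def)

lemma label_count_eq_1:
  assumes "a < length ks" "label_count n ks \<pi> a < 2" "b < length ks"
    "edge_label n ks \<pi> b = edge_label n ks \<pi> a"
  shows "b = a"
proof (rule ccontr)
  assume "b \<noteq> a"
  then have "card {a, b} = 2" by simp
  moreover have "card {a, b} \<le> label_count n ks \<pi> a"
    unfolding label_count_def using assms by (intro card_mono) auto
  ultimately show False using assms(2) by simp
qed

lemma label_count_eq_2:
  assumes "label_count n ks \<pi> a = 2" "a < length ks" "b < length ks" "c < length ks" "a \<noteq> b" "a \<noteq> c"
    "edge_label n ks \<pi> b = edge_label n ks \<pi> a" "edge_label n ks \<pi> c = edge_label n ks \<pi> a"
  shows "b = c"
proof (rule ccontr)
  assume "b \<noteq> c"
  then have "card {a, b, c} = 3" using assms by simp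
  moreover have "card {a, b, c} \<le> label_count n ks \<pi> a"
    unfolding label_count_def using assms by (intro card_mono) auto
  ultimately show False using assms(1) by simp
qed

lemma expectation_walk_prod_single:
  assumes "set ks \<subseteq> K" "\<pi> \<in> walks n (length ks)" "a < length ks" "label_count n ks \<pi> a < 2"
  shows "expectation (walk_prod n ks \<pi>) = 0"
  unfolding walk_prod_def using assms label_count_eq_1[OF assms(3,4)]
  by (intro expectation_prod_single[of _ _ a] edge_label_image) auto

lemma expectation_walk_prod_pairs:
  assumes "set ks \<subseteq> K" "\<pi> \<in> pair_walks n ks"
  shows "expectation (walk_prod n ks \<pi>) = 1"
  unfolding walk_prod_def using assms
  by (intro expectation_prod_pairs edge_label_image)
    (auto simp: pair_walks_def label_count_def)

lemma power_le_sqrt_power: "n > 0 \<Longrightarrow> 2 * m \<le> j \<Longrightarrow> real n ^ m \<le> sqrt (real n) ^ j"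
proof -
  assume n: "n > 0" and m: "2 * m \<le> j"
  have "real n ^ m = sqrt (real n) ^ (2 * m)" by (simp add: power_mult)
  also have "\<dots> \<le> sqrt (real n) ^ j" using n m by (intro power_increasing) auto
  finally show ?thesis .
qed

lemma negligible_triple_walks:
  assumes "set ks \<subseteq> K" "ks \<noteq> []"
  shows "(\<lambda>n. real (card (triple_walks n ks)) / (real n * sqrt (real n) ^ length ks)) \<longlonglongrightarrow> 0"
proof (rule Lim_null_comparison)
  let ?k = "length ks" and ?C = "2 ^ (length ks * length ks + length ks) :: real"
  show "\<forall>\<^sub>F n in sequentially. norm (real (card (triple_walks n ks)) / (real n * sqrt (real n) ^ ?k)) \<le>
      ?C / sqrt (real n)"
  proof (intro eventually_sequentiallyI[of 1])
    fix n :: nat assume "1 \<le> n"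
    then have n: "n > 0" by simp
    have "real (card (triple_walks n ks)) \<le> real (2 ^ (?k * ?k + ?k) * n ^ (1 + (?k - 1) div 2))"
      using card_triple_walks[OF assms n] by (intro of_nat_mono)
    also have "\<dots> = ?C * (real n * real n ^ ((?k - 1) div 2))" by simp
    also have "\<dots> \<le> ?C * (real n * sqrt (real n) ^ (?k - 1))"
      using n by (intro mult_left_mono power_le_sqrt_power) auto
    finally have le: "real (card (triple_walks n ks)) \<le> ?C * (real n * sqrt (real n) ^ (?k - 1))" .
    have "norm (real (card (triple_walks n ks)) / (real n * sqrt (real n) ^ ?k)) \<le>
        ?C * (real n * sqrt (real n) ^ (?k - 1)) / (real n * sqrt (real n) ^ ?k)"
      using divide_right_mono[OF le, of "real n * sqrt (real n) ^ ?k"] by simp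
    also have "\<dots> = ?C / sqrt (real n)"
    proof -
      have "sqrt (real n) ^ ?k = sqrt (real n) * sqrt (real n) ^ (?k - 1)"
        using assms(2) by (cases ks) auto
      then show ?thesis using n by simp
    qed
    finally show "norm (real (card (triple_walks n ks)) / (real n * sqrt (real n) ^ ?k)) \<le> ?C / sqrt (real n)" .
  qed
  show "(\<lambda>n. ?C / sqrt (real n)) \<longlonglongrightarrow> 0"
    by (intro tendsto_divide_0[OF tendsto_const] filterlim_at_top_imp_at_infinity
        filterlim_compose[OF sqrt_at_top filterlim_real_sequentially])
qed

text \<open>A label of multiplicity one makes the expectation zero, and a walk with all labels
  paired has expectation one by the unit variances; the remaining walks are negligible. So the limit
  does not depend on the distributions of the inputs.\<close>

lemma normed_trace_pair_walks:
  assumes ks: "set ks \<subseteq> K" "ks \<noteq> []"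
  shows "(\<lambda>n. expectation (normed_trace n ks) -
    real (card (pair_walks n ks)) / (real n * sqrt (real n) ^ length ks)) \<longlonglongrightarrow> 0"
proof -
  let ?k = "length ks" and ?c = "\<lambda>n. real n * sqrt (real n) ^ length ks"
  obtain C where C: "\<And>E (lam :: nat \<Rightarrow> 'l). finite E \<Longrightarrow> card E \<le> ?k \<Longrightarrow>
     lam ` E \<subseteq> Idx \<Longrightarrow> \<bar>expectation (\<lambda>\<omega>. \<Prod>e\<in>E. V (lam e) \<omega>)\<bar> \<le> C"
    using expectation_prod_bounded[of ?k] by blast
  have eq: "expectation (normed_trace n ks) - real (card (pair_walks n ks)) / ?c n =
      (\<Sum>\<pi>\<in>triple_walks n ks. expectation (walk_prod n ks \<pi>)) / ?c n" for n
  proof -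
    let ?W = "walks n ?k"
    have "(\<Sum>\<pi>\<in>?W. expectation (walk_prod n ks \<pi>)) =
        (\<Sum>\<pi>\<in>pair_walks n ks \<union> triple_walks n ks. expectation (walk_prod n ks \<pi>))"
    proof (rule sum.mono_neutral_right)
      show "\<forall>\<pi>\<in>?W - (pair_walks n ks \<union> triple_walks n ks). expectation (walk_prod n ks \<pi>) = 0"
      proof
        fix \<pi> assume pi: "\<pi> \<in> ?W - (pair_walks n ks \<union> triple_walks n ks)"
        have "\<exists>a<?k. label_count n ks \<pi> a < 2"
        proof (rule ccontr)
          assume "\<not> ?thesis"
          then have ge2: "\<forall>a<?k. 2 \<le> label_count n ks \<pi> a" by auto
          then have "\<forall>a<?k. \<not> 3 \<le> label_count n ks \<pi> a" using pi by (auto simp: triple_walks_eq)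
          then have "\<forall>a<?k. label_count n ks \<pi> a = 2" using ge2 by force
          then have "\<pi> \<in> pair_walks n ks" using pi by (simp only: pair_walks_def) blast
          then show False using pi by blast
        qed
        then show "expectation (walk_prod n ks \<pi>) = 0"
          using pi expectation_walk_prod_single[OF ks(1)] by blast
      qed
    qed (auto simp: pair_walks_def triple_walks_eq)
    also have "\<dots> = (\<Sum>\<pi>\<in>pair_walks n ks. expectation (walk_prod n ks \<pi>)) +
        (\<Sum>\<pi>\<in>triple_walks n ks. expectation (walk_prod n ks \<pi>))"
    proof (rule sum.union_disjoint)
      show "pair_walks n ks \<inter> triple_walks n ks = {}"
        by (auto simp: pair_walks_def triple_walks_eq)
    qed (simp_all add: pair_walks_def triple_walks_eq)
    also have "(\<Sum>\<pi>\<in>pair_walks n ks. expectation (walk_prod n ks \<pi>)) = real (card (pair_walks n ks))"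
      by (simp add: expectation_walk_prod_pairs[OF ks(1)])
    finally have "(\<Sum>\<pi>\<in>?W. expectation (walk_prod n ks \<pi>)) = real (card (pair_walks n ks)) +
        (\<Sum>\<pi>\<in>triple_walks n ks. expectation (walk_prod n ks \<pi>))" .
    moreover have "expectation (normed_trace n ks) = (\<Sum>\<pi>\<in>?W. expectation (walk_prod n ks \<pi>)) / ?c n"
      unfolding normed_trace_def using ks(1) by (simp add: integrable_walk_prod)
    ultimately show ?thesis by (simp add: add_divide_distrib)
  qed
  show ?thesis
    unfolding eq
  proof (rule Lim_null_comparison)
    show "\<forall>\<^sub>F n in sequentially. norm ((\<Sum>\<pi>\<in>triple_walks n ks. expectation (walk_prod n ks \<pi>)) / ?c n) \<le>
        \<bar>C\<bar> * (real (card (triple_walks n ks)) / ?c n)"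
    proof (rule always_eventually, rule allI)
      fix n
      have "\<bar>expectation (walk_prod n ks \<pi>)\<bar> \<le> \<bar>C\<bar>" if "\<pi> \<in> triple_walks n ks" for \<pi>
      proof -
        have "\<bar>expectation (walk_prod n ks \<pi>)\<bar> \<le> C"
          unfolding walk_prod_def using that ks(1)
          by (intro C edge_label_image) (auto simp: triple_walks_eq)
        then show ?thesis by linarith
      qed
      then have "\<bar>\<Sum>\<pi>\<in>triple_walks n ks. expectation (walk_prod n ks \<pi>)\<bar> \<le> (\<Sum>\<pi>\<in>triple_walks n ks. \<bar>C\<bar>)"
        by (intro order_trans[OF sum_abs] sum_mono)
      then show "norm ((\<Sum>\<pi>\<in>triple_walks n ks. expectation (walk_prod n ks \<pi>)) / ?c n) \<le>
        \<bar>C\<bar> * (real (card (triple_walks n ks)) / ?c n)"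
        by (simp add: abs_mult divide_right_mono mult.commute)
    qed
    show "(\<lambda>n. \<bar>C\<bar> * (real (card (triple_walks n ks)) / ?c n)) \<longlonglongrightarrow> 0"
      using negligible_triple_walks[OF ks] by (rule tendsto_mult_right_zero)
  qed
qed

section \<open>Wigner edges traversed twice in the same direction\<close>

text \<open>A label is the unordered pair of its indices: the property of Wigner matrices behind the
  Schwinger-Dyson equation.\<close>

definition wigner_letter :: "'k \<Rightarrow> bool" where
  "wigner_letter w \<longleftrightarrow> w \<in> K \<and> (\<forall>n i j i' j'. lab n w i j = lab n w i' j' \<longleftrightarrow>
     i = i' \<and> j = j' \<or> i = j' \<and> j = i')"

definition parallel_walks :: "nat \<Rightarrow> 'k list \<Rightarrow> nat \<Rightarrow> (nat \<Rightarrow> nat) set" where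
  "parallel_walks n ks b = {\<pi> \<in> pair_walks n ks. ks ! b = ks ! 0 \<and> \<pi> 0 = \<pi> b \<and> \<pi> 1 = \<pi> (Suc b)}"

text \<open>Both ends of the edges \<open>0\<close> and \<open>b\<close> are visited by the rest of the walk, so that their common
  label does not contribute a degree of freedom.\<close>

lemma card_parallel_walks:
  assumes ks: "set ks \<subseteq> K" and b: "0 < b" "b < length ks" and n: "n > 0"
  shows "card (parallel_walks n ks b) \<le> 2 ^ (length ks * length ks) * (n ^ (length ks div 2) * 2 ^ length ks)"
proof -
  define k where "k = length ks"
  let ?P = "parallel_walks n ks b"
  let ?l = "edge_label n ks"
  let ?ker = "\<lambda>\<pi>. {d \<in> {..<k} \<times> {..<k}. ?l \<pi> (fst d) = ?l \<pi> (snd d)}"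
  have bk: "b < k" "k > 1" using b by (simp_all add: k_def)
  have walk: "\<pi> \<in> walks n k" if "\<pi> \<in> ?P" for \<pi>
    using that by (simp add: parallel_walks_def pair_walks_def k_def)
  have "card ?P \<le> card (Pow ({..<k} \<times> {..<k})) * (n ^ (k div 2) * 2 ^ k)"
  proof (rule card_le_fibres[where h = ?ker])
    show "finite ?P" by (rule finite_subset[of _ "walks n k"]) (use walk in auto)
    fix \<rho> assume rho: "\<rho> \<in> ?P"
    let ?Q = "{\<pi> \<in> ?P. ?ker \<pi> = ?ker \<rho>}"
    have ker: "?l \<pi> a = ?l \<pi> a' \<longleftrightarrow> ?l \<rho> a = ?l \<rho> a'" if "\<pi> \<in> ?Q" "a < k" "a' < k" for \<pi> a a'
    proof -
      have "(a, a') \<in> ?ker \<pi> \<longleftrightarrow> (a, a') \<in> ?ker \<rho>" using that(1) by blast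
      then show ?thesis using that by simp
    qed
    have mult: "label_count n ks \<rho> a = 2" if "a < k" for a
      using rho that by (simp add: parallel_walks_def pair_walks_def k_def)
    have l0b: "?l \<rho> b = ?l \<rho> 0"
      using rho by (simp add: parallel_walks_def edge_label_def)
    define N where "N = {a \<in> {1..<k}. a \<noteq> b \<and> (\<forall>a'<a. ?l \<rho> a' \<noteq> ?l \<rho> a)}"
    define F where "F = insert 1 (Suc ` {a \<in> N. Suc a < k})"
    have finN: "finite N" by (simp add: N_def)
    have cardF: "card F \<le> k div 2"
    proof -
      have "card F \<le> Suc (card (Suc ` {a \<in> N. Suc a < k}))"
        unfolding F_def using finN by (simp add: card_insert_if)
      also have "\<dots> \<le> Suc (card N)"
        using finN by (simp add: card_image card_mono)
      also have "card N \<le> card (?l \<rho> ` {..<k} - {?l \<rho> 0})"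
      proof (rule card_inj_on_le)
        show "inj_on (?l \<rho>) N"
        proof (rule inj_onI)
          fix a a' assume "a \<in> N" "a' \<in> N" "?l \<rho> a = ?l \<rho> a'"
          then show "a = a'" by (cases a a' rule: linorder_cases) (auto simp: N_def)
        qed
        show "?l \<rho> ` N \<subseteq> ?l \<rho> ` {..<k} - {?l \<rho> 0}"
        proof
          fix t assume "t \<in> ?l \<rho> ` N"
          then obtain a where a: "a \<in> N" "t = ?l \<rho> a" by auto
          then have "?l \<rho> 0 \<noteq> ?l \<rho> a" by (simp add: N_def)
          then show "t \<in> ?l \<rho> ` {..<k} - {?l \<rho> 0}" using a by (auto simp: N_def)
        qed
      qed simp
      also have "\<dots> = card (?l \<rho> ` {..<k}) - 1"
        using bk by (subst card_Diff_singleton) auto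
      finally have "card F \<le> Suc (card (?l \<rho> ` {..<k}) - 1)" by simp
      moreover have "0 < card (?l \<rho> ` {..<k})" using bk by (simp add: card_gt_0_iff lessThan_empty_iff)
      moreover have "2 * card (?l \<rho> ` {..<k}) \<le> k"
      proof -
        have "2 * card (?l \<rho> ` {..<k}) + (\<Sum>t\<in>{}. card {e \<in> {..<k}. ?l \<rho> e = t}) \<le> card {..<k} + 2 * card ({} :: 'l set)"
        proof (rule card_multiplicity_le)
          fix t assume "t \<in> ?l \<rho> ` {..<k}"
          then obtain a where "a < k" "t = ?l \<rho> a" by auto
          then show "2 \<le> card {e \<in> {..<k}. ?l \<rho> e = t}"
            using mult[of a] by (simp add: label_count_def k_def)
        qed auto
        then show ?thesis by simp
      qed
      ultimately show ?thesis by linarith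
    qed
    \<comment> \<open>Rank \<open>2 * b + 1\<close> places vertex \<open>0\<close> right after
      vertex \<open>b\<close>, with which it coincides; the other vertices keep their order.\<close>
    have "card ?Q \<le> n ^ card F * 2 ^ card {..<k}"
    proof (rule card_le_encoding[where val = "\<lambda>\<pi>. \<pi>" and rank = "\<lambda>c. if c = 0 then 2 * b + 1 else 2 * c" and
          code = "\<lambda>\<pi> c. side n (ks ! (c - 1)) (\<pi> (c - 1)) (\<pi> c)"])
      show "F \<subseteq> {..<k}" using bk by (auto simp: F_def)
      show "\<pi> c < n" if "\<pi> \<in> ?Q" "c \<in> F" for \<pi> c
        using that walk[of \<pi>] bk by (auto simp: F_def intro: walks_less)
      show "\<pi> = \<pi>'" if "\<pi> \<in> ?Q" "\<pi>' \<in> ?Q" "\<forall>c\<in>{..<k}. \<pi> c = \<pi>' c" for \<pi> \<pi>'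
        using that walk bk by (intro walks_eqI[of \<pi> n k \<pi>']) auto
      show "\<pi> c = \<pi>' c"
        if pi: "\<pi> \<in> ?Q" "\<pi>' \<in> ?Q" and c: "c \<in> {..<k}" "c \<notin> F"
          and IH: "\<forall>d\<in>{..<k}. (if d = 0 then 2 * b + 1 else 2 * d) < (if c = 0 then 2 * b + 1 else 2 * c) \<longrightarrow> \<pi> d = \<pi>' d"
          and side: "side n (ks ! (c - 1)) (\<pi> (c - 1)) (\<pi> c) = side n (ks ! (c - 1)) (\<pi>' (c - 1)) (\<pi>' c)"
        for \<pi> \<pi>' c
      proof -
        have par: "\<tau> 0 = \<tau> b" "\<tau> 1 = \<tau> (Suc b)" if "\<tau> \<in> ?Q" for \<tau>
          using that by (auto simp: parallel_walks_def)
        consider "c = 0" | "c = Suc b" | "c \<noteq> 0" "c \<noteq> Suc b" by blast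
        then show ?thesis
        proof cases
          case 1
          then have "\<pi> b = \<pi>' b" using bspec[OF IH, of b] bk b by simp
          then show ?thesis using 1 par(1)[OF pi(1)] par(1)[OF pi(2)] by simp
        next
          case 2
          then have "\<pi> 1 = \<pi>' 1" using bspec[OF IH, of 1] bk b by simp
          then show ?thesis using 2 par(2)[OF pi(1)] par(2)[OF pi(2)] by simp
        next
          case 3
          then obtain a where a: "c = Suc a" by (cases c) auto
          have a': "1 \<le> a" "a \<noteq> b" "Suc a < k" using 3 a c by (auto simp: F_def) 
          have "a \<notin> N" using c a' by (auto simp: F_def a)
          then obtain d where d: "d < a" "?l \<rho> d = ?l \<rho> a" using a' by (auto simp: N_def)
          \<comment> \<open>The earlier edge must not start in vertex \<open>0\<close>, which may
            still be unknown. It does not, because the label of edge \<open>0\<close> occurs again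
            only at \<open>b\<close>.\<close>
          have "d \<noteq> 0"
          proof
            assume "d = 0"
            moreover have "ks \<noteq> []" using bk by (auto simp: k_def)
            ultimately have "b = a"
              using label_count_eq_2[OF mult, of 0 b a] bk a' d l0b b by (simp add: k_def)
            then show False using a' by simp
          qed
          have eq: "\<pi> e = \<pi>' e" if "e \<noteq> 0" "e \<le> a" for e
            using bspec[OF IH, of e] that a a' by simp
          have lab: "lab n (ks ! d) (\<tau> d) (\<tau> (Suc d)) = lab n (ks ! a) (\<tau> a) (\<tau> (Suc a))" if "\<tau> \<in> ?Q" for \<tau>
            using ker[OF that, of d a] d a' by (simp add: edge_label_def)
          have "lab n (ks ! a) (\<pi> a) (\<pi> (Suc a)) = lab n (ks ! a) (\<pi> a) (\<pi>' (Suc a))"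
            using lab[OF pi(1)] lab[OF pi(2)] eq[of d] eq[of "Suc d"] eq[of a] d a' \<open>d \<noteq> 0\<close> by simp
          moreover have "side n (ks ! a) (\<pi> a) (\<pi> (Suc a)) = side n (ks ! a) (\<pi> a) (\<pi>' (Suc a))"
            using side eq[of a] a' by (simp add: a)
          moreover have "ks ! a \<in> K" using ks a' by (auto simp: k_def)
          ultimately show ?thesis
            unfolding a using walks_less[OF walk, of \<pi>] walks_less[OF walk, of \<pi>'] pi a'
            by (intro lab_side[of "ks ! a" "\<pi> a" n]) auto
        qed
      qed
    qed auto
    also have "\<dots> \<le> n ^ (k div 2) * 2 ^ k"
      using cardF n by (simp add: power_increasing)
    finally show "card ?Q \<le> n ^ (k div 2) * 2 ^ k" .
  qed auto
  then show ?thesis by (simp add: card_Pow card_cartesian_product k_def)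
qed

lemma negligible_parallel_walks:
  assumes "set ks \<subseteq> K" "0 < b" "b < length ks"
  shows "(\<lambda>n. real (card (parallel_walks n ks b)) / (real n * sqrt (real n) ^ length ks)) \<longlonglongrightarrow> 0"
proof (rule Lim_null_comparison)
  let ?k = "length ks" and ?C = "2 ^ (length ks * length ks) * 2 ^ length ks :: real"
  show "\<forall>\<^sub>F n in sequentially. norm (real (card (parallel_walks n ks b)) / (real n * sqrt (real n) ^ ?k)) \<le> ?C / real n"
  proof (intro eventually_sequentiallyI[of 1])
    fix n :: nat assume "1 \<le> n"
    then have n: "n > 0" by simp
    have "real (card (parallel_walks n ks b)) \<le> real (2 ^ (?k * ?k) * (n ^ (?k div 2) * 2 ^ ?k))"
      using card_parallel_walks[OF assms n] by (intro of_nat_mono)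
    also have "\<dots> = ?C * real n ^ (?k div 2)" by simp
    also have "\<dots> \<le> ?C * sqrt (real n) ^ ?k"
      using n by (intro mult_left_mono power_le_sqrt_power) auto
    finally have le: "real (card (parallel_walks n ks b)) \<le> ?C * sqrt (real n) ^ ?k" .
    have "norm (real (card (parallel_walks n ks b)) / (real n * sqrt (real n) ^ ?k)) \<le>
        ?C * sqrt (real n) ^ ?k / (real n * sqrt (real n) ^ ?k)"
      using divide_right_mono[OF le, of "real n * sqrt (real n) ^ ?k"] by simp
    also have "\<dots> = ?C / real n" using n by simp
    finally show "norm (real (card (parallel_walks n ks b)) / (real n * sqrt (real n) ^ ?k)) \<le> ?C / real n" .
  qed
  show "(\<lambda>n. ?C / real n) \<longlonglongrightarrow> 0" by (rule lim_const_over_n)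
qed

end

context patterned_inputs
begin

section \<open>Splitting a walk at a Wigner edge traversed back and forth\<close>

text \<open>Labels are not restricted, so every pair of closed walks of the right lengths arises and
  the sum over these walks factorises exactly.\<close>

definition reversed_walks :: "nat \<Rightarrow> 'k list \<Rightarrow> nat \<Rightarrow> (nat \<Rightarrow> nat) set" where
  "reversed_walks n ks b = {\<pi> \<in> walks n (length ks). \<pi> 0 = \<pi> (Suc b) \<and> \<pi> 1 = \<pi> b}"

definition reduced_prod :: "nat \<Rightarrow> 'k list \<Rightarrow> nat \<Rightarrow> (nat \<Rightarrow> nat) \<Rightarrow> 'a \<Rightarrow> real" where
  "reduced_prod n ks b \<pi> \<omega> = (\<Prod>a\<in>{..<length ks} - {0, b}. V (edge_label n ks \<pi> a) \<omega>)"

text \<open>A walk that traverses the edge \<open>0\<close> again in the opposite direction splits into two closed walks.\<close>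

lemma sum_reversed_walks:
  assumes c: "c < length u"
  shows "(\<Sum>\<pi>\<in>reversed_walks n (w # u) (Suc c). reduced_prod n (w # u) (Suc c) \<pi> \<omega>) =
    (\<Sum>\<rho>\<in>walks n c. walk_prod n (take c u) \<rho> \<omega>) *
    (\<Sum>\<sigma>\<in>walks n (length u - Suc c). walk_prod n (drop (Suc c) u) \<sigma> \<omega>)"
proof -
  define m where "m = length u - Suc c"
  have len: "length (w # u) = Suc (Suc (c + m))" using c by (simp add: m_def)
  \<comment> \<open>The walk \<open>\<rho>\<close> occupies the vertices \<open>1\<close> to
    \<open>Suc c\<close> between the two traversals, and \<open>\<sigma>\<close> those from
    \<open>Suc (Suc c)\<close> on. Vertex \<open>0\<close> repeats the start of
    \<open>\<sigma>\<close>, where the second traversal ends.\<close>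
  define join where "join = (\<lambda>(\<rho> :: nat \<Rightarrow> nat, \<sigma> :: nat \<Rightarrow> nat). \<lambda>a\<in>{..Suc (Suc (c + m))}.
    if a = 0 then \<sigma> 0 else if a \<le> Suc c then \<rho> (a - 1) else \<sigma> (a - Suc (Suc c)))"
  define split where "split = (\<lambda>\<pi> :: nat \<Rightarrow> nat. (\<lambda>a\<in>{..c}. \<pi> (Suc a), \<lambda>a\<in>{..m}. \<pi> (a + Suc (Suc c))))"
  have "(\<Sum>(\<rho>, \<sigma>)\<in>walks n c \<times> walks n m. walk_prod n (take c u) \<rho> \<omega> * walk_prod n (drop (Suc c) u) \<sigma> \<omega>) =
    (\<Sum>\<pi>\<in>reversed_walks n (w # u) (Suc c). reduced_prod n (w # u) (Suc c) \<pi> \<omega>)"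
  proof (rule sum.reindex_bij_witness[of _ split join])
    fix p assume p: "p \<in> walks n c \<times> walks n m"
    obtain \<rho> \<sigma> where rs: "p = (\<rho>, \<sigma>)" "\<rho> \<in> walks n c" "\<sigma> \<in> walks n m" using p by auto
    have undef: "\<rho> a = undefined" if "a > c" for a
      using that rs(2) by (auto simp: walks_def PiE_iff extensional_def)
    have undef': "\<sigma> a = undefined" if "a > m" for a
      using that rs(3) by (auto simp: walks_def PiE_iff extensional_def)
    show "split (join p) = p"
      unfolding rs(1) split_def join_def prod.case
      by (intro prod_eqI ext) (auto simp: restrict_def undef undef')
    have cl: "\<rho> c = \<rho> 0" "\<sigma> m = \<sigma> 0" using rs walks_closed by auto
    have less: "\<rho> a < n" if "a \<le> c" for a using walks_less[OF rs(2) that] .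
    have less': "\<sigma> a < n" if "a \<le> m" for a using walks_less[OF rs(3) that] .
    show "join p \<in> reversed_walks n (w # u) (Suc c)"
      unfolding rs(1) reversed_walks_def join_def prod.case len walks_def
      using cl by (auto simp: less less')
    have "{..<Suc (Suc (c + m))} - {0, Suc c} = Suc ` {..<c} \<union> (\<lambda>a. a + Suc (Suc c)) ` {..<m}"
    proof (rule Set.set_eqI)
      fix a show "a \<in> {..<Suc (Suc (c + m))} - {0, Suc c} \<longleftrightarrow> a \<in> Suc ` {..<c} \<union> (\<lambda>a. a + Suc (Suc c)) ` {..<m}"
      proof (cases "a \<le> Suc c")
        case True
        then show ?thesis by (cases a) auto
      next
        case False
        then obtain d where "a = d + Suc (Suc c)" by (metis add.commute le_iff_add not_less_eq_eq)
        then show ?thesis by auto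
      qed
    qed
    then have "reduced_prod n (w # u) (Suc c) (join p) \<omega> =
        (\<Prod>a\<in>Suc ` {..<c} \<union> (\<lambda>a. a + Suc (Suc c)) ` {..<m}. V (edge_label n (w # u) (join p) a) \<omega>)"
      unfolding reduced_prod_def len by (rule arg_cong)
    also have "\<dots> = (\<Prod>a\<in>Suc ` {..<c}. V (edge_label n (w # u) (join p) a) \<omega>) *
        (\<Prod>a\<in>(\<lambda>a. a + Suc (Suc c)) ` {..<m}. V (edge_label n (w # u) (join p) a) \<omega>)"
      by (rule prod.union_disjoint) auto
    also have "\<dots> = (\<Prod>a<c. V (edge_label n (w # u) (join p) (Suc a)) \<omega>) *
        (\<Prod>a<m. V (edge_label n (w # u) (join p) (a + Suc (Suc c))) \<omega>)"
      by (simp only: prod.reindex[OF inj_Suc[THEN inj_on_subset, OF subset_UNIV]] 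
          prod.reindex[OF inj_on_add'] comp_def)
    also have "(\<Prod>a<c. V (edge_label n (w # u) (join p) (Suc a)) \<omega>) = walk_prod n (take c u) \<rho> \<omega>"
      unfolding walk_prod_def rs(1) join_def prod.case using c
      by (intro prod.cong) (auto simp: edge_label_def)
    also have "(\<Prod>a<m. V (edge_label n (w # u) (join p) (a + Suc (Suc c))) \<omega>) = walk_prod n (drop (Suc c) u) \<sigma> \<omega>"
      unfolding walk_prod_def rs(1) join_def prod.case using c
      by (intro prod.cong) (auto simp: edge_label_def m_def add.commute)
    finally show "reduced_prod n (w # u) (Suc c) (join p) \<omega> =
        (case p of (\<rho>, \<sigma>) \<Rightarrow> walk_prod n (take c u) \<rho> \<omega> * walk_prod n (drop (Suc c) u) \<sigma> \<omega>)"
      by (simp add: rs(1))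
  next
    fix \<pi> assume pi: "\<pi> \<in> reversed_walks n (w # u) (Suc c)"
    then have walk: "\<pi> \<in> walks n (Suc (Suc (c + m)))" and rev: "\<pi> 0 = \<pi> (Suc (Suc c))" "\<pi> 1 = \<pi> (Suc c)"
      using len by (auto simp: reversed_walks_def)
    have undef: "\<pi> a = undefined" if "a > Suc (Suc (c + m))" for a
      using that walk by (auto simp: walks_def PiE_iff extensional_def)
    show "join (split \<pi>) = \<pi>"
    proof
      fix a
      show "join (split \<pi>) a = \<pi> a"
        using undef[of a] rev by (cases a) (auto simp: join_def split_def)
    qed
    show "split \<pi> \<in> walks n c \<times> walks n m"
      using walks_less[OF walk] rev walks_closed[OF walk]
      by (auto simp: split_def walks_def add.commute)
  qed
  then show ?thesis
    by (simp add: sum_product sum.cartesian_product m_def)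
qed

lemma integrable_reduced_prod:
  assumes "set ks \<subseteq> K" "\<pi> \<in> walks n (length ks)"
  shows "integrable M (reduced_prod n ks b \<pi>)"
  unfolding reduced_prod_def using edge_label_image[OF assms] by (intro integrable_prod) auto

lemma reversed_walks_subset: "reversed_walks n ks b \<subseteq> walks n (length ks)"
  by (auto simp: reversed_walks_def)

lemma finite_reversed_walks [simp]: "finite (reversed_walks n ks b)"
  by (rule finite_subset[OF reversed_walks_subset]) simp

text \<open>Outside the negligible walks the equation is exact for each walk. A label of
  multiplicity one cannot belong to the edges \<open>0\<close> and \<open>Suc c\<close>, which share
  theirs; it survives in the reduced product and both sides vanish. If all labels are paired, the
  unique partner of edge \<open>0\<close> yields the only summand, and both sides are one.\<close>

lemma schwinger_dyson_term:
  assumes w: "wigner_letter w" and u: "set u \<subseteq> K"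
    and pi: "\<pi> \<in> walks n (length (w # u))" "\<pi> \<notin> triple_walks n (w # u)"
      "\<And>b. 0 < b \<Longrightarrow> b < length (w # u) \<Longrightarrow> \<pi> \<notin> parallel_walks n (w # u) b"
  shows "expectation (walk_prod n (w # u) \<pi>) =
    (\<Sum>c<length u. if u ! c = w \<and> \<pi> \<in> reversed_walks n (w # u) (Suc c)
       then expectation (reduced_prod n (w # u) (Suc c) \<pi>) else 0)"
proof -
  let ?ks = "w # u" and ?k = "length (w # u)"
  let ?l = "edge_label n ?ks \<pi>"
  have ks: "set ?ks \<subseteq> K" using w u by (auto simp: wigner_letter_def)
  have lw: "lab n w i j = lab n w i' j' \<longleftrightarrow> i = i' \<and> j = j' \<or> i = j' \<and> j = i'" for i j i' j'
    using w by (simp add: wigner_letter_def)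
  have rev: "?l (Suc c) = ?l 0" if "u ! c = w" "\<pi> \<in> reversed_walks n ?ks (Suc c)" for c
    using that by (simp add: edge_label_def reversed_walks_def lw)
  show ?thesis
  proof (cases "\<exists>a<?k. label_count n ?ks \<pi> a < 2")
    case True
    then obtain a where a: "a < ?k" "label_count n ?ks \<pi> a < 2" by auto
    have "expectation (reduced_prod n ?ks (Suc c) \<pi>) = 0"
      if "u ! c = w" "\<pi> \<in> reversed_walks n ?ks (Suc c)" "c < length u" for c
    proof -
      have "a \<noteq> 0"
      proof
        assume "a = 0"
        then show False
          using label_count_eq_1[OF a, of "Suc c"] rev[OF that(1,2)] that(3) by simp
      qed
      moreover have "a \<noteq> Suc c"
      proof
        assume "a = Suc c"
        then show False
          using label_count_eq_1[OF a, of 0] rev[OF that(1,2)] by simp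
      qed
      ultimately show ?thesis
        unfolding reduced_prod_def using a edge_label_image[OF ks pi(1)] label_count_eq_1[OF a]
        by (intro expectation_prod_single[of _ _ a]) auto
    qed
    then have "(\<Sum>c<length u. if u ! c = w \<and> \<pi> \<in> reversed_walks n ?ks (Suc c)
       then expectation (reduced_prod n ?ks (Suc c) \<pi>) else 0) = 0"
      by (intro sum.neutral) auto
    then show ?thesis using expectation_walk_prod_single[OF ks pi(1) a] by simp
  next
    case False
    then have ge2: "2 \<le> label_count n ?ks \<pi> a" if "a < ?k" for a
      using that by (meson not_less)
    have two: "label_count n ?ks \<pi> a = 2" if "a < ?k" for a
    proof -
      have "\<not> 3 \<le> label_count n ?ks \<pi> a"
        using pi(1,2) ge2 that unfolding triple_walks_eq mem_Collect_eq by blast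
      then show ?thesis using ge2[OF that] by linarith
    qed
    then have pair: "\<pi> \<in> pair_walks n ?ks" using pi(1) by (simp add: pair_walks_def)
    have "\<exists>b<?k. b \<noteq> 0 \<and> ?l b = ?l 0"
    proof (rule ccontr)
      assume "\<not> ?thesis"
      then have "{b. b < ?k \<and> ?l b = ?l 0} = {0}" by auto
      then show False using two[of 0] by (simp add: label_count_def)
    qed
    then obtain c where c: "c < length u" "?l (Suc c) = ?l 0"
      by (metis Suc_less_eq length_Cons not0_implies_Suc)
    have uc: "u ! c = w"
      using lab_letter[of n "u ! c" "\<pi> (Suc c)" "\<pi> (Suc (Suc c))" w "\<pi> 0" "\<pi> 1"] c(2)
      by (simp add: edge_label_def)
    have "\<pi> \<notin> parallel_walks n ?ks (Suc c)" using pi(3) c(1) by simp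
    \<comment> \<open>Equal Wigner labels leave two directions, and the parallel one is
      excluded.\<close>
    then have revc: "\<pi> \<in> reversed_walks n ?ks (Suc c)"
      using pair c(2) uc pi(1) by (auto simp: parallel_walks_def reversed_walks_def edge_label_def lw)
    have uniq: "d = c" if "d < length u" "u ! d = w" "\<pi> \<in> reversed_walks n ?ks (Suc d)" for d
      using label_count_eq_2[OF two[of 0], of "Suc d" "Suc c"] that c rev[OF that(2,3)] by simp
    have "(\<Sum>d<length u. if u ! d = w \<and> \<pi> \<in> reversed_walks n ?ks (Suc d)
       then expectation (reduced_prod n ?ks (Suc d) \<pi>) else 0) =
      (\<Sum>d<length u. if d = c then expectation (reduced_prod n ?ks (Suc c) \<pi>) else 0)"
    proof (intro sum.cong refl)
      fix d assume d: "d \<in> {..<length u}"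
      show "(if u ! d = w \<and> \<pi> \<in> reversed_walks n ?ks (Suc d)
         then expectation (reduced_prod n ?ks (Suc d) \<pi>) else 0) =
        (if d = c then expectation (reduced_prod n ?ks (Suc c) \<pi>) else 0)"
      proof (cases "d = c")
        case True
        then show ?thesis using uc revc by (simp only: simp_thms if_True)
      next
        case False
        then have "\<not> (u ! d = w \<and> \<pi> \<in> reversed_walks n ?ks (Suc d))"
          using uniq[of d] d by blast
        then show ?thesis using False by (simp only: if_False)
      qed
    qed
    also have "\<dots> = expectation (reduced_prod n ?ks (Suc c) \<pi>)"
      using c by simp
    also have "\<dots> = 1"
      unfolding reduced_prod_def
    proof (rule expectation_prod_pairs)
      show "?l ` ({..<?k} - {0, Suc c}) \<subseteq> Idx" using edge_label_image[OF ks pi(1)] by auto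
      fix e assume e: "e \<in> {..<?k} - {0, Suc c}"
      have "?l 0 \<noteq> ?l e"
        using label_count_eq_2[OF two[of 0], of "Suc c" e] c e by auto
      then have "x \<noteq> 0" "x \<noteq> Suc c" if "?l x = ?l e" for x
        using that c(2) by metis+
      then have "{e' \<in> {..<?k} - {0, Suc c}. ?l e' = ?l e} = {b. b < ?k \<and> ?l b = ?l e}"
        by blast
      then show "card {e' \<in> {..<?k} - {0, Suc c}. ?l e' = ?l e} = 2"
        using two[of e] e by (simp add: label_count_def)
    qed simp
    finally show ?thesis using expectation_walk_prod_pairs[OF ks pair] by simp
  qed
qed

text \<open>The exact identity is summed over all walks; the error is a bounded quantity for each
  negligible walk. The two traces still stand under one expectation here; the covariance estimate
  separates them later.\<close>

theorem schwinger_dyson_asymptotic: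
  assumes w: "wigner_letter w" and u: "set u \<subseteq> K"
  shows "(\<lambda>n. expectation (normed_trace n (w # u)) -
    (\<Sum>c<length u. if u ! c = w then expectation (\<lambda>\<omega>. normed_trace n (take c u) \<omega> *
       normed_trace n (drop (Suc c) u) \<omega>) else 0)) \<longlonglongrightarrow> 0"
proof -
  let ?ks = "w # u" and ?k = "length (w # u)"
  let ?c = "\<lambda>n. real n * sqrt (real n) ^ length (w # u)"
  let ?R = "\<lambda>n c. reversed_walks n ?ks (Suc c)" and ?rp = "\<lambda>n c. reduced_prod n ?ks (Suc c)"
  have ks: "set ?ks \<subseteq> K" using w u by (auto simp: wigner_letter_def)
  define summand where "summand n \<pi> = expectation (walk_prod n ?ks \<pi>) -
    (\<Sum>c<length u. if u ! c = w \<and> \<pi> \<in> ?R n c then expectation (?rp n c \<pi>) else 0)" for n \<pi>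
  define bad where "bad n = triple_walks n ?ks \<union> (\<Union>b\<in>{1..<?k}. parallel_walks n ?ks b)" for n
  obtain C where C: "C \<ge> 1" "\<And>E (lam :: nat \<Rightarrow> 'l). finite E \<Longrightarrow> card E \<le> ?k \<Longrightarrow>
     lam ` E \<subseteq> Idx \<Longrightarrow> \<bar>expectation (\<lambda>\<omega>. \<Prod>e\<in>E. V (lam e) \<omega>)\<bar> \<le> C"
    using expectation_prod_bounded[of ?k] by blast
  define D where "D = C + real (length u) * C"
  have D: "\<bar>summand n \<pi>\<bar> \<le> D" if "\<pi> \<in> walks n ?k" for n \<pi>
  proof -
    have 1: "\<bar>expectation (walk_prod n ?ks \<pi>)\<bar> \<le> C"
      unfolding walk_prod_def using that by (intro C(2) edge_label_image ks) auto
    have 2: "\<bar>expectation (?rp n c \<pi>)\<bar> \<le> C" for c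
      unfolding reduced_prod_def using edge_label_image[OF ks that] card_mono[of "{..<?k}" "{..<?k} - {0, Suc c}"]
      by (intro C(2)) auto
    have "\<bar>\<Sum>c<length u. if u ! c = w \<and> \<pi> \<in> ?R n c then expectation (?rp n c \<pi>) else 0\<bar> \<le> (\<Sum>c<length u. C)"
      using 2 C(1) by (intro order_trans[OF sum_abs] sum_mono) auto
    then show ?thesis using 1 unfolding summand_def D_def by simp
  qed
  have bad_walks: "bad n \<subseteq> walks n ?k" for n
    by (auto simp: bad_def triple_walks_eq parallel_walks_def pair_walks_def)
  have zero: "summand n \<pi> = 0" if "\<pi> \<in> walks n ?k" "\<pi> \<notin> bad n" for n \<pi>
    using schwinger_dyson_term[OF w u that(1)] that(2) by (auto simp: summand_def bad_def)
  have eq: "expectation (normed_trace n ?ks) -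
      (\<Sum>c<length u. if u ! c = w then expectation (\<lambda>\<omega>. normed_trace n (take c u) \<omega> *
       normed_trace n (drop (Suc c) u) \<omega>) else 0) = (\<Sum>\<pi>\<in>bad n. summand n \<pi>) / ?c n" for n
  proof -
    have E1: "expectation (normed_trace n ?ks) = (\<Sum>\<pi>\<in>walks n ?k. expectation (walk_prod n ?ks \<pi>)) / ?c n"
      unfolding normed_trace_def using ks by (simp add: integrable_walk_prod del: length_Cons)
    have E2: "expectation (\<lambda>\<omega>. normed_trace n (take c u) \<omega> * normed_trace n (drop (Suc c) u) \<omega>) =
        (\<Sum>\<pi>\<in>?R n c. expectation (?rp n c \<pi>)) / ?c n" if c: "c < length u" for c
    proof -
      have "normed_trace n (take c u) \<omega> * normed_trace n (drop (Suc c) u) \<omega> =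
          (\<Sum>\<pi>\<in>?R n c. ?rp n c \<pi> \<omega>) / ?c n" for \<omega>
      proof -
        have "?k = Suc (Suc (c + (length u - Suc c)))" using c by simp
        then have cn: "?c n = (real n * sqrt (real n) ^ c) * (real n * sqrt (real n) ^ (length u - Suc c))"
          by (simp only: power_Suc power_add) simp
        have lens: "length (take c u) = c" "length (drop (Suc c) u) = length u - Suc c"
          using c by simp_all
        show ?thesis
          unfolding sum_reversed_walks[OF c] normed_trace_def lens cn by (rule times_divide_times_eq)
      qed
      moreover have "integrable M (?rp n c \<pi>)" if "\<pi> \<in> ?R n c" for \<pi>
        using that reversed_walks_subset by (intro integrable_reduced_prod ks) blast
      ultimately show ?thesis by simp
    qed
    have "(\<Sum>c<length u. if u ! c = w then expectation (\<lambda>\<omega>. normed_trace n (take c u) \<omega> *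
       normed_trace n (drop (Suc c) u) \<omega>) else 0) =
       (\<Sum>c<length u. \<Sum>\<pi>\<in>walks n ?k. if u ! c = w \<and> \<pi> \<in> ?R n c then expectation (?rp n c \<pi>) else 0) / ?c n"
      unfolding sum_divide_distrib
    proof (intro sum.cong refl)
      fix c assume c: "c \<in> {..<length u}"
      have "(\<Sum>\<pi>\<in>walks n ?k. if \<pi> \<in> ?R n c then expectation (?rp n c \<pi>) else 0) =
          (\<Sum>\<pi>\<in>?R n c. expectation (?rp n c \<pi>))"
        using reversed_walks_subset[of n ?ks "Suc c"]
        by (simp add: sum.inter_restrict[symmetric] Int_absorb1 del: length_Cons)
      then show "(if u ! c = w then expectation (\<lambda>\<omega>. normed_trace n (take c u) \<omega> *
          normed_trace n (drop (Suc c) u) \<omega>) else 0) =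
        (\<Sum>\<pi>\<in>walks n ?k. (if u ! c = w \<and> \<pi> \<in> ?R n c then expectation (?rp n c \<pi>) else 0) / ?c n)"
        using E2[of c] c by (simp add: sum_divide_distrib[symmetric] del: length_Cons)
    qed
    then have "expectation (normed_trace n ?ks) -
      (\<Sum>c<length u. if u ! c = w then expectation (\<lambda>\<omega>. normed_trace n (take c u) \<omega> *
       normed_trace n (drop (Suc c) u) \<omega>) else 0) = (\<Sum>\<pi>\<in>walks n ?k. summand n \<pi>) / ?c n"
      unfolding E1 summand_def by (subst (asm) sum.swap) (simp only: sum_subtractf diff_divide_distrib)
    also have "(\<Sum>\<pi>\<in>walks n ?k. summand n \<pi>) = (\<Sum>\<pi>\<in>bad n. summand n \<pi>)"
      using zero by (intro sum.mono_neutral_right bad_walks) (auto simp del: length_Cons)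
    finally show ?thesis .
  qed
  show ?thesis
    unfolding eq
  proof (rule Lim_null_comparison)
    let ?b = "\<lambda>n. D * (real (card (triple_walks n ?ks)) / ?c n +
      (\<Sum>b\<in>{1..<?k}. real (card (parallel_walks n ?ks b)) / ?c n))"
    show "\<forall>\<^sub>F n in sequentially. norm ((\<Sum>\<pi>\<in>bad n. summand n \<pi>) / ?c n) \<le> ?b n"
    proof (rule always_eventually, rule allI)
      fix n
      have "D \<ge> 0" using C(1) by (simp add: D_def)
      have fin: "finite (parallel_walks n ?ks b)" for b
        by (rule finite_subset[of _ "walks n ?k"]) (auto simp: parallel_walks_def pair_walks_def)
      have "card (bad n) \<le> card (triple_walks n ?ks) + card (\<Union>b\<in>{1..<?k}. parallel_walks n ?ks b)"
        unfolding bad_def by (rule card_Un_le)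
      also have "card (\<Union>b\<in>{1..<?k}. parallel_walks n ?ks b) \<le> (\<Sum>b\<in>{1..<?k}. card (parallel_walks n ?ks b))"
        by (rule card_UN_le) simp
      finally have card: "real (card (bad n)) \<le> real (card (triple_walks n ?ks)) +
          (\<Sum>b\<in>{1..<?k}. real (card (parallel_walks n ?ks b)))"
        by (simp only: of_nat_add[symmetric] of_nat_sum[symmetric] of_nat_le_iff)
      have "\<bar>\<Sum>\<pi>\<in>bad n. summand n \<pi>\<bar> \<le> (\<Sum>\<pi>\<in>bad n. D)"
        using D bad_walks by (intro order_trans[OF sum_abs] sum_mono) blast
      also have "\<dots> = D * real (card (bad n))" by simp
      also have "\<dots> \<le> D * (real (card (triple_walks n ?ks)) +
          (\<Sum>b\<in>{1..<?k}. real (card (parallel_walks n ?ks b))))"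
        using card \<open>D \<ge> 0\<close> by (rule mult_left_mono)
      finally have "\<bar>\<Sum>\<pi>\<in>bad n. summand n \<pi>\<bar> / ?c n \<le> D * (real (card (triple_walks n ?ks)) +
          (\<Sum>b\<in>{1..<?k}. real (card (parallel_walks n ?ks b)))) / ?c n"
        by (rule divide_right_mono) simp
      moreover have "norm ((\<Sum>\<pi>\<in>bad n. summand n \<pi>) / ?c n) = \<bar>\<Sum>\<pi>\<in>bad n. summand n \<pi>\<bar> / ?c n"
        by (simp only: real_norm_def abs_divide) (simp add: abs_mult)
      ultimately show "norm ((\<Sum>\<pi>\<in>bad n. summand n \<pi>) / ?c n) \<le> ?b n"
        by (simp only: sum_divide_distrib[symmetric] add_divide_distrib[symmetric] times_divide_eq_right)
    qed
    have "(\<lambda>n. \<Sum>b\<in>{1..<?k}. real (card (parallel_walks n ?ks b)) / ?c n) \<longlonglongrightarrow> (\<Sum>b\<in>{1..<?k}. 0)"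
      by (intro tendsto_sum negligible_parallel_walks ks) auto
    then have "?b \<longlonglongrightarrow> D * (0 + (\<Sum>b\<in>{1..<?k}. 0))"
      by (intro tendsto_mult_left tendsto_add negligible_triple_walks ks) auto
    then show "?b \<longlonglongrightarrow> 0" by simp
  qed
qed

end

section \<open>Lattice points in dilated polytopes\<close>

text \<open>Scaled by \<open>n\<close>, the interval \<open>(-1, 2]\<close> contains the unit cell
  ending in any vertex or label: Hankel labels reach \<open>2 * n\<close>, and the cell of
  \<open>0\<close> is \<open>(-1, 0]\<close>. Half-open cells are the fibres of the ceiling.\<close>

definition cell_measure :: "nat set \<Rightarrow> (nat \<Rightarrow> real) measure" where
  "cell_measure I = PiM I (\<lambda>_. uniform_measure lborel {-1<..2})"

definition lattice_point :: "nat set \<Rightarrow> nat \<Rightarrow> (nat \<Rightarrow> real) \<Rightarrow> nat \<Rightarrow> int" where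
  "lattice_point I n x = (\<lambda>i\<in>I. \<lceil>real n * x i\<rceil>)"

text \<open>The substitute for a description by polytopes: at the lattice point that belongs to
  \<open>n x\<close> the value stabilises for almost every \<open>x\<close>. The property survives
  arbitrary finite combinations, so that only affine inequalities have to be examined.\<close>

definition eventually_const :: "nat set \<Rightarrow> (nat \<Rightarrow> (nat \<Rightarrow> int) \<Rightarrow> 'b) \<Rightarrow> bool" where
  "eventually_const I F \<longleftrightarrow>
     (AE x in cell_measure I. \<exists>c. \<forall>\<^sub>F n in sequentially. F n (lattice_point I n x) = c)"

definition affine_form :: "nat set \<Rightarrow> (nat \<Rightarrow> (nat \<Rightarrow> int) \<Rightarrow> int) \<Rightarrow> bool" where
  "affine_form I f \<longleftrightarrow>
     (\<exists>\<alpha> c \<beta>. \<forall>n z. f n z = (\<Sum>i\<in>I. \<alpha> i * z i) + c * int n + \<beta>)"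

lemma affine_form_const: "affine_form I (\<lambda>n z. \<beta>)"
  unfolding affine_form_def by (rule exI[of _ "\<lambda>_. 0"], rule exI[of _ 0], rule exI[of _ \<beta>]) simp

lemma affine_form_dim: "affine_form I (\<lambda>n z. int n)"
  unfolding affine_form_def by (rule exI[of _ "\<lambda>_. 0"], rule exI[of _ 1], rule exI[of _ 0]) simp

lemma affine_form_var: "finite I \<Longrightarrow> j \<in> I \<Longrightarrow> affine_form I (\<lambda>n z. z j)"
  unfolding affine_form_def
  by (rule exI[of _ "\<lambda>i. if i = j then 1 else 0"], rule exI[of _ 0], rule exI[of _ 0])
    (simp add: if_distrib[of "\<lambda>a. a * _"] cong: if_cong)

lemma affine_form_add:
  assumes "affine_form I f" "affine_form I g"
  shows "affine_form I (\<lambda>n z. f n z + g n z)"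
proof -
  obtain a c b where f: "\<And>n z. f n z = (\<Sum>i\<in>I. a i * z i) + c * int n + b"
    using assms(1) unfolding affine_form_def by blast
  obtain a' c' b' where g: "\<And>n z. g n z = (\<Sum>i\<in>I. a' i * z i) + c' * int n + b'"
    using assms(2) unfolding affine_form_def by blast
  show ?thesis
    unfolding affine_form_def f g
    by (rule exI[of _ "\<lambda>i. a i + a' i"], rule exI[of _ "c + c'"], rule exI[of _ "b + b'"])
      (simp add: algebra_simps sum.distrib)
qed

lemma affine_form_cmult:
  assumes "affine_form I f"
  shows "affine_form I (\<lambda>n z. d * f n z)"
proof -
  obtain a c b where f: "\<And>n z. f n z = (\<Sum>i\<in>I. a i * z i) + c * int n + b"
    using assms(1) unfolding affine_form_def by blast
  show ?thesis
    unfolding affine_form_def f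
    by (rule exI[of _ "\<lambda>i. d * a i"], rule exI[of _ "d * c"], rule exI[of _ "d * b"])
      (simp add: algebra_simps sum_distrib_left)
qed

lemma affine_form_diff:
  "affine_form I f \<Longrightarrow> affine_form I g \<Longrightarrow> affine_form I (\<lambda>n z. f n z - g n z)"
  using affine_form_add[of I f "\<lambda>n z. - 1 * g n z"] affine_form_cmult[of I g "- 1"] by simp

lemma prob_space_unif: "prob_space (uniform_measure lborel {-1<..2 :: real})"
  by (rule prob_space_uniform_measure) auto

lemma emeasure_unif:
  "A \<in> sets borel \<Longrightarrow> A \<subseteq> {-1<..2} \<Longrightarrow> emeasure (uniform_measure lborel {-1<..2 :: real}) A = emeasure lborel A / 3"
  by (simp add: emeasure_uniform_measure Int_absorb1)

lemma emeasure_unif_singleton: "emeasure (uniform_measure lborel {-1<..2 :: real}) {a} = 0"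
proof -
  have "emeasure lborel ({-1<..2} \<inter> {a}) \<le> emeasure lborel {a}"
    by (rule emeasure_mono) auto
  then show ?thesis by (simp add: emeasure_uniform_measure)
qed

lemma product_prob_space_unif: "product_prob_space (\<lambda>_ :: nat. uniform_measure lborel {-1<..2 :: real})"
  using prob_space_unif by (simp add: product_prob_space_def product_prob_space_axioms_def
      product_sigma_finite_def prob_space_imp_sigma_finite)

text \<open>Fubini in the coordinate \<open>j\<close>: when the other coordinates are fixed, at most
  one value solves the equation, and points are null sets.\<close>

lemma AE_hyperplane:
  fixes \<alpha> :: "nat \<Rightarrow> real"
  assumes I: "finite I" "j \<in> I" "\<alpha> j \<noteq> 0"
  shows "AE x in cell_measure I. (\<Sum>i\<in>I. \<alpha> i * x i) + c \<noteq> 0"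
proof -
  let ?U = "uniform_measure lborel {-1<..2 :: real}"
  interpret product_prob_space "\<lambda>_ :: nat. ?U" by (rule product_prob_space_unif)
  define J where "J = I - {j}"
  have J: "finite J" "j \<notin> J" "I = insert j J" using I by (auto simp: J_def)
  let ?g = "\<lambda>x. (\<Sum>i\<in>I. \<alpha> i * x i) + c"
  have g: "?g \<in> borel_measurable (PiM I (\<lambda>_. ?U))"
    by measurable
  have "{x \<in> space (PiM I (\<lambda>_. ?U)). ?g x = 0} = ?g -` {0} \<inter> space (PiM I (\<lambda>_. ?U))"
    by auto
  then have sets: "{x \<in> space (PiM I (\<lambda>_. ?U)). ?g x = 0} \<in> sets (PiM I (\<lambda>_. ?U))"
    using measurable_sets[OF g, of "{0}"] by simp
  have "emeasure (PiM I (\<lambda>_. ?U)) {x \<in> space (PiM I (\<lambda>_. ?U)). ?g x = 0} =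
      (\<integral>\<^sup>+x. indicator {x \<in> space (PiM I (\<lambda>_. ?U)). ?g x = 0} x \<partial>PiM I (\<lambda>_. ?U))"
    using sets by simp
  also have "\<dots> = (\<integral>\<^sup>+x. (\<integral>\<^sup>+y. indicator {x \<in> space (PiM I (\<lambda>_. ?U)). ?g x = 0} (x(j := y)) \<partial>?U) \<partial>PiM J (\<lambda>_. ?U))"
    unfolding J(3) using J sets unfolding J(3) by (intro product_nn_integral_insert) auto
  also have "\<dots> = (\<integral>\<^sup>+x. 0 \<partial>PiM J (\<lambda>_. ?U))"
  proof (rule nn_integral_cong)
    fix x :: "nat \<Rightarrow> real"
    let ?a = "- ((\<Sum>i\<in>J. \<alpha> i * x i) + c) / \<alpha> j"
    have "(\<integral>\<^sup>+y. indicator {x \<in> space (PiM I (\<lambda>_. ?U)). ?g x = 0} (x(j := y)) \<partial>?U) \<le>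
        (\<integral>\<^sup>+y. indicator {?a} y \<partial>?U)"
    proof (rule nn_integral_mono)
      fix y
      have "?g (x(j := y)) = \<alpha> j * y + ((\<Sum>i\<in>J. \<alpha> i * x i) + c)"
        unfolding J(3) using J(1,2) by (auto simp: intro!: sum.cong)
      then show "indicator {x \<in> space (PiM I (\<lambda>_. ?U)). ?g x = 0} (x(j := y)) \<le> (indicator {?a} y :: ennreal)"
        using I(3) by (auto simp: indicator_def field_simps)
    qed
    also have "\<dots> = emeasure ?U {?a}" by simp
    finally show "(\<integral>\<^sup>+y. indicator {x \<in> space (PiM I (\<lambda>_. ?U)). ?g x = 0} (x(j := y)) \<partial>?U) = 0"
      by (simp only: emeasure_unif_singleton le_zero_eq)
  qed
  finally have "emeasure (PiM I (\<lambda>_. ?U)) {x \<in> space (PiM I (\<lambda>_. ?U)). ?g x = 0} = 0" by simp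
  then show ?thesis
    unfolding cell_measure_def using sets by (intro AE_I[where N = "{x \<in> space (PiM I (\<lambda>_. ?U)). ?g x = 0}"]) auto
qed

section \<open>Boolean combinations of affine inequalities\<close>

lemma eventually_const_triv: "eventually_const I (\<lambda>n z. c)"
  by (simp add: eventually_const_def)

lemma eventually_const_comp2:
  assumes "eventually_const I F" "eventually_const I G"
  shows "eventually_const I (\<lambda>n z. h (F n z) (G n z))"
  using assms unfolding eventually_const_def
proof eventually_elim
  case (elim x)
  then obtain c d where "\<forall>\<^sub>F n in sequentially. F n (lattice_point I n x) = c"
    "\<forall>\<^sub>F n in sequentially. G n (lattice_point I n x) = d" by blast
  then have "\<forall>\<^sub>F n in sequentially. h (F n (lattice_point I n x)) (G n (lattice_point I n x)) = h c d"
    by eventually_elim simp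
  then show ?case by blast
qed

lemmas eventually_const_conj = eventually_const_comp2[where h = "(\<and>)"]
lemmas eventually_const_disj = eventually_const_comp2[where h = "(\<or>)"]
lemmas eventually_const_iff = eventually_const_comp2[where h = "(\<longleftrightarrow>)"]

lemma eventually_const_ball:
  assumes "finite A" "\<And>a. a \<in> A \<Longrightarrow> eventually_const I (F a)"
  shows "eventually_const I (\<lambda>n z. \<forall>a\<in>A. F a n z)"
  using assms
proof (induction A rule: finite_induct)
  case (insert a A)
  then have "eventually_const I (\<lambda>n z. F a n z \<and> (\<forall>a\<in>A. F a n z))"
    by (intro eventually_const_conj) auto
  then show ?case by simp
qed (simp add: eventually_const_triv)

text \<open>Divided by \<open>n\<close>, the form tends to \<open>?L x\<close>, whose sign decides
  the inequality eventually unless it is zero. The zeros of \<open>?L\<close> form a null set,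
  except if \<open>?L\<close> vanishes identically; then the form is the constant
  \<open>b\<close>.\<close>

lemma eventually_const_le_0:
  assumes I: "finite I" and f: "affine_form I f"
  shows "eventually_const I (\<lambda>n z. f n z \<le> 0)"
proof -
  obtain a c b where f: "\<And>n z. f n z = (\<Sum>i\<in>I. a i * z i) + c * int n + b"
    using f unfolding affine_form_def by blast
  let ?L = "\<lambda>x. (\<Sum>i\<in>I. real_of_int (a i) * x i) + real_of_int c"
  have conv: "\<exists>d. \<forall>\<^sub>F n in sequentially. (f n (lattice_point I n x) \<le> 0) = d" if L: "?L x \<noteq> 0" for x
  proof -
    have ceil: "(\<lambda>n. real_of_int \<lceil>real n * y\<rceil> / real n) \<longlonglongrightarrow> y" for y
    proof (rule tendsto_sandwich)
      show "\<forall>\<^sub>F n in sequentially. y \<le> real_of_int \<lceil>real n * y\<rceil> / real n"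
        by (intro eventually_sequentiallyI[of 1]) (simp add: pos_le_divide_eq mult.commute)
      show "\<forall>\<^sub>F n in sequentially. real_of_int \<lceil>real n * y\<rceil> / real n \<le> y + 1 / real n"
      proof (intro eventually_sequentiallyI[of 1])
        fix n :: nat assume n: "1 \<le> n"
        have "real_of_int \<lceil>real n * y\<rceil> \<le> real n * y + 1" by linarith
        then have "real_of_int \<lceil>real n * y\<rceil> / real n \<le> (real n * y + 1) / real n"
          by (rule divide_right_mono) simp
        then show "real_of_int \<lceil>real n * y\<rceil> / real n \<le> y + 1 / real n"
          using n by (simp add: add_divide_distrib)
      qed
      have "(\<lambda>n. y + 1 / real n) \<longlonglongrightarrow> y + 0" by (intro tendsto_intros lim_const_over_n)
      then show "(\<lambda>n. y + 1 / real n) \<longlonglongrightarrow> y" by simp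
    qed simp
    have "(\<lambda>n. (\<Sum>i\<in>I. real_of_int (a i) * (real_of_int \<lceil>real n * x i\<rceil> / real n)) + real_of_int c + real_of_int b / real n)
        \<longlonglongrightarrow> (\<Sum>i\<in>I. real_of_int (a i) * x i) + real_of_int c + 0"
      by (intro tendsto_intros ceil lim_const_over_n)
    moreover have "\<forall>\<^sub>F n in sequentially. (\<Sum>i\<in>I. real_of_int (a i) * (real_of_int \<lceil>real n * x i\<rceil> / real n)) +
        real_of_int c + real_of_int b / real n = real_of_int (f n (lattice_point I n x)) / real n"
      by (intro eventually_sequentiallyI[of 1])
        (simp add: f lattice_point_def add_divide_distrib sum_divide_distrib)
    ultimately have lim: "(\<lambda>n. real_of_int (f n (lattice_point I n x)) / real n) \<longlonglongrightarrow> ?L x"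
      by (simp add: filterlim_cong)
    show ?thesis
    proof (cases "?L x > 0")
      case True
      have "\<forall>\<^sub>F n in sequentially. (f n (lattice_point I n x) \<le> 0) = False"
        using order_tendstoD(1)[OF lim True] by eventually_elim (auto simp: zero_less_divide_iff)
      then show ?thesis by blast
    next
      case False
      then have "?L x < 0" using L by simp
      have "\<forall>\<^sub>F n in sequentially. (f n (lattice_point I n x) \<le> 0) = True"
        using order_tendstoD(2)[OF lim \<open>?L x < 0\<close>] by eventually_elim (auto simp: divide_less_0_iff)
      then show ?thesis by blast
    qed
  qed
  consider (var) j where "j \<in> I" "a j \<noteq> 0" | (dim) "\<forall>i\<in>I. a i = 0" "c \<noteq> 0" | (const) "\<forall>i\<in>I. a i = 0" "c = 0"
    by blast
  then show ?thesis
  proof cases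
    case var
    then show ?thesis
      unfolding eventually_const_def
      using AE_hyperplane[OF I var(1), of "\<lambda>i. real_of_int (a i)" "real_of_int c"] conv by (auto elim!: AE_mp)
  next
    case dim
    then have "?L x \<noteq> 0" for x by simp
    then show ?thesis unfolding eventually_const_def using conv by auto
  next
    case const
    then have "(\<lambda>n z. f n z \<le> 0) = (\<lambda>n z. b \<le> 0)" by (auto simp: f fun_eq_iff)
    then show ?thesis by (simp add: eventually_const_triv)
  qed
qed

lemma eventually_const_le:
  "finite I \<Longrightarrow> affine_form I f \<Longrightarrow> affine_form I g \<Longrightarrow> eventually_const I (\<lambda>n z. f n z \<le> g n z)"
  using eventually_const_le_0[of I "\<lambda>n z. f n z - g n z"] affine_form_diff[of I f g] by simp

lemma eventually_const_less:
  assumes "finite I" "affine_form I f" "affine_form I g"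
  shows "eventually_const I (\<lambda>n z. f n z < g n z)"
proof -
  have "eventually_const I (\<lambda>n z. f n z + 1 \<le> g n z)"
    by (intro eventually_const_le assms affine_form_add affine_form_const)
  then show ?thesis by (simp add: zless_iff_Suc_zadd add1_zle_eq)
qed

lemma eventually_const_eq:
  assumes "finite I" "affine_form I f" "affine_form I g"
  shows "eventually_const I (\<lambda>n z. f n z = g n z)"
proof -
  have "eventually_const I (\<lambda>n z. f n z \<le> g n z \<and> g n z \<le> f n z)"
    by (intro eventually_const_conj eventually_const_le assms)
  then show ?thesis by (simp add: eq_iff)
qed

text \<open>Up to the factor \<open>3 ^ card I\<close> from the uniform measure, the normalised sum
  is the integral of the step function with value \<open>N n z\<close> on the cell of
  \<open>z\<close>. Almost everywhere this function is eventually constant in \<open>n\<close>, and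
  it is bounded by \<open>B\<close>, so dominated convergence applies.\<close>

theorem lattice_sum_convergent:
  fixes N :: "nat \<Rightarrow> (nat \<Rightarrow> int) \<Rightarrow> nat"
  assumes I: "finite I" "I \<noteq> {}" and N: "eventually_const I N" and B: "\<And>n z. N n z \<le> B"
  shows "convergent (\<lambda>n. real (\<Sum>z\<in>I \<rightarrow>\<^sub>E {- int n<..2 * int n}. N n z) / real n ^ card I)"
proof -
  let ?U = "uniform_measure lborel {-1<..2 :: real}"
  interpret product_prob_space "\<lambda>_ :: nat. ?U" by (rule product_prob_space_unif)
  let ?M = "cell_measure I" and ?R = "\<lambda>n. I \<rightarrow>\<^sub>E {- int n<..2 * int n}"
  interpret cell: prob_space ?M unfolding cell_measure_def by (rule prob_space_PiM[OF prob_space_unif])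
  let ?cell = "\<lambda>n z. {(real_of_int z - 1) / real n<..real_of_int z / real n}"
  define G where "G n x = (\<Sum>z\<in>?R n. real (N n z) * (\<Prod>i\<in>I. indicator (?cell n (z i)) (x i)))" for n x
  have finR: "finite (?R n)" for n using I by (intro finite_PiE) auto
  have meas: "G n \<in> borel_measurable ?M" for n
    unfolding G_def cell_measure_def by measurable
  have cellU: "emeasure ?U (?cell n z) = ennreal (1 / (3 * real n))" if "n > 0" "z \<in> {- int n<..2 * int n}" for n z
  proof -
    have "emeasure ?U (?cell n z) = emeasure lborel (?cell n z) / 3"
    proof (rule emeasure_unif)
      show "?cell n z \<subseteq> {-1<..2}"
      proof
        fix u assume u: "u \<in> ?cell n z"
        have "- real n \<le> real_of_int z - 1" "real_of_int z \<le> 2 * real n" using that(2) by auto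
        then have "- 1 \<le> (real_of_int z - 1) / real n" "real_of_int z / real n \<le> 2"
          using that(1) by (auto simp: field_simps)
        then show "u \<in> {-1<..2}" using u by auto
      qed
    qed simp
    also have "emeasure lborel (?cell n z) = ennreal (1 / real n)"
      using that(1) by (simp add: diff_divide_distrib[symmetric] divide_right_mono)
    also have "ennreal (1 / real n) / 3 = ennreal (1 / (3 * real n))"
      using that(1) by (simp add: ennreal_divide_numeral)
    finally show ?thesis .
  qed
  have intG: "(\<integral>x. G n x \<partial>?M) = real (\<Sum>z\<in>?R n. N n z) / real n ^ card I / 3 ^ card I" if n: "n > 0" for n
  proof -
    have one: "integrable ?U (indicator (?cell n (z i)) :: real \<Rightarrow> real)"
      "(\<integral>u. indicator (?cell n (z i)) u \<partial>?U) = 1 / (3 * real n)" if "z \<in> ?R n" "i \<in> I" for z i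
    proof -
      have zi: "z i \<in> {- int n<..2 * int n}" using that by (auto simp: PiE_iff)
      show "integrable ?U (indicator (?cell n (z i)) :: real \<Rightarrow> real)"
        using cellU[OF n zi] by (intro integrable_real_indicator) (auto simp: less_top[symmetric])
      show "(\<integral>u. indicator (?cell n (z i)) u \<partial>?U) = 1 / (3 * real n)"
        using cellU[OF n zi] by (simp add: measure_def)
    qed
    have "(\<integral>x. (\<Prod>i\<in>I. indicator (?cell n (z i)) (x i) :: real) \<partial>?M) = (1 / (3 * real n)) ^ card I"
      if z: "z \<in> ?R n" for z
    proof -
      have "(\<integral>x. (\<Prod>i\<in>I. indicator (?cell n (z i)) (x i) :: real) \<partial>?M) =
          (\<Prod>i\<in>I. \<integral>u. indicator (?cell n (z i)) u \<partial>?U)"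
        unfolding cell_measure_def using one(1)[OF z] by (intro product_integral_prod[OF I(1)])
      also have "\<dots> = (\<Prod>i\<in>I. 1 / (3 * real n))"
        by (intro prod.cong refl one(2)[OF z])
      also have "\<dots> = (1 / (3 * real n)) ^ card I" by (rule prod_constant)
      finally show ?thesis .
    qed
    moreover have "integrable ?M (\<lambda>x. \<Prod>i\<in>I. indicator (?cell n (z i)) (x i) :: real)" if z: "z \<in> ?R n" for z
      unfolding cell_measure_def using one(1)[OF z] by (intro product_integrable_prod[OF I(1)]) auto
    ultimately have "(\<integral>x. G n x \<partial>?M) = (\<Sum>z\<in>?R n. real (N n z) * (1 / (3 * real n)) ^ card I)"
      unfolding G_def by simp
    also have "\<dots> = real (\<Sum>z\<in>?R n. N n z) * (1 / (3 * real n)) ^ card I"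
      by (simp add: sum_distrib_right)
    finally show ?thesis by (simp add: power_divide power_mult_distrib mult.commute)
  qed
  have AE_cube: "AE x in ?M. \<forall>i\<in>I. x i \<in> {-1<..2}"
  proof (rule AE_finite_allI[OF I(1)])
    fix i assume "i \<in> I"
    have "AE u in ?U. u \<in> {-1<..2}" by (rule AE_uniform_measureI) auto
    then show "AE x in ?M. x i \<in> {-1<..2}"
      unfolding cell_measure_def by (intro AE_PiM_component prob_space_unif \<open>i \<in> I\<close>)
  qed
  have G_eq: "G n x = real (N n (lattice_point I n x))" if n: "n > 0" and x: "\<forall>i\<in>I. x i \<in> {-1<..2}" for n x
  proof -
    let ?z = "lattice_point I n x"
    have cell: "x i \<in> ?cell n m \<longleftrightarrow> m = \<lceil>real n * x i\<rceil>" for i m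
    proof -
      have "x i \<in> ?cell n m \<longleftrightarrow> real_of_int m - 1 < real n * x i \<and> real n * x i \<le> real_of_int m"
        using n by (auto simp: field_simps)
      also have "\<dots> \<longleftrightarrow> m = \<lceil>real n * x i\<rceil>" unfolding ceiling_eq_iff[symmetric] by (rule eq_commute)
      finally show ?thesis .
    qed
    have z: "?z \<in> ?R n"
    proof (rule PiE_I)
      fix i assume i: "i \<in> I"
      have "real n * -1 < real n * x i" "real n * x i \<le> real n * 2"
        using x i n mult_strict_left_mono[of "- 1" "x i" "real n"] mult_left_mono[of "x i" 2 "real n"]
        by auto
      then have "- int n < \<lceil>real n * x i\<rceil>" "\<lceil>real n * x i\<rceil> \<le> 2 * int n"
        using x i by (auto simp: less_ceiling_iff ceiling_le_iff)
      then show "?z i \<in> {- int n<..2 * int n}" using i by (simp add: lattice_point_def)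
    qed (simp add: lattice_point_def)
    have "(\<Prod>i\<in>I. indicator (?cell n (z i)) (x i)) = (if z = ?z then 1 else 0 :: real)" if zR: "z \<in> ?R n" for z
    proof (cases "z = ?z")
      case True
      then show ?thesis using cell by (auto simp: lattice_point_def intro!: prod.neutral)
    next
      case False
      then obtain i where "i \<in> I" "z i \<noteq> ?z i" using PiE_ext[OF zR z] by blast
      then have "indicator (?cell n (z i)) (x i) = (0 :: real)"
        using cell[of i "z i"] by (simp only: lattice_point_def indicator_simps restrict_apply') simp
      then show ?thesis using False \<open>i \<in> I\<close> I(1) by (simp only: if_False) (rule prod_zero, auto)
    qed
    then have "G n x = (\<Sum>z\<in>?R n. if z = ?z then real (N n z) else 0)"
      unfolding G_def by (intro sum.cong) auto
    then show ?thesis using z finR by simp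
  qed
  have conv: "AE x in ?M. convergent (\<lambda>n. G n x)"
    using N AE_cube unfolding eventually_const_def
  proof eventually_elim
    case (elim x)
    then obtain c where "\<forall>\<^sub>F n in sequentially. N n (lattice_point I n x) = c" by blast
    then have "\<forall>\<^sub>F n in sequentially. G n x = real c"
      using eventually_gt_at_top[of "0 :: nat"]
      by eventually_elim (simp only: G_eq[OF _ elim(2)])
    then show ?case by (intro convergentI[of _ "real c"] tendsto_eventually)
  qed
  have "(\<lambda>n. \<integral>x. G n x \<partial>?M) \<longlonglongrightarrow> (\<integral>x. Topological_Spaces.lim (\<lambda>n. G n x) \<partial>?M)"
  proof (rule integral_dominated_convergence)
    show "(\<lambda>x. Topological_Spaces.lim (\<lambda>n. G n x)) \<in> borel_measurable ?M"
      by (rule borel_measurable_lim_metric[OF meas])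
    show "AE x in ?M. (\<lambda>n. G n x) \<longlonglongrightarrow> Topological_Spaces.lim (\<lambda>n. G n x)"
      using conv by eventually_elim (simp add: convergent_LIMSEQ_iff)
    show "integrable ?M (\<lambda>x. real B)" by simp
    show "AE x in ?M. norm (G n x) \<le> real B" for n
    \<comment> \<open>In dimension zero the range of summation is empty and the step function is
      zero.\<close>
    proof (cases "n = 0")
      case True
      then have "?R n = {}" using I(2) by (simp add: PiE_eq_empty_iff ex_in_conv)
      then show ?thesis by (simp add: G_def)
    next
      case False
      show ?thesis using AE_cube by eventually_elim (use False B in \<open>simp add: G_eq\<close>)
    qed
  qed (rule meas)
  then have "(\<lambda>n. 3 ^ card I * (\<integral>x. G n x \<partial>?M)) \<longlonglongrightarrow> 3 ^ card I * (\<integral>x. Topological_Spaces.lim (\<lambda>n. G n x) \<partial>?M)"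
    by (rule tendsto_mult_left)
  moreover have "\<forall>\<^sub>F n in sequentially. 3 ^ card I * (\<integral>x. G n x \<partial>?M) = real (\<Sum>z\<in>?R n. N n z) / real n ^ card I"
    using eventually_gt_at_top[of 0] by eventually_elim (simp add: intG)
  ultimately show ?thesis
    by (intro convergentI) (rule Lim_transform_eventually)
qed

section \<open>Closed walks with prescribed coincidences of labels\<close>

definition pattern_links :: "(nat \<Rightarrow> nat \<Rightarrow> nat \<Rightarrow> int) set" where
  "pattern_links = {toeplitz_link, hankel_link, symmetric_circulant_link, reverse_circulant_link}"

lemma symmetric_circulant_link_eq:
  "symmetric_circulant_link n i j = min \<bar>int i - int j\<bar> (int n - \<bar>int i - int j\<bar>)"
proof -
  have "real n / 2 - \<bar>real n / 2 - \<bar>real i - real j\<bar>\<bar> =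
      real_of_int (min \<bar>int i - int j\<bar> (int n - \<bar>int i - int j\<bar>))"
    by (auto simp: min_def abs_if)
  then show ?thesis unfolding symmetric_circulant_link_def by simp
qed

text \<open>Given one end of an edge and its label \<open>t\<close>, the other end is one of finitely many affine forms
  in that end, \<open>t\<close> and the dimension.\<close>

definition branches :: "(int \<times> int \<times> int \<times> int) set" where
  "branches = {- 1, 1} \<times> {- 1, 1} \<times> {- 1..2} \<times> {- 2, 0}"

definition branch_step :: "int \<times> int \<times> int \<times> int \<Rightarrow> nat \<Rightarrow> int \<Rightarrow> int \<Rightarrow> int" where
  "branch_step = (\<lambda>(e, e', c, b) n v t. e * v + e' * t + c * int n + b)"

lemma div_in_0_2:
  fixes m n :: int
  assumes "0 \<le> m" "m \<le> 2 * n" "0 < n"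
  shows "m div n \<in> {0..2}"
  using zdiv_mono1[OF assms(2,3)] assms by (simp add: pos_imp_zdiv_nonneg_iff)

text \<open>Each link is solved for the second vertex. The constant \<open>- 2\<close> stems from
  the two index shifts in \<open>i + j\<close>, the coefficient of \<open>n\<close> from the
  quotient 0, 1 or 2 of \<open>i + j\<close> by \<open>n\<close> or from a circulant step that wraps
  around in one of the two directions.\<close>

lemma link_branch:
  assumes l: "l \<in> pattern_links" and v: "v < n" "v' < n"
  shows "\<exists>b\<in>branches. int v' = branch_step b n (int v) (l n (Suc v) (Suc v'))"
proof -
  consider "l = toeplitz_link" | "l = hankel_link" | "l = symmetric_circulant_link" | "l = reverse_circulant_link"
    using l by (auto simp: pattern_links_def)
  then show ?thesis
  proof cases
    case 1
    then show ?thesis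
      by (intro bexI[of _ "(1, if v \<le> v' then 1 else - 1, 0, 0)"])
        (auto simp: toeplitz_link_def branch_step_def branches_def)
  next
    case 2
    then show ?thesis
      by (intro bexI[of _ "(- 1, 1, 0, - 2)"]) (auto simp: hankel_link_def branch_step_def branches_def)
  next
    case 3
    define d where "d = \<bar>int v - int v'\<bar>"
    have lab: "l n (Suc v) (Suc v') = min d (int n - d)"
      by (simp add: 3 symmetric_circulant_link_eq d_def)
    show ?thesis
      unfolding lab
      by (intro bexI[of _ "(1, if (v \<le> v') = (d \<le> int n - d) then 1 else - 1,
          if d \<le> int n - d then 0 else if v \<le> v' then 1 else - 1, 0)"])
        (auto simp: branch_step_def branches_def d_def min_def)
  next
    case 4
    let ?m = "int v + int v' + 2"
    have "?m div int n \<in> {0..2}" using v by (intro div_in_0_2) auto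
    moreover have "int v' = branch_step (- 1, 1, ?m div int n, - 2) n (int v) (l n (Suc v) (Suc v'))"
      using div_mult_mod_eq[of ?m "int n"] by (simp add: 4 reverse_circulant_link_def branch_step_def algebra_simps)
    ultimately show ?thesis
      by (intro bexI[of _ "(- 1, 1, ?m div int n, - 2)"]) (auto simp: branches_def)
  qed
qed

lemma link_bounds:
  assumes "l \<in> pattern_links" "v < n" "v' < n"
  shows "l n (Suc v) (Suc v') \<in> {- int n<..2 * int n}"
proof (cases "l = reverse_circulant_link")
  case True
  have "0 < int n" using assms by simp
  then have "0 \<le> (int (Suc v) + int (Suc v')) mod int n" "(int (Suc v) + int (Suc v')) mod int n < int n"
    by (rule pos_mod_sign, rule pos_mod_bound)
  then show ?thesis
    unfolding True reverse_circulant_link_def greaterThanAtMost_iff by linarith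
next
  case False
  then show ?thesis
    using assms
    by (auto simp: pattern_links_def toeplitz_link_def hankel_link_def symmetric_circulant_link_eq
        min_def abs_if)
qed

text \<open>This and the next three equivalences resolve absolute value, minimum and remainder into
  Boolean combinations of affine conditions on \<open>v\<close>, \<open>v'\<close>, \<open>t\<close>
  and \<open>n\<close>.\<close>

lemma toeplitz_link_iff:
  "0 \<le> v \<Longrightarrow> 0 \<le> v' \<Longrightarrow> toeplitz_link n (Suc (nat v)) (Suc (nat v')) = t \<longleftrightarrow>
     0 \<le> t \<and> (v - v' = t \<or> v' - v = t)"
  by (auto simp: toeplitz_link_def)

lemma hankel_link_iff:
  "0 \<le> v \<Longrightarrow> 0 \<le> v' \<Longrightarrow> hankel_link n (Suc (nat v)) (Suc (nat v')) = t \<longleftrightarrow> v + v' + 2 = t"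
  by (auto simp: hankel_link_def)

lemma symmetric_circulant_link_iff:
  "0 \<le> v \<Longrightarrow> 0 \<le> v' \<Longrightarrow> symmetric_circulant_link n (Suc (nat v)) (Suc (nat v')) = t \<longleftrightarrow>
     (v' \<le> v \<and> (2 * (v - v') \<le> int n \<and> t = v - v' \<or> int n < 2 * (v - v') \<and> t = int n - (v - v'))) \<or>
     (v < v' \<and> (2 * (v' - v) \<le> int n \<and> t = v' - v \<or> int n < 2 * (v' - v) \<and> t = int n - (v' - v)))"
  by (cases "v' \<le> v") (auto simp: symmetric_circulant_link_eq min_def abs_if)

lemma reverse_circulant_link_iff:
  assumes "0 \<le> v" "0 \<le> v'" "v < int n" "v' < int n"
  shows "reverse_circulant_link n (Suc (nat v)) (Suc (nat v')) = t \<longleftrightarrow>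
     0 \<le> t \<and> t < int n \<and> (v + v' + 2 = t \<or> v + v' + 2 = t + int n \<or> v + v' + 2 = t + 2 * int n)"
proof -
  let ?m = "v + v' + 2"
  have lab: "reverse_circulant_link n (Suc (nat v)) (Suc (nat v')) = ?m mod int n"
    using assms by (simp add: reverse_circulant_link_def add.commute add.left_commute)
  have n: "int n > 0" using assms by simp
  show ?thesis
  proof
    assume "reverse_circulant_link n (Suc (nat v)) (Suc (nat v')) = t"
    then have t: "t = ?m mod int n" by (simp add: lab)
    define q where "q = ?m div int n"
    have m: "?m = q * int n + t" by (simp add: q_def t)
    have b: "0 \<le> t" "t < int n" using n by (simp_all add: t)
    have "q \<in> {0..2}" unfolding q_def using assms by (intro div_in_0_2) auto
    then have "q = 0 \<or> q = 1 \<or> q = 2" by auto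
    then show "0 \<le> t \<and> t < int n \<and> (?m = t \<or> ?m = t + int n \<or> ?m = t + 2 * int n)"
      using m b by auto
  next
    assume *: "0 \<le> t \<and> t < int n \<and> (?m = t \<or> ?m = t + int n \<or> ?m = t + 2 * int n)"
    then have "?m mod int n = t mod int n" by auto
    also have "\<dots> = t" using * by (intro mod_pos_pos_trivial) auto
    finally show "reverse_circulant_link n (Suc (nat v)) (Suc (nat v')) = t" by (simp add: lab)
  qed
qed

text \<open>The range condition is part of the predicate because the affine descriptions of the
  links are available only inside the range: \<open>nat\<close> truncates negative values.\<close>

lemma eventually_const_link:
  assumes I: "finite I" and l: "l \<in> pattern_links"
    and aff: "affine_form I v" "affine_form I v'" "affine_form I t"
  shows "eventually_const I (\<lambda>n z. (0 \<le> v n z \<and> v n z < int n \<and> 0 \<le> v' n z \<and> v' n z < int n) \<and>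
    l n (Suc (nat (v n z))) (Suc (nat (v' n z))) = t n z)"
proof -
  note rules = eventually_const_conj eventually_const_disj eventually_const_le eventually_const_less
    eventually_const_eq I aff affine_form_add affine_form_diff affine_form_cmult affine_form_const affine_form_dim
  let ?R = "\<lambda>n z. 0 \<le> v n z \<and> v n z < int n \<and> 0 \<le> v' n z \<and> v' n z < int n"
  have red: ?thesis if "\<And>n z. ?R n z \<Longrightarrow> (l n (Suc (nat (v n z))) (Suc (nat (v' n z))) = t n z) = Q n z"
    "eventually_const I (\<lambda>n z. ?R n z \<and> Q n z)" for Q
  proof -
    have "(\<lambda>n z. ?R n z \<and> l n (Suc (nat (v n z))) (Suc (nat (v' n z))) = t n z) = (\<lambda>n z. ?R n z \<and> Q n z)"
      using that(1) by blast
    then show ?thesis using that(2) by simp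
  qed
  consider "l = toeplitz_link" | "l = hankel_link" | "l = symmetric_circulant_link" | "l = reverse_circulant_link"
    using l by (auto simp: pattern_links_def)
  then show ?thesis
  proof cases
    case 1
    show ?thesis
    proof (rule red)
      show "eventually_const I (\<lambda>n z. ?R n z \<and>
        (0 \<le> t n z \<and> (v n z - v' n z = t n z \<or> v' n z - v n z = t n z)))"
        by (intro rules)
    qed (simp add: 1 toeplitz_link_iff)
  next
    case 2
    show ?thesis
    proof (rule red)
      show "eventually_const I (\<lambda>n z. ?R n z \<and> v n z + v' n z + 2 = t n z)"
        by (intro rules)
    qed (simp add: 2 hankel_link_iff)
  next
    case 3
    show ?thesis
    proof (rule red)
      show "eventually_const I (\<lambda>n z. ?R n z \<and>
        ((v' n z \<le> v n z \<and> (2 * (v n z - v' n z) \<le> int n \<and> t n z = v n z - v' n z \<or>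
            int n < 2 * (v n z - v' n z) \<and> t n z = int n - (v n z - v' n z))) \<or>
         (v n z < v' n z \<and> (2 * (v' n z - v n z) \<le> int n \<and> t n z = v' n z - v n z \<or>
            int n < 2 * (v' n z - v n z) \<and> t n z = int n - (v' n z - v n z)))))"
        by (intro rules)
    qed (simp only: 3 symmetric_circulant_link_iff)
  next
    case 4
    show ?thesis
    proof (rule red)
      show "eventually_const I (\<lambda>n z. ?R n z \<and>
        (0 \<le> t n z \<and> t n z < int n \<and> (v n z + v' n z + 2 = t n z \<or>
           v n z + v' n z + 2 = t n z + int n \<or> v n z + v' n z + 2 = t n z + 2 * int n)))"
        by (intro rules)
    qed (simp only: 4 reverse_circulant_link_iff)
  qed
qed

section \<open>Walks as functions of start, labels and branches\<close>

text \<open>The values of the label classes are stored in \<open>z\<close>, with the start vertex in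
  slot \<open>k\<close>. Classes are numbered below \<open>k\<close> later, so the slots do not
  collide.\<close>

primrec branch_walk :: "(nat \<Rightarrow> nat) \<Rightarrow> nat \<Rightarrow> nat \<Rightarrow> (nat \<Rightarrow> int) \<Rightarrow>
    (nat \<Rightarrow> int \<times> int \<times> int \<times> int) \<Rightarrow> nat \<Rightarrow> int" where
  "branch_walk f k n z s 0 = z k"
| "branch_walk f k n z s (Suc a) = branch_step (s a) n (branch_walk f k n z s a) (z (f a))"

lemma affine_form_branch_walk:
  assumes I: "finite I" "k \<in> I" and f: "\<And>a. a < k \<Longrightarrow> f a \<in> I" and "a \<le> k"
  shows "affine_form I (\<lambda>n z. branch_walk f k n z s a)"
  using assms(4)
proof (induction a)
  case 0
  then show ?case using I by (simp add: affine_form_var)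
next
  case (Suc a)
  obtain e e' c b where s: "s a = (e, e', c, b)" by (cases "s a")
  have "affine_form I (\<lambda>n z. e * branch_walk f k n z s a + e' * z (f a) + c * int n + b)"
    using Suc f I by (intro affine_form_add affine_form_cmult affine_form_var affine_form_dim affine_form_const) auto
  then show ?case by (simp add: s branch_step_def)
qed

lemma eventually_const_restrict:
  assumes "finite S" "\<And>s. s \<in> S \<Longrightarrow> eventually_const I (F s)"
  shows "eventually_const I (\<lambda>n z. \<lambda>s\<in>S. F s n z)"
  using assms
proof (induction S rule: finite_induct)
  case (insert s S)
  have "eventually_const I (\<lambda>n z. (\<lambda>s\<in>S. F s n z)(s := F s n z))"
  proof (rule eventually_const_comp2[where h = "\<lambda>g v. g(s := v)"])
    show "eventually_const I (\<lambda>n z. \<lambda>s\<in>S. F s n z)"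
      by (rule insert.IH) (rule insert.prems, simp)
    show "eventually_const I (F s)" by (rule insert.prems) simp
  qed
  moreover have "(\<lambda>r\<in>insert s S. F r n z) = (\<lambda>r\<in>S. F r n z)(s := F s n z)" for n z
    by (auto simp: fun_eq_iff)
  ultimately show ?case by (simp only:)
qed (simp add: eventually_const_triv restrict_def)

text \<open>The size of an image depends only on which arguments have equal values, hence on
  finitely many truth values if \<open>E\<close> is finite.\<close>

lemma card_image_kernel:
  "card (g ` E) = card ((\<lambda>s. {s' \<in> E. g s' = g s}) ` E)"
proof -
  have "(\<lambda>s. {s' \<in> E. g s' = g s}) ` E = (\<lambda>t. {s' \<in> E. g s' = t}) ` g ` E" by auto
  moreover have "inj_on (\<lambda>t. {s' \<in> E. g s' = t}) (g ` E)"
    by (rule inj_onI) blast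
  ultimately show ?thesis by (simp add: card_image)
qed

text \<open>\<open>f\<close> numbers the classes of equal labels, and \<open>same\<close> tells
  whether two edges belong to the same matrix. For fixed \<open>z\<close>, that is, start and label
  values, the walks are among finitely many branch walks, and the number of distinct valid ones is a
  function of eventually constant predicates. The sum over \<open>z\<close> brings one power of
  \<open>n\<close> for each class and one for the start.\<close>

theorem pattern_walk_count:
  fixes f :: "nat \<Rightarrow> nat" and lk :: "nat \<Rightarrow> nat \<Rightarrow> nat \<Rightarrow> nat \<Rightarrow> int" and same :: "nat \<Rightarrow> nat \<Rightarrow> bool"
  assumes lk: "\<And>a. a < k \<Longrightarrow> lk a \<in> pattern_links" and f: "\<And>a. a < k \<Longrightarrow> f a < k"
  shows "convergent (\<lambda>n. real (card {\<pi> \<in> walks n k. \<forall>a<k. \<forall>b<k.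
      (same a b \<and> lk a n (Suc (\<pi> a)) (Suc (\<pi> (Suc a))) = lk b n (Suc (\<pi> b)) (Suc (\<pi> (Suc b)))) \<longleftrightarrow> f a = f b}) /
    real n ^ Suc (card (f ` {..<k})))"
proof -
  define el where "el n \<pi> a = lk a n (Suc (\<pi> a)) (Suc (\<pi> (Suc a)))" for n \<pi> a
  let ?C = "\<lambda>n. {\<pi> \<in> walks n k. \<forall>a<k. \<forall>b<k. (same a b \<and> el n \<pi> a = el n \<pi> b) \<longleftrightarrow> f a = f b}"
  define I where "I = insert k (f ` {..<k})"
  have I: "finite I" "I \<noteq> {}" "k \<in> I" by (auto simp: I_def)
  have fI: "f a \<in> I" if "a < k" for a using that by (simp add: I_def)
  have "k \<notin> f ` {..<k}" using f by force
  then have cardI: "card I = Suc (card (f ` {..<k}))" by (simp add: I_def)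
  define good where "good z \<longleftrightarrow> (\<forall>a\<in>{..<k}. \<forall>b\<in>{..<k}. (same a b \<and> z (f a) = z (f b)) \<longleftrightarrow> f a = f b)"
    for z :: "nat \<Rightarrow> int"
  define W where "W n z = {\<pi> \<in> walks n k. int (\<pi> 0) = z k \<and> (\<forall>a<k. el n \<pi> a = z (f a)) \<and> good z}" for n z
  let ?R = "\<lambda>n. I \<rightarrow>\<^sub>E {- int n<..2 * int n}"
  have finW: "finite (W n z)" for n z by (simp add: W_def)
  have C_eq: "?C n = (\<Union>z\<in>?R n. W n z)" for n
  proof (intro equalityI subsetI)
    fix \<pi> assume pi: "\<pi> \<in> ?C n"
    then have walk: "\<pi> \<in> walks n k" by simp
    define z where "z = (\<lambda>i\<in>I. if i = k then int (\<pi> 0) else el n \<pi> (SOME a. a < k \<and> f a = i))"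
    have zf: "z (f a) = el n \<pi> a" if a: "a < k" for a
    proof -
      let ?a = "SOME b. b < k \<and> f b = f a"
      have "?a < k \<and> f ?a = f a" by (rule someI[of _ a]) (simp add: a)
      then have "el n \<pi> ?a = el n \<pi> a" using pi a by blast
      moreover have "f a \<noteq> k" using f[OF a] by simp
      ultimately show ?thesis using fI[OF a] by (simp add: z_def)
    qed
    have zk: "z k = int (\<pi> 0)" using I by (simp add: z_def)
    have "z \<in> ?R n"
    proof (rule PiE_I)
      fix i assume "i \<in> I"
      then consider "i = k" | a where "a < k" "i = f a" by (auto simp: I_def)
      then show "z i \<in> {- int n<..2 * int n}"
      proof cases
        case 1
        then show ?thesis using walks_less[OF walk, of 0] by (simp add: zk)
      next
        case 2
        then show ?thesis
          using link_bounds[OF lk[OF 2(1)] walks_less[OF walk, of a] walks_less[OF walk, of "Suc a"]] zf[OF 2(1)]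
          by (simp add: el_def)
      qed
    qed (simp add: z_def)
    moreover have "\<pi> \<in> W n z"
      using pi zf zk by (simp add: W_def good_def)
    ultimately show "\<pi> \<in> (\<Union>z\<in>?R n. W n z)" by blast
  next
    fix \<pi> assume "\<pi> \<in> (\<Union>z\<in>?R n. W n z)"
    then obtain z where z: "\<pi> \<in> walks n k" "\<And>a. a < k \<Longrightarrow> el n \<pi> a = z (f a)" "good z"
      by (auto simp: W_def)
    have "(same a b \<and> el n \<pi> a = el n \<pi> b) \<longleftrightarrow> f a = f b" if "a < k" "b < k" for a b
      using z(3) that unfolding good_def z(2)[OF that(1)] z(2)[OF that(2)] by simp
    then show "\<pi> \<in> ?C n" using z(1) by simp
  qed
  have disj: "W n z \<inter> W n z' = {}" if "z \<in> ?R n" "z' \<in> ?R n" "z \<noteq> z'" for n z z'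
  proof (rule ccontr)
    assume "W n z \<inter> W n z' \<noteq> {}"
    then obtain \<pi> where pi: "\<pi> \<in> W n z" "\<pi> \<in> W n z'" by blast
    have "z i = z' i" if "i \<in> I" for i
      using that pi by (auto simp: I_def W_def)
    then show False using PiE_ext[OF that(1,2)] that(3) by blast
  qed
  have card_C: "card (?C n) = (\<Sum>z\<in>?R n. card (W n z))" for n
    unfolding C_eq using I disj finW by (intro card_UN_disjoint) (auto intro!: finite_PiE)
  define S where "S = {..<k} \<rightarrow>\<^sub>E branches"
  have finS: "finite S" unfolding S_def by (intro finite_PiE) (auto simp: branches_def)
  let ?w = "\<lambda>n z s. branch_walk f k n z s"
  define valid where "valid s n z \<longleftrightarrow>
    (\<forall>a\<in>{..<k}. (0 \<le> ?w n z s a \<and> ?w n z s a < int n \<and> 0 \<le> ?w n z s (Suc a) \<and> ?w n z s (Suc a) < int n) \<and>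
       lk a n (Suc (nat (?w n z s a))) (Suc (nat (?w n z s (Suc a)))) = z (f a)) \<and>
    (0 \<le> ?w n z s 0 \<and> ?w n z s 0 < int n) \<and> ?w n z s k = ?w n z s 0 \<and> good z" for s n z
  define eq where "eq p n z \<longleftrightarrow> (\<forall>a\<in>{..k}. ?w n z (fst p) a = ?w n z (snd p) a)"
    for p :: "(nat \<Rightarrow> int \<times> int \<times> int \<times> int) \<times> (nat \<Rightarrow> int \<times> int \<times> int \<times> int)" and n z
  have aff: "affine_form I (\<lambda>n z. ?w n z s a)" if "a \<le> k" for s a
    using I fI that by (intro affine_form_branch_walk) auto
  have affz: "affine_form I (\<lambda>n z. z (f a))" if "a < k" for a
    using I fI that by (intro affine_form_var) auto
  have ec_good: "eventually_const I (\<lambda>n. good)"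
    unfolding good_def
    using affz by (intro eventually_const_ball eventually_const_iff eventually_const_conj eventually_const_triv
        eventually_const_eq I) auto
  have ec_valid: "eventually_const I (valid s)" for s
    unfolding valid_def
    by (intro eventually_const_conj[OF eventually_const_ball[OF _ eventually_const_link]]
        eventually_const_conj eventually_const_le eventually_const_less eventually_const_eq ec_good I
        affine_form_const affine_form_dim aff affz lk) auto
  have ec_eq: "eventually_const I (eq p)" for p
    unfolding eq_def by (intro eventually_const_ball eventually_const_eq I aff) auto
  have image: "(\<lambda>\<pi>. \<lambda>a\<in>{..k}. int (\<pi> a)) ` W n z = (\<lambda>s. restrict (?w n z s) {..k}) ` {s \<in> S. valid s n z}" for n z
  proof (intro equalityI subsetI)
    fix g assume "g \<in> (\<lambda>\<pi>. \<lambda>a\<in>{..k}. int (\<pi> a)) ` W n z"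
    then obtain \<pi> where pi: "\<pi> \<in> W n z" and g: "g = (\<lambda>a\<in>{..k}. int (\<pi> a))" by blast
    have walk: "\<pi> \<in> walks n k" and p0: "int (\<pi> 0) = z k" and el: "\<And>a. a < k \<Longrightarrow> el n \<pi> a = z (f a)" and gz: "good z"
      using pi by (auto simp: W_def)
    define s where "s = (\<lambda>a\<in>{..<k}. SOME b. b \<in> branches \<and> int (\<pi> (Suc a)) = branch_step b n (int (\<pi> a)) (z (f a)))"
    have s: "s a \<in> branches \<and> int (\<pi> (Suc a)) = branch_step (s a) n (int (\<pi> a)) (z (f a))" if a: "a < k" for a
    proof -
      have "\<exists>b. b \<in> branches \<and> int (\<pi> (Suc a)) = branch_step b n (int (\<pi> a)) (z (f a))"
        using link_branch[OF lk[OF a] walks_less[OF walk, of a] walks_less[OF walk, of "Suc a"]] a el[OF a]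
        by (auto simp: el_def)
      from someI_ex[OF this] show ?thesis using a by (simp add: s_def)
    qed
    have w: "?w n z s a = int (\<pi> a)" if "a \<le> k" for a
      using that by (induction a) (use s p0 in auto)
    have "s \<in> S" unfolding S_def by (rule PiE_I) (use s in \<open>auto simp: s_def\<close>)
    moreover have "valid s n z"
      using w walks_less[OF walk] walks_closed[OF walk] el gz by (auto simp: valid_def el_def simp del: branch_walk.simps)
    moreover have "g = restrict (?w n z s) {..k}"
      using w by (auto simp: g)
    ultimately show "g \<in> (\<lambda>s. restrict (?w n z s) {..k}) ` {s \<in> S. valid s n z}" by blast
  next
    fix g assume "g \<in> (\<lambda>s. restrict (?w n z s) {..k}) ` {s \<in> S. valid s n z}"
    then obtain s where v: "valid s n z" and g: "g = restrict (?w n z s) {..k}" by blast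
    have range: "0 \<le> ?w n z s a \<and> ?w n z s a < int n" if "a \<le> k" for a
    proof (cases a)
      case 0
      then show ?thesis using v by (simp add: valid_def del: branch_walk.simps)
    next
      case (Suc b)
      then show ?thesis using v that by (auto simp: valid_def simp del: branch_walk.simps)
    qed
    define \<pi> where "\<pi> = (\<lambda>a\<in>{..k}. nat (?w n z s a))"
    have int_pi: "int (\<pi> a) = ?w n z s a" if "a \<le> k" for a
      using range[OF that] that by (simp add: \<pi>_def)
    have "\<pi> \<in> W n z"
      unfolding W_def walks_def
    proof (intro CollectI conjI allI impI)
      show "\<pi> \<in> {..k} \<rightarrow>\<^sub>E {..<n}"
        using range by (auto simp: \<pi>_def nat_less_iff)
      show "\<pi> k = \<pi> 0" using v by (simp add: \<pi>_def valid_def)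
      show "int (\<pi> 0) = z k" using int_pi[of 0] by simp
      show "good z" using v by (simp add: valid_def)
      show "el n \<pi> a = z (f a)" if "a < k" for a
        using v that by (simp add: el_def \<pi>_def valid_def del: branch_walk.simps)
    qed
    moreover have "g = (\<lambda>a\<in>{..k}. int (\<pi> a))"
      using int_pi by (auto simp: g)
    ultimately show "g \<in> (\<lambda>\<pi>. \<lambda>a\<in>{..k}. int (\<pi> a)) ` W n z" by blast
  qed
  have "inj_on (\<lambda>\<pi>. \<lambda>a\<in>{..k}. int (\<pi> a)) (W n z)" for n z
  proof (rule inj_onI)
    fix \<pi> \<rho> assume *: "\<pi> \<in> W n z" "\<rho> \<in> W n z" "(\<lambda>a\<in>{..k}. int (\<pi> a)) = (\<lambda>a\<in>{..k}. int (\<rho> a))"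
    show "\<pi> = \<rho>"
    proof (rule PiE_ext)
      show "\<pi> \<in> {..k} \<rightarrow>\<^sub>E {..<n}" "\<rho> \<in> {..k} \<rightarrow>\<^sub>E {..<n}" using *(1,2) by (auto simp: W_def walks_def)
      show "\<pi> a = \<rho> a" if "a \<in> {..k}" for a using fun_cong[OF *(3), of a] that by simp
    qed
  qed
  then have card_W: "card (W n z) = card ((\<lambda>s. restrict (?w n z s) {..k}) ` {s \<in> S. valid s n z})" for n z
    using card_image image by metis
  have kernel: "restrict (?w n z s) {..k} = restrict (?w n z s') {..k} \<longleftrightarrow> eq (s, s') n z" for n z s s'
    by (auto simp: eq_def fun_eq_iff restrict_def)
  \<comment> \<open>Several branch sequences may describe the same walk, so walks are counted as
    classes of valid sequences under \<open>eq\<close>. The function \<open>h\<close> expresses this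
    number by the two truth tables alone.\<close>
  define h where "h v e = card ((\<lambda>s. {s' \<in> {s \<in> S. v s}. e (s', s)}) ` {s \<in> S. v s})" for v e
  have "card (W n z) = h (\<lambda>s\<in>S. valid s n z) (\<lambda>p\<in>S \<times> S. eq p n z)" for n z
  proof -
    have "card (W n z) = h (\<lambda>s. valid s n z) (\<lambda>p. eq p n z)"
      unfolding card_W h_def by (subst card_image_kernel) (simp only: kernel)
    moreover have "(\<lambda>s. {s' \<in> {s \<in> S. valid s n z}. eq (s', s) n z}) ` {s \<in> S. valid s n z} =
      (\<lambda>s. {s' \<in> {s \<in> S. (\<lambda>s\<in>S. valid s n z) s}. (\<lambda>p\<in>S \<times> S. eq p n z) (s', s)}) ` {s \<in> S. (\<lambda>s\<in>S. valid s n z) s}"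
      by (intro image_cong) auto
    ultimately show ?thesis unfolding h_def by (simp only:)
  qed
  moreover have "eventually_const I (\<lambda>n z. h (\<lambda>s\<in>S. valid s n z) (\<lambda>p\<in>S \<times> S. eq p n z))"
    by (rule eventually_const_comp2[where h = h])
      (intro eventually_const_restrict finS finite_cartesian_product ec_valid ec_eq)+
  ultimately have "eventually_const I (\<lambda>n z. card (W n z))"
    by (simp only:)
  moreover have "card (W n z) \<le> card S" for n z
    unfolding card_W using finS by (intro order_trans[OF card_image_le] card_mono) auto
  ultimately have "convergent (\<lambda>n. real (\<Sum>z\<in>?R n. card (W n z)) / real n ^ card I)"
    by (intro lattice_sum_convergent I)
  then show ?thesis
    unfolding card_C[symmetric] cardI el_def .
qed

section \<open>Wigner and patterned matrices\<close>

definition matrix_label ::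
  "(nat \<Rightarrow> nat \<Rightarrow> nat \<Rightarrow> nat \<Rightarrow> int) \<Rightarrow> nat \<Rightarrow> nat + nat \<Rightarrow> nat \<Rightarrow> nat \<Rightarrow> nat \<times> (int \<times> int) + nat \<times> int" where
  "matrix_label L n \<kappa> i j = (case \<kappa> of
     Inl q \<Rightarrow> Inl (q, wigner_link n (Suc i) (Suc j))
   | Inr q \<Rightarrow> Inr (q, L q n (Suc i) (Suc j)))"

text \<open>Tells apart the two columns of a row that may carry the same label. In the circulant case it
  says whether \<open>j - i\<close> modulo \<open>n\<close> is at most \<open>n / 2\<close>.\<close>

definition link_side :: "(nat \<Rightarrow> nat \<Rightarrow> nat \<Rightarrow> int) \<Rightarrow> nat \<Rightarrow> nat \<Rightarrow> nat \<Rightarrow> bool" where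
  "link_side l n i j \<longleftrightarrow>
     (if l = toeplitz_link then i \<le> j
      else if i \<le> j then 2 * (j - i) \<le> n else n \<le> 2 * (i - j))"

lemma link_side_inj:
  assumes l: "l \<in> pattern_links" and less: "i < n" "j < n" "j' < n"
    and lab: "l n (Suc i) (Suc j) = l n (Suc i) (Suc j')" and side: "link_side l n i j = link_side l n i j'"
  shows "j = j'"
proof -
  consider "l = toeplitz_link" | "l = hankel_link" | "l = symmetric_circulant_link" "l \<noteq> toeplitz_link"
    | "l = reverse_circulant_link"
    using l by (auto simp: pattern_links_def)
  then show ?thesis
  proof cases
    case 1
    then show ?thesis using lab side by (auto simp: toeplitz_link_def link_side_def abs_if split: if_splits)
  next
    case 2
    then show ?thesis using lab by (simp add: hankel_link_def)
  next
    case 3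
    \<comment> \<open>\<open>r k\<close> is the residue of \<open>k - i\<close> modulo
      \<open>n\<close>. The label is the smaller one of \<open>r k\<close> and
      \<open>n - r k\<close>, and the side decides which of them it is.\<close>
    define r where "r k = (if i \<le> k then int k - int i else int n - (int i - int k))" for k
    have side_r: "link_side l n i k \<longleftrightarrow> 2 * r k \<le> int n" for k
      using 3(2) by (auto simp: link_side_def r_def)
    have lab_r: "l n (Suc i) (Suc k) = (if 2 * r k \<le> int n then r k else int n - r k)" for k
      by (auto simp: 3(1) symmetric_circulant_link_eq min_def r_def)
    have "r j = r j'"
      using lab side unfolding side_r lab_r by (auto split: if_splits)
    then show ?thesis using less by (auto simp: r_def split: if_splits)
  next
    case 4
    have "(int (Suc i) + int (Suc j)) mod int n = (int (Suc i) + int (Suc j')) mod int n"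
      using lab by (simp only: 4 reverse_circulant_link_def)
    then have "int n dvd (int (Suc i) + int (Suc j)) - (int (Suc i) + int (Suc j'))"
      by (rule mod_eq_dvd_iff[THEN iffD1])
    then have dvd: "int n dvd int j - int j'" by simp
    have "int j - int j' = 0"
    proof (rule ccontr)
      assume "int j - int j' \<noteq> 0"
      then have "\<bar>int n\<bar> \<le> \<bar>int j - int j'\<bar>" using dvd by (rule dvd_imp_le_int)
      then show False using less by linarith
    qed
    then show ?thesis by simp
  qed
qed

text \<open>In a Wigner matrix the row and the label already determine the column, so a constant
  separates enough.\<close>

definition matrix_side :: "(nat \<Rightarrow> nat \<Rightarrow> nat \<Rightarrow> nat \<Rightarrow> int) \<Rightarrow> nat \<Rightarrow> nat + nat \<Rightarrow> nat \<Rightarrow> nat \<Rightarrow> bool" where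
  "matrix_side L n \<kappa> i j = (case \<kappa> of Inl q \<Rightarrow> True | Inr q \<Rightarrow> link_side (L q) n i j)"

abbreviation matrix_letters :: "nat \<Rightarrow> (nat + nat) set" where
  "matrix_letters p \<equiv> Sum_Type.Plus {1..p} {1..p}"

lemma link_rangeI: "i < n \<Longrightarrow> j < n \<Longrightarrow> l n (Suc i) (Suc j) \<in> link_range l"
  unfolding link_range_def using Suc_leI by fastforce

lemma wigner_link_eq_iff:
  "wigner_link n (Suc i) (Suc j) = wigner_link n (Suc i') (Suc j') \<longleftrightarrow> i = i' \<and> j = j' \<or> i = j' \<and> j = i'"
  by (auto simp: wigner_link_def min_def max_def split: if_splits)

lemma patterned_inputs_matrices:
  fixes M :: "'a measure"
  assumes M: "prob_space M"
    and links: "\<And>i. i \<in> {1..p} \<Longrightarrow> L i \<in> pattern_links"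
    and indep: "prob_space.indep_vars M (\<lambda>_. borel) (input_var x y) (input_index p L)"
    and mean: "\<And>k. k \<in> input_index p L \<Longrightarrow> prob_space.expectation M (input_var x y k) = 0"
    and variance: "\<And>k. k \<in> input_index p L \<Longrightarrow> prob_space.variance M (input_var x y k) = 1"
    and moments: "\<And>m :: nat. \<exists>C :: real. \<forall>k \<in> input_index p L.
      integrable M (\<lambda>\<omega>. \<bar>input_var x y k \<omega>\<bar> ^ m) \<and>
      prob_space.expectation M (\<lambda>\<omega>. \<bar>input_var x y k \<omega>\<bar> ^ m) \<le> C"
  shows "patterned_inputs M (input_var x y) (input_index p L) (matrix_letters p) (matrix_label L) (matrix_side L)"
proof -
  interpret prob_space M by (rule M)
  show ?thesis
  proof
    show "indep_vars (\<lambda>_. borel) (input_var x y) (input_index p L)" by (rule indep)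
    show "expectation (input_var x y t) = 0" if "t \<in> input_index p L" for t
      using mean[OF that] .
    show "expectation (\<lambda>\<omega>. input_var x y t \<omega> ^ 2) = 1" if "t \<in> input_index p L" for t
      using variance[OF that] mean[OF that] by simp
    show "\<exists>C. \<forall>t\<in>input_index p L. integrable M (\<lambda>\<omega>. \<bar>input_var x y t \<omega>\<bar> ^ m) \<and>
        expectation (\<lambda>\<omega>. \<bar>input_var x y t \<omega>\<bar> ^ m) \<le> C" for m
      by (rule moments)
    show "matrix_label L n \<kappa> i j \<in> input_index p L"
      if "\<kappa> \<in> matrix_letters p" "i < n" "j < n" for n \<kappa> i j
      using that by (auto simp: matrix_label_def input_index_def link_rangeI)
    show "\<kappa> = \<kappa>'" if "matrix_label L n \<kappa> i j = matrix_label L n \<kappa>' i' j'" for n \<kappa> \<kappa>' i j i' j'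
      using that by (auto simp: matrix_label_def split: sum.splits)
    show "j = j'" if "\<kappa> \<in> matrix_letters p" "i < n" "j < n" "j' < n"
      "matrix_label L n \<kappa> i j = matrix_label L n \<kappa> i j'" "matrix_side L n \<kappa> i j = matrix_side L n \<kappa> i j'"
      for n \<kappa> i j j'
    proof (cases \<kappa>)
      case (Inl q)
      then show ?thesis using that(5) by (auto simp: matrix_label_def wigner_link_eq_iff)
    next
      case (Inr q)
      then have "L q \<in> pattern_links" using that(1) links by auto
      then show ?thesis
        using that link_side_inj[of "L q" i n j j'] by (simp add: matrix_label_def matrix_side_def Inr)
    qed
  qed
qed

locale wigner_patterned =
  patterned_inputs M "input_var x y" "input_index p L" "matrix_letters p" "matrix_label L" "matrix_side L"
  for M :: "'a measure" and p :: nat and L :: "nat \<Rightarrow> nat \<Rightarrow> nat \<Rightarrow> nat \<Rightarrow> int"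
    and x :: "nat \<Rightarrow> int \<times> int \<Rightarrow> 'a \<Rightarrow> real" and y :: "nat \<Rightarrow> int \<Rightarrow> 'a \<Rightarrow> real" +
  assumes links: "\<And>i. i \<in> {1..p} \<Longrightarrow> L i \<in> pattern_links"
begin

lemma phi1_scaled_matrix:
  "phi1 n (mat_monomial n (\<lambda>k. scaled_matrix L x y n k \<omega>) ks) = normed_trace n ks \<omega>"
proof -
  let ?B = "\<lambda>k. scaled_matrix L x y n k \<omega>" and ?k = "length ks"
  have B: "?B k \<in> carrier_mat n n" for k
    by (auto simp: scaled_matrix_def patterned_matrix_def split: sum.splits)
  have entry: "?B k $$ (i, j) = input_var x y (matrix_label L n k i j) \<omega> / sqrt (real n)" if "i < n" "j < n" for k i j
    using that by (auto simp: scaled_matrix_def patterned_matrix_def matrix_label_def input_var_def split: sum.splits)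
  have "mat_trace (mat_monomial n ?B ks) = (\<Sum>\<pi>\<in>walks n ?k. \<Prod>a<?k. ?B (ks ! a) $$ (\<pi> a, \<pi> (Suc a)))"
    by (rule mat_trace_monomial[OF B])
  also have "\<dots> = (\<Sum>\<pi>\<in>walks n ?k. walk_prod n ks \<pi> \<omega> / sqrt (real n) ^ ?k)"
  proof (rule sum.cong[OF refl])
    fix \<pi> assume pi: "\<pi> \<in> walks n ?k"
    have "(\<Prod>a<?k. ?B (ks ! a) $$ (\<pi> a, \<pi> (Suc a))) =
        (\<Prod>a<?k. input_var x y (edge_label n ks \<pi> a) \<omega> / sqrt (real n))"
      using walks_less[OF pi] by (intro prod.cong refl) (simp add: entry edge_label_def)
    then show "(\<Prod>a<?k. ?B (ks ! a) $$ (\<pi> a, \<pi> (Suc a))) = walk_prod n ks \<pi> \<omega> / sqrt (real n) ^ ?k"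
      by (simp add: prod_dividef walk_prod_def)
  qed
  finally show ?thesis
    by (simp add: phi1_def normed_trace_def sum_divide_distrib[symmetric] mult.commute)
qed

lemma phi2_scaled_matrix:
  "phi2 M n (\<lambda>\<omega>. mat_monomial n (\<lambda>k. scaled_matrix L x y n k \<omega>) ks) = expectation (normed_trace n ks)"
proof -
  have "phi2 M n (\<lambda>\<omega>. mat_monomial n (\<lambda>k. scaled_matrix L x y n k \<omega>) ks) =
      expectation (\<lambda>\<omega>. phi1 n (mat_monomial n (\<lambda>k. scaled_matrix L x y n k \<omega>) ks))"
    by (simp add: phi2_def phi1_def)
  then show ?thesis by (simp add: phi1_scaled_matrix)
qed

lemma wigner_letter_Inl: "q \<in> {1..p} \<Longrightarrow> wigner_letter (Inl q)"
  unfolding wigner_letter_def by (auto simp: matrix_label_def wigner_link_eq_iff)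

text \<open>Up to a null sequence the expectation is a normalised number of pair walks. These are
  sorted by the coincidence pattern \<open>R\<close> of their labels, and each of the finitely many
  patterns is covered by \<open>pattern_walk_count\<close>.\<close>

lemma convergent_patterned:
  assumes ks: "ks \<in> lists (Inr ` {1..p})"
  shows "convergent (\<lambda>n. expectation (normed_trace n ks))"
proof (cases "ks = []")
  case True
  have "\<forall>\<^sub>F n in sequentially. expectation (normed_trace n ks) = 1"
  proof (intro eventually_sequentiallyI[of 1])
    fix n :: nat assume "1 \<le> n"
    then have "normed_trace n ks = (\<lambda>_. 1)" by (simp add: True normed_trace_Nil fun_eq_iff)
    then show "expectation (normed_trace n ks) = 1" by (simp add: prob_space)
  qed
  then show ?thesis by (intro convergentI[of _ 1] tendsto_eventually)
next
  case False
  define k where "k = length ks"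
  have K: "set ks \<subseteq> matrix_letters p" using ks by auto
  have ksa: "\<exists>q\<in>{1..p}. ks ! a = Inr q" if "a < k" for a
    using ks that nth_mem[of a ks] by (auto simp: k_def in_lists_conv_set)
  define lk where "lk a = L (projr (ks ! a))" for a
  have lk: "lk a \<in> pattern_links" if "a < k" for a
    using ksa[OF that] links by (auto simp: lk_def)
  have label: "edge_label n ks \<pi> a = edge_label n ks \<pi> b \<longleftrightarrow> ks ! a = ks ! b \<and>
      lk a n (Suc (\<pi> a)) (Suc (\<pi> (Suc a))) = lk b n (Suc (\<pi> b)) (Suc (\<pi> (Suc b)))"
    if "a < k" "b < k" for n \<pi> a b
    using ksa[OF that(1)] ksa[OF that(2)] by (auto simp: edge_label_def matrix_label_def lk_def)
  let ?ker = "\<lambda>n \<pi>. {d \<in> {..<k} \<times> {..<k}. edge_label n ks \<pi> (fst d) = edge_label n ks \<pi> (snd d)}"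
  have conv: "convergent (\<lambda>n. real (card {\<pi> \<in> pair_walks n ks. ?ker n \<pi> = R}) / (real n * sqrt (real n) ^ k))"
    for R
  proof (cases "\<exists>n0 \<pi>0. \<pi>0 \<in> pair_walks n0 ks \<and> ?ker n0 \<pi>0 = R")
    case False
    then have empty: "{\<pi> \<in> pair_walks n ks. ?ker n \<pi> = R} = {}" for n by blast
    show ?thesis unfolding empty by (simp add: convergent_const)
  next
    case True
    then obtain n0 \<pi>0 where p0: "\<pi>0 \<in> pair_walks n0 ks" "?ker n0 \<pi>0 = R" by blast
    let ?l0 = "edge_label n0 ks \<pi>0"
    \<comment> \<open>The least edge with the given label represents a class. The pattern is read
      off from one walk \<open>\<pi>0\<close> in one dimension \<open>n0\<close> but serves for all
      dimensions.\<close>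
    define f where "f a = (LEAST b. ?l0 b = ?l0 a)" for a
    have f_le: "f a \<le> a" for a unfolding f_def by (rule Least_le) simp
    have f_lab: "?l0 (f a) = ?l0 a" for a unfolding f_def by (rule LeastI[of _ a]) simp
    have f_iff: "f a = f b \<longleftrightarrow> ?l0 a = ?l0 b" for a b
      using f_lab[of a] f_lab[of b] by (metis f_def)
    have set_eq: "{\<pi> \<in> pair_walks n ks. ?ker n \<pi> = R} = {\<pi> \<in> walks n k. \<forall>a<k. \<forall>b<k.
      (ks ! a = ks ! b \<and> lk a n (Suc (\<pi> a)) (Suc (\<pi> (Suc a))) = lk b n (Suc (\<pi> b)) (Suc (\<pi> (Suc b)))) \<longleftrightarrow> f a = f b}" for n
    proof (rule Set.set_eqI)
      fix \<pi>
      have ker_iff: "?ker n \<pi> = R \<longleftrightarrow> (\<forall>a<k. \<forall>b<k. edge_label n ks \<pi> a = edge_label n ks \<pi> b \<longleftrightarrow> ?l0 a = ?l0 b)"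
        unfolding p0(2)[symmetric] set_eq_iff by (simp add: split_paired_all) blast
      have pair: "label_count n ks \<pi> a = 2" if "?ker n \<pi> = R" "a < k" for a
      proof -
        have "{b. b < length ks \<and> edge_label n ks \<pi> b = edge_label n ks \<pi> a} =
            {b. b < length ks \<and> ?l0 b = ?l0 a}"
          using that ker_iff by (auto simp: k_def)
        then have "label_count n ks \<pi> a = label_count n0 ks \<pi>0 a" by (simp add: label_count_def)
        then show ?thesis using p0(1) that(2) by (simp add: pair_walks_def k_def)
      qed
      have "\<pi> \<in> {\<pi> \<in> pair_walks n ks. ?ker n \<pi> = R} \<longleftrightarrow> \<pi> \<in> walks n k \<and> ?ker n \<pi> = R"
        using pair by (auto simp: pair_walks_def k_def)
      also have "\<dots> \<longleftrightarrow> \<pi> \<in> walks n k \<and> (\<forall>a<k. \<forall>b<k. (ks ! a = ks ! b \<and>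
          lk a n (Suc (\<pi> a)) (Suc (\<pi> (Suc a))) = lk b n (Suc (\<pi> b)) (Suc (\<pi> (Suc b)))) \<longleftrightarrow> f a = f b)"
        unfolding ker_iff f_iff using label by blast
      finally show "\<pi> \<in> {\<pi> \<in> pair_walks n ks. ?ker n \<pi> = R} \<longleftrightarrow> \<pi> \<in> {\<pi> \<in> walks n k. \<forall>a<k. \<forall>b<k.
          (ks ! a = ks ! b \<and> lk a n (Suc (\<pi> a)) (Suc (\<pi> (Suc a))) = lk b n (Suc (\<pi> b)) (Suc (\<pi> (Suc b)))) \<longleftrightarrow> f a = f b}"
        by simp
    qed
    have card_f: "2 * card (f ` {..<k}) = k"
    proof -
      have "k = (\<Sum>t\<in>f ` {..<k}. card {a \<in> {..<k}. f a = t})"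
        using sum.image_gen[of "{..<k}" "\<lambda>_. 1 :: nat" f] by simp
      also have "\<dots> = (\<Sum>t\<in>f ` {..<k}. 2)"
      proof (rule sum.cong[OF refl])
        fix t assume "t \<in> f ` {..<k}"
        then obtain a where a: "a < k" "t = f a" by auto
        have "label_count n0 ks \<pi>0 a = 2" using p0(1) a(1) by (simp add: pair_walks_def k_def)
        then show "card {a \<in> {..<k}. f a = t} = 2"
          by (simp add: a(2) f_iff label_count_def k_def)
      qed
      finally show ?thesis by simp
    qed
    \<comment> \<open>Paired labels form \<open>k / 2\<close> classes, so the half-integral
      normalisation is the integral power of \<open>n\<close> in
      \<open>pattern_walk_count\<close>.\<close>
    have norm: "real n * sqrt (real n) ^ k = real n ^ Suc (card (f ` {..<k}))" for n
    proof -
      have "sqrt (real n) ^ k = (sqrt (real n) ^ 2) ^ card (f ` {..<k})"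
        by (simp only: power_mult[symmetric] card_f)
      then show ?thesis by simp
    qed
    have fk: "f a < k" if "a < k" for a using f_le[of a] that by simp
    show ?thesis
      unfolding set_eq norm
      by (rule pattern_walk_count[where same = "\<lambda>a b. ks ! a = ks ! b", OF lk fk])
  qed
  have "real (card (pair_walks n ks)) / (real n * sqrt (real n) ^ k) =
      (\<Sum>R\<in>Pow ({..<k} \<times> {..<k}). real (card {\<pi> \<in> pair_walks n ks. ?ker n \<pi> = R}) / (real n * sqrt (real n) ^ k))" for n
  proof -
    have "finite (pair_walks n ks)"
      by (rule finite_subset[of _ "walks n (length ks)"]) (auto simp: pair_walks_def)
    then have "(\<Sum>R\<in>Pow ({..<k} \<times> {..<k}). \<Sum>\<pi>\<in>{\<pi> \<in> pair_walks n ks. ?ker n \<pi> = R}. 1 :: real) = (\<Sum>\<pi>\<in>pair_walks n ks. 1)"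
      by (intro sum.group) auto
    then show ?thesis by (simp add: sum_divide_distrib[symmetric])
  qed
  then have "convergent (\<lambda>n. real (card (pair_walks n ks)) / (real n * sqrt (real n) ^ k))"
    using conv by (simp only:) (rule convergent_sum)
  then have "convergent (\<lambda>n. (expectation (normed_trace n ks) - real (card (pair_walks n ks)) / (real n * sqrt (real n) ^ k)) +
      real (card (pair_walks n ks)) / (real n * sqrt (real n) ^ k))"
    using normed_trace_pair_walks[OF K False] unfolding k_def by (intro convergent_add) (auto intro: convergentI)
  then show ?thesis by simp
qed

text \<open>Passage to the limit in the Schwinger-Dyson equation: the vanishing covariance turns the
  expectation of a product of traces into a product of limits, both of them for words shorter than
  \<open>u\<close>.\<close>

lemma split_tendsto:
  assumes q: "q \<in> {1..p}" and u: "u \<in> lists (matrix_letters p)"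
    and IH: "\<And>v. v \<in> lists (matrix_letters p) \<Longrightarrow> length v < length u \<Longrightarrow>
      (\<lambda>n. expectation (normed_trace n v)) \<longlonglongrightarrow> m v"
  shows "(\<lambda>n. expectation (normed_trace n (Inl q # u))) \<longlonglongrightarrow>
    (\<Sum>c<length u. if u ! c = Inl q then m (take c u) * m (drop (Suc c) u) else 0)"
proof -
  let ?E = "\<lambda>n c. expectation (\<lambda>\<omega>. normed_trace n (take c u) \<omega> * normed_trace n (drop (Suc c) u) \<omega>)"
  have "(\<lambda>n. ?E n c) \<longlonglongrightarrow> m (take c u) * m (drop (Suc c) u)" if c: "c < length u" for c
  proof -
    have sub: "take c u \<in> lists (matrix_letters p)" "drop (Suc c) u \<in> lists (matrix_letters p)"
      using u by (auto simp: in_lists_conv_set dest: in_set_takeD in_set_dropD)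
    have "(\<lambda>n. (?E n c - expectation (normed_trace n (take c u)) * expectation (normed_trace n (drop (Suc c) u))) +
        expectation (normed_trace n (take c u)) * expectation (normed_trace n (drop (Suc c) u)))
      \<longlonglongrightarrow> 0 + m (take c u) * m (drop (Suc c) u)"
      using sub c by (intro tendsto_add tendsto_mult normed_trace_covariance IH) (auto simp: in_lists_conv_set)
    then show ?thesis by simp
  qed
  then have "(\<lambda>n. \<Sum>c<length u. if u ! c = Inl q then ?E n c else 0) \<longlonglongrightarrow>
      (\<Sum>c<length u. if u ! c = Inl q then m (take c u) * m (drop (Suc c) u) else 0)"
    by (intro tendsto_sum) auto
  moreover have "set u \<subseteq> matrix_letters p" using u by (auto simp: in_lists_conv_set)
  ultimately have "(\<lambda>n. (expectation (normed_trace n (Inl q # u)) - (\<Sum>c<length u. if u ! c = Inl q then ?E n c else 0)) +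
      (\<Sum>c<length u. if u ! c = Inl q then ?E n c else 0)) \<longlonglongrightarrow>
      0 + (\<Sum>c<length u. if u ! c = Inl q then m (take c u) * m (drop (Suc c) u) else 0)"
    using schwinger_dyson_asymptotic[OF wigner_letter_Inl[OF q]] by (intro tendsto_add)
  then show ?thesis by simp
qed

section \<open>The limit moments\<close>

text \<open>Traciality moves any Wigner letter to the front, where \<open>split_tendsto\<close>
  leaves only shorter words; words without such a letter are the base of the induction.\<close>

lemma convergent_moment:
  "ks \<in> lists (matrix_letters p) \<Longrightarrow> convergent (\<lambda>n. expectation (normed_trace n ks))"
proof (induction ks rule: length_induct)
  case (1 ks)
  show ?case
  proof (cases "ks \<in> lists (Inr ` {1..p})")
    case True
    then show ?thesis by (rule convergent_patterned)
  next
    case False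
    then obtain \<kappa> where "\<kappa> \<in> set ks" "\<kappa> \<notin> Inr ` {1..p}" by (auto simp: in_lists_conv_set)
    moreover from this have "\<kappa> \<in> matrix_letters p" using 1(2) by (auto simp: in_lists_conv_set)
    ultimately obtain q where q: "q \<in> {1..p}" "Inl q \<in> set ks" by auto
    then obtain us vs where ks: "ks = us @ Inl q # vs" by (meson split_list)
    have rot: "normed_trace n ks = normed_trace n (Inl q # (vs @ us))" for n
      using normed_trace_rotate[of n us "Inl q # vs"] by (simp add: ks fun_eq_iff)
    have u: "vs @ us \<in> lists (matrix_letters p)" using 1(2) by (auto simp: ks)
    have "(\<lambda>n. expectation (normed_trace n (Inl q # (vs @ us)))) \<longlonglongrightarrow>
      (\<Sum>c<length (vs @ us). if (vs @ us) ! c = Inl q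
         then Topological_Spaces.lim (\<lambda>n. expectation (normed_trace n (take c (vs @ us)))) *
           Topological_Spaces.lim (\<lambda>n. expectation (normed_trace n (drop (Suc c) (vs @ us)))) else 0)"
    proof (rule split_tendsto[OF q(1) u])
      fix v assume "v \<in> lists (matrix_letters p)" "length v < length (vs @ us)"
      then have "convergent (\<lambda>n. expectation (normed_trace n v))" using 1(1) by (simp add: ks)
      then show "(\<lambda>n. expectation (normed_trace n v)) \<longlonglongrightarrow>
          Topological_Spaces.lim (\<lambda>n. expectation (normed_trace n v))"
        by (simp add: convergent_LIMSEQ_iff)
    qed
    then show ?thesis unfolding rot by (rule convergentI)
  qed
qed

text \<open>Zero is a default value on words with foreign letters. It keeps the functional tracial
  on all words, because rotation does not change the set of letters.\<close>

definition limit_moment :: "(nat + nat) list \<Rightarrow> complex" where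
  "limit_moment ks = (if ks \<in> lists (matrix_letters p)
     then complex_of_real (Topological_Spaces.lim (\<lambda>n. expectation (normed_trace n ks))) else 0)"

lemma expectation_tendsto_lim:
  "ks \<in> lists (matrix_letters p) \<Longrightarrow> (\<lambda>n. expectation (normed_trace n ks)) \<longlonglongrightarrow>
     Topological_Spaces.lim (\<lambda>n. expectation (normed_trace n ks))"
  using convergent_moment by (simp add: convergent_LIMSEQ_iff)

sublocale limit: semicircular_functional limit_moment "Inl ` {1..p}" "matrix_letters p"
proof
  have "\<forall>\<^sub>F n in sequentially. expectation (normed_trace n []) = 1"
  proof (intro eventually_sequentiallyI[of 1])
    fix n :: nat assume "1 \<le> n"
    then have "normed_trace n [] = (\<lambda>_. 1)" by (simp add: normed_trace_Nil fun_eq_iff)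
    then show "expectation (normed_trace n []) = 1" by (simp add: prob_space)
  qed
  then have "(\<lambda>n. expectation (normed_trace n [])) \<longlonglongrightarrow> 1" by (rule tendsto_eventually)
  then show "limit_moment [] = 1" by (simp add: limit_moment_def limI)
  show "limit_moment (u @ v) = limit_moment (v @ u)" for u v
  proof -
    have "normed_trace n (u @ v) = normed_trace n (v @ u)" for n
      using normed_trace_rotate[of n u v] by (simp add: fun_eq_iff)
    then show ?thesis by (auto simp: limit_moment_def)
  qed
  show "limit_moment (s # u) = split_sum s u (\<lambda>a b. limit_moment a * limit_moment b)"
    if s: "s \<in> Inl ` {1..p}" and u: "u \<in> lists (matrix_letters p)" for s u
  proof -
    obtain q where q: "q \<in> {1..p}" "s = Inl q" using s by auto
    let ?m = "\<lambda>ks. Topological_Spaces.lim (\<lambda>n. expectation (normed_trace n ks))"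
    have "(\<lambda>n. expectation (normed_trace n (s # u))) \<longlonglongrightarrow>
      (\<Sum>c<length u. if u ! c = s then ?m (take c u) * ?m (drop (Suc c) u) else 0)"
      unfolding q(2) by (rule split_tendsto[OF q(1) u expectation_tendsto_lim])
    then have "?m (s # u) = (\<Sum>c<length u. if u ! c = s then ?m (take c u) * ?m (drop (Suc c) u) else 0)"
      by (rule limI)
    moreover have "s # u \<in> lists (matrix_letters p)" using s u by auto
    moreover have "take c u \<in> lists (matrix_letters p)" "drop (Suc c) u \<in> lists (matrix_letters p)" for c
      using u by (auto simp: in_lists_conv_set dest: in_set_takeD in_set_dropD)
    ultimately show ?thesis
      by (auto simp: limit_moment_def split_sum_def intro!: sum.cong)
  qed
qed auto

lemma phi2_tendsto:
  assumes "ks \<in> lists (matrix_letters p)"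
  shows "(\<lambda>n. complex_of_real (phi2 M n (\<lambda>\<omega>. mat_monomial n (\<lambda>k. scaled_matrix L x y n k \<omega>) ks)))
    \<longlonglongrightarrow> limit_moment ks"
  unfolding phi2_scaled_matrix using assms
  by (simp add: limit_moment_def tendsto_of_real expectation_tendsto_lim)

text \<open>There are countably many words, so the exceptional null sets can be united.\<close>

lemma phi1_tendsto:
  "AE \<omega> in M. \<forall>ks\<in>lists (matrix_letters p).
     (\<lambda>n. complex_of_real (phi1 n (mat_monomial n (\<lambda>k. scaled_matrix L x y n k \<omega>) ks)))
       \<longlonglongrightarrow> limit_moment ks"
proof (rule AE_ball_countable[THEN iffD2, rule_format])
  show "countable (lists (matrix_letters p))"
    by (intro countable_lists countable_finite) simp
  fix ks assume ks: "ks \<in> lists (matrix_letters p)"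
  then have "set ks \<subseteq> matrix_letters p" by (auto simp: in_lists_conv_set)
  from normed_trace_AE[OF this]
  show "AE \<omega> in M. (\<lambda>n. complex_of_real (phi1 n (mat_monomial n (\<lambda>k. scaled_matrix L x y n k \<omega>) ks)))
       \<longlonglongrightarrow> limit_moment ks"
  proof eventually_elim
    case (elim \<omega>)
    have "(\<lambda>n. (normed_trace n ks \<omega> - expectation (normed_trace n ks)) + expectation (normed_trace n ks))
        \<longlonglongrightarrow> 0 + Topological_Spaces.lim (\<lambda>n. expectation (normed_trace n ks))"
      by (intro tendsto_add elim expectation_tendsto_lim ks)
    then show ?case
      using ks by (simp add: phi1_scaled_matrix limit_moment_def tendsto_of_real)
  qed
qed

end

theorem theorem3p4:
  fixes M :: "'a measure"
    and p :: nat
    and L :: "nat \<Rightarrow> nat \<Rightarrow> nat \<Rightarrow> nat \<Rightarrow> int"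
    and x :: "nat \<Rightarrow> int \<times> int \<Rightarrow> 'a \<Rightarrow> real"
    and y :: "nat \<Rightarrow> int \<Rightarrow> 'a \<Rightarrow> real"
  assumes "prob_space M"
    and "p \<ge> 1"
    and links: "\<And>i. i \<in> {1..p} \<Longrightarrow>
      L i \<in> {toeplitz_link, hankel_link, symmetric_circulant_link, reverse_circulant_link}"
    and indep: "prob_space.indep_vars M (\<lambda>_. borel) (input_var x y) (input_index p L)"
    and mean: "\<And>k. k \<in> input_index p L \<Longrightarrow> prob_space.expectation M (input_var x y k) = 0"
    and variance: "\<And>k. k \<in> input_index p L \<Longrightarrow> prob_space.variance M (input_var x y k) = 1"
    and moments: "\<And>m :: nat. \<exists>C :: real. \<forall>k \<in> input_index p L.
      integrable M (\<lambda>\<omega>. \<bar>input_var x y k \<omega>\<bar> ^ m) \<and>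
      prob_space.expectation M (\<lambda>\<omega>. \<bar>input_var x y k \<omega>\<bar> ^ m) \<le> C"
  shows "\<exists>(\<A> :: (complex, (nat + nat) list \<Rightarrow> complex) module) \<phi> s a.
      nc_prob_space \<A> \<phi> \<and>
      (\<forall>i \<in> {1..p}. s i \<in> carrier \<A> \<and> a i \<in> carrier \<A>) \<and>
      (\<forall>ks \<in> lists (Sum_Type.Plus {1..p} {1..p}).
        (\<lambda>n. complex_of_real (phi2 M n (\<lambda>\<omega>. mat_monomial n (\<lambda>k. scaled_matrix L x y n k \<omega>) ks)))
          \<longlonglongrightarrow> \<phi> (alg_monomial \<A> (case_sum s a) ks)) \<and>
      (AE \<omega> in M. \<forall>ks \<in> lists (Sum_Type.Plus {1..p} {1..p}).
        (\<lambda>n. complex_of_real (phi1 n (mat_monomial n (\<lambda>k. scaled_matrix L x y n k \<omega>) ks)))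
          \<longlonglongrightarrow> \<phi> (alg_monomial \<A> (case_sum s a) ks)) \<and>
      free_subalgebras \<A> \<phi> (UNIV :: bool set)
        (\<lambda>b. generated_subalgebra \<A> (if b then s ` {1..p} else a ` {1..p}))"
proof -
  have links': "L i \<in> pattern_links" if "i \<in> {1..p}" for i
    using links[OF that] by (simp add: pattern_links_def)
  interpret wigner_patterned M p L x y
    using patterned_inputs_matrices[OF assms(1) links' indep mean variance moments] links'
    by (intro wigner_patterned.intro wigner_patterned_axioms.intro) simp_all
  \<comment> \<open>The limit elements are the letters of the free algebra. A monomial in them is a
    single word, at which the functional is the limit moment by construction.\<close>
  let ?s = "\<lambda>i. word [Inl i :: nat + nat]" and ?a = "\<lambda>i. word [Inr i :: nat + nat]"
  have "case_sum ?s ?a = (\<lambda>k. word [k])" by (auto simp: fun_eq_iff split: sum.splits)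
  then have word: "linear_ext limit_moment (alg_monomial free_algebra (case_sum ?s ?a) ks) = limit_moment ks" for ks
    using alg_monomial_word[of "\<lambda>k. k" ks] by (simp add: linear_ext_word)
  have gen: "(if b then ?s ` {1..p} else ?a ` {1..p}) \<subseteq> word_subalgebra (limit.letters b)" for b
    unfolding limit.letters_def word_subalgebra_def by (auto simp: support_word)
  show ?thesis
  proof (rule exI[of _ free_algebra], rule exI[of _ "linear_ext limit_moment"], rule exI[of _ ?s],
      rule exI[of _ ?a], unfold word, intro conjI)
    show "nc_prob_space free_algebra (linear_ext limit_moment)"
      by (rule nc_prob_space_free_algebra) (rule limit.phi_Nil)
    show "\<forall>i\<in>{1..p}. ?s i \<in> carrier free_algebra \<and> ?a i \<in> carrier free_algebra"
      by (simp add: support_word)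
    show "free_subalgebras free_algebra (linear_ext limit_moment) UNIV
        (\<lambda>b. generated_subalgebra free_algebra (if b then ?s ` {1..p} else ?a ` {1..p}))"
      by (rule limit.free_subalgebras_generated[OF gen])
  qed (use phi2_tendsto phi1_tendsto in blast)+
qed

end
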